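(* Let $(Z,a(Z))$ be positive generic stability data on $\mathfrak{g}$. The function $$X(z,Z)(e_\alpha)=X^0(z,Z)(e_\alpha)\exp_*\Big\langle\alpha,-\sum_TW_T(Z)G_T(z,Z)\Big\rangle$$ (sum over all connected rooted trees decorated by $\Gamma$) is an algebra automorphism which satisfies: (1) $X(z,Z)$ is an $\operatorname{Aut}^*(\widehat{\mathfrak{g}})$-valued holomorphic function of $z$ in the complement of the rays $\ell_\gamma(Z)$ with $a(\gamma)\ne0$; (2) $X(z,Z)(e_\alpha)$ extends to a holomorphic function with values in $\widehat{\mathfrak{g}}$ in a neighbourhood of $\ell_\alpha(Z)$; (3) for every ray $\ell\subset\mathbb{H}'$ and $z_0\in\ell$, the limits $X(z_0^+)$ and $X(z_0^-)$ of $X(z,Z)$ as $z\to z_0$ in the counterclockwise, respectively clockwise, direction both exist, and $X(z_0^+)=X(z_0^-)\operatorname{Ad}S_\ell$; (4) there exists $g(Z)\in\operatorname{Aut}^*(\widehat{\mathfrak{g}})$ such that $\lim_{z\to0}X(z,Z)e^{-Z/z}=g(Z)$ along directions non-tangential to anti-Stokes rays. The automorphism $g(Z)$ of (4) is given by $$g(Z)(e_\alpha)=e_\alpha*\exp_*\Big\langle\alpha,-\sum_TW_TG_T^0(Z)\Big\rangle,$$ $$G^0_T(Z)=\frac{1}{4\pi i}\int_{\ell_{\gamma_T}}\frac{dz'}{z'}X^0(z',Z)(e_{\gamma_T})\prod_{T'}G_{T'}(z',Z),$$ where $T'$ runs over the trees obtained by removing the root of $T$.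
   Context: Algebras. $\Gamma$ is a lattice of finite rank with an integral skew-symmetric form $\langle-,-\rangle$. $\mathfrak{g}$ is the complex Lie algebra with basis $e_\gamma$ ($\gamma\in\Gamma$), bracket $[e_\gamma,e_\eta]=\langle\gamma,\eta\rangle e_{\gamma+\eta}$ and commutative product $e_\gamma*e_\eta=e_{\gamma+\eta}$. Fix a strictly convex cone $\Gamma_{\ge0}\subset\Gamma$; $\mathfrak{g}_{\ge0}$ is spanned by $e_\gamma$, $\gamma\in\Gamma_{\ge0}$; $\mathfrak{g}_{>k}$ ($k\ge1$) is the ideal given by the cone generated by sums of more than $k$ nonzero elements of $\Gamma_{\ge0}$; $\mathfrak{g}_{\le k}=\mathfrak{g}_{\ge0}/\mathfrak{g}_{>k}$, $\widehat{\mathfrak{g}}=\varprojlim\mathfrak{g}_{\le k}$. $\operatorname{Aut}^*(\widehat{\mathfrak{g}})$: automorphisms of $(\widehat{\mathfrak{g}},* )$; $\exp_*$ is the exponential for $*$. Holomorphy and limits are understood in each finite-dimensional quotient $\mathfrak{g}_{\le k}$, where only the finitely many rays $\ell_\gamma$ with $a(\gamma)$ nonzero in $\mathfrak{g}_{\le k}$ matter; limits are not required to be uniform in $k$. The pairing is extended by $\langle\alpha,\gamma\otimes x\rangle=\langle\alpha,\gamma\rangle x$ on $\Gamma\otimes\widehat{\mathfrak{g}}$. Stability data. $Z\in\operatorname{Hom}(\Gamma,\mathbb{C})$ (acting by $e_\alpha\mapsto Z(\alpha)e_\alpha$), $a(\gamma)=-\mathrm{DT}(\gamma)e_\gamma$,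 $\mathrm{DT}(\gamma)=\sum_{n\ge1,n|\gamma}\Omega(\gamma/n)/n^2\in\mathbb{Q}$, with $\|\gamma\|\le C|Z(\gamma)|$ when $a(\gamma)\ne0$. Positive: $a(\gamma)\ne0\Rightarrow\gamma\in\Gamma_{\ge0}$. Generic: $a(\gamma),a(\eta)\ne0$ and $\ell_\gamma(Z)=\ell_\eta(Z)$ imply $\langle\gamma,\eta\rangle=0$. Here $\ell_\gamma(Z)=-\mathbb{R}_{>0}Z(\gamma)$ are the anti-Stokes rays; those with $a(\gamma)\ne0$ lie in a fixed half-plane $\mathbb{H}'$. $\operatorname{Ad}S_\ell(e_\alpha)=e_\alpha\prod_{Z(\gamma)\in-\ell}(1-e_\gamma)^{\Omega(\gamma)\langle\gamma,\alpha\rangle}$. Explicit functions. $\rho(z,z')=\frac{1}{4\pi i}\frac{z'+z}{z'-z}$; $X^0(z,Z)(e_\alpha)=e_\alpha\exp(z^{-1}Z(\alpha)+z\bar Z(\alpha))$. For a connected finite rooted tree $T$ with vertices decorated by $\alpha:T^0\to\Gamma$ and root decoration $\gamma_T$, $$W_T=\frac{\mathrm{DT}(\gamma_T)\gamma_T}{|\mathrm{Aut}(T)|}\prod_{v\to w}\langle\mathrm{DT}(\alpha(v))\alpha(v),\alpha(w)\rangle\in\Gamma\otimes\mathbb{Q}$$ (edges $v\to w$ oriented towards the root, $\mathrm{Aut}(T)$ automorphisms of the decorated rooted tree), and recursively $$G_T(z,Z)=\int_{\ell_{\gamma_T}}\frac{dz'}{z'}\rho(z,z')X^0(z',Z)(e_{\gamma_T})\prod_{T'}G_{T'}(z',Z)$$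 over the trees $T'$ obtained by removing the root of $T$ (empty product $=1$). "$z\to z_0$ in the counterclockwise direction" means that $z$ approaches $z_0\in\ell$ while moving counterclockwise.
   Formalization: Part (2) is stated for α in Γ_{≥0} with Z(α)≠0 and ⟨γ,α⟩=0 for all γ with a(γ)≠0 and ℓ_γ=ℓ_α (automatic if a(α)≠0); for other α with a ray, X(e_α) can jump across ℓ_α by (3), so (2) is false as stated. *)

theory Defs
  imports "HOL-Analysis.Analysis" "HOL-Combinatorics.Permutations"
begin

text \<open>
  The lattice \<open>\<Gamma>\<close> is \<open>int ^ 'n\<close>. A family \<open>x : \<Gamma> \<rightarrow> \<complex>\<close> stands for the formal sum
  of the \<open>x \<gamma> \<cdot> e\<^sub>\<gamma>\<close>.
\<close>

type_synonym 'n lat = "int ^ 'n"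
type_synonym 'n ser = "int ^ 'n \<Rightarrow> complex"

definition skew_form :: "('n::finite lat \<Rightarrow> 'n lat \<Rightarrow> int) \<Rightarrow> bool" where
  "skew_form pr \<longleftrightarrow>
     (\<forall>a b c. pr (a + b) c = pr a c + pr b c) \<and>
     (\<forall>a b c. pr a (b + c) = pr a b + pr a c) \<and>
     (\<forall>a b. pr a b = - pr b a)"


section \<open>The completed algebra\<close>

definition strictly_convex_cone :: "'n::finite lat set \<Rightarrow> bool" where
  "strictly_convex_cone C \<longleftrightarrow>
     0 \<in> C \<and> (\<forall>a\<in>C. \<forall>b\<in>C. a + b \<in> C) \<and> (\<forall>a. a \<in> C \<and> - a \<in> C \<longrightarrow> a = 0)"

text \<open>
  The exponents of \<open>\<gg>\<^sub>>\<^sub>k\<close>. This set is already closed under adding elements of the cone.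
\<close>

definition cone_gt :: "'n::finite lat set \<Rightarrow> nat \<Rightarrow> 'n lat set" where
  "cone_gt C k = {sum_list xs |xs. set xs \<subseteq> C - {0} \<and> length xs > k}"

text \<open>
  The quotient \<open>\<gg>\<^sub>\<le>\<^sub>k\<close> has the basis \<open>e\<^sub>\<gamma>\<close> for \<open>\<gamma>\<close> in \<open>basis_le C k\<close>, and the transition maps
  forget coefficients. When these sets are finite, a compatible family is the same thing as a
  function on their union (lemma \<open>ghat_inverse_limit\<close>). A basis vector \<open>e\<^sub>\<alpha>\<close> with \<open>\<alpha>\<close>
  outside this union is zero in the inverse limit.
\<close>

definition basis_le :: "'n::finite lat set \<Rightarrow> nat \<Rightarrow> 'n lat set" where
  "basis_le C k = C - cone_gt C k"

definition basis_hat :: "'n::finite lat set \<Rightarrow> 'n lat set" where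
  "basis_hat C = (\<Union>k\<in>{1..}. basis_le C k)"

definition ghat :: "'n::finite lat set \<Rightarrow> 'n ser set" where
  "ghat C = {x. \<forall>\<gamma>. x \<gamma> \<noteq> 0 \<longrightarrow> \<gamma> \<in> basis_hat C}"

lemma basis_le_mono: "k \<le> l \<Longrightarrow> basis_le C k \<subseteq> basis_le C l"
  by (auto simp: basis_le_def cone_gt_def)

lemma ghat_inverse_limit:
  "bij_betw (\<lambda>x k \<gamma>. if \<gamma> \<in> basis_le C (Suc k) then x \<gamma> else 0) (ghat C)
     {y :: nat \<Rightarrow> 'n::finite ser.
        (\<forall>k \<gamma>. y k \<gamma> \<noteq> 0 \<longrightarrow> \<gamma> \<in> basis_le C (Suc k)) \<and>
        (\<forall>k. \<forall>\<gamma>\<in>basis_le C (Suc k). y (Suc k) \<gamma> = y k \<gamma>)}"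
  (is "bij_betw ?f _ ?L")
proof (rule bij_betw_imageI)
  show "inj_on ?f (ghat C)"
  proof (rule inj_onI, rule ext)
    fix x y \<gamma> assume x: "x \<in> ghat C" and y: "y \<in> ghat C" and eq: "?f x = ?f y"
    show "x \<gamma> = y \<gamma>"
    proof (cases "\<gamma> \<in> basis_hat C")
      case True
      then obtain k where "k \<ge> 1" "\<gamma> \<in> basis_le C k" by (auto simp: basis_hat_def)
      then have "\<gamma> \<in> basis_le C (Suc (k - 1))" by simp
      with fun_cong[OF fun_cong[OF eq, of "k - 1"], of \<gamma>] show ?thesis by simp
    next
      case False
      with x y show ?thesis unfolding ghat_def by force
    qed
  qed
  show "?f ` ghat C = ?L"
  proof
    show "?f ` ghat C \<subseteq> ?L"
    proof -
      have "\<gamma> \<in> basis_le C (Suc (Suc k))" if "\<gamma> \<in> basis_le C (Suc k)" for \<gamma> k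
        using that basis_le_mono[of "Suc k" "Suc (Suc k)" C] by auto
      then show ?thesis by (auto split: if_splits)
    qed
    show "?L \<subseteq> ?f ` ghat C"
    proof
      fix y assume y: "y \<in> ?L"
      have stab: "y m \<gamma> = y k \<gamma>" if "k \<le> m" "\<gamma> \<in> basis_le C (Suc k)" for k m \<gamma>
        using that
      proof (induction m rule: dec_induct)
        case (step m)
        then have "\<gamma> \<in> basis_le C (Suc m)"
          using basis_le_mono[of "Suc k" "Suc m" C] by auto
        with step y show ?case by auto
      qed simp
      define x where "x \<gamma> = (if \<gamma> \<in> basis_hat C then y (LEAST k. \<gamma> \<in> basis_le C (Suc k)) \<gamma> else 0)" for \<gamma>
      have val: "x \<gamma> = y k \<gamma>" if g: "\<gamma> \<in> basis_le C (Suc k)" for k \<gamma>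
      proof -
        have "\<gamma> \<in> basis_hat C" using g by (auto simp: basis_hat_def intro!: bexI[of _ "Suc k"])
        then show ?thesis
          using stab[OF Least_le[of "\<lambda>k. \<gamma> \<in> basis_le C (Suc k)", OF g]
              LeastI[of "\<lambda>k. \<gamma> \<in> basis_le C (Suc k)", OF g]]
          by (simp add: x_def)
      qed
      have "x \<in> ghat C" by (auto simp: ghat_def x_def)
      moreover have "?f x = y"
        using y by (intro ext) (auto simp: val)
      ultimately show "y \<in> ?f ` ghat C" by blast
    qed
  qed
qed

definition be :: "'n::finite lat set \<Rightarrow> 'n lat \<Rightarrow> 'n ser" where
  "be C \<alpha> = (\<lambda>\<gamma>. if \<gamma> = \<alpha> \<and> \<alpha> \<in> basis_hat C then 1 else 0)"

definition hmult :: "'n::finite lat set \<Rightarrow> 'n ser \<Rightarrow> 'n ser \<Rightarrow> 'n ser" where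
  "hmult C x y = (\<lambda>\<gamma>. if \<gamma> \<in> basis_hat C
     then (\<Sum>(a, b)\<in>{(a, b). a \<in> basis_hat C \<and> b \<in> basis_hat C \<and> a + b = \<gamma>}. x a * y b)
     else 0)"

definition hpow :: "'n::finite lat set \<Rightarrow> 'n ser \<Rightarrow> nat \<Rightarrow> 'n ser" where
  "hpow C x m = (hmult C x ^^ m) (be C 0)"

definition hprod_mset :: "'n::finite lat set \<Rightarrow> 'n ser multiset \<Rightarrow> 'n ser" where
  "hprod_mset C M = fold_mset (hmult C) (be C 0) M"

definition hexp :: "'n::finite lat set \<Rightarrow> 'n ser \<Rightarrow> 'n ser" where
  "hexp C x = (\<lambda>\<gamma>. \<Sum>m. hpow C x m \<gamma> / fact m)"

text \<open>The power \<open>(1 - x)\<^sup>c\<close>, by the binomial series.\<close>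

definition hone_minus_pow :: "'n::finite lat set \<Rightarrow> 'n ser \<Rightarrow> complex \<Rightarrow> 'n ser" where
  "hone_minus_pow C x c = (\<lambda>\<gamma>. \<Sum>m. (c gchoose m) * (- 1) ^ m * hpow C x m \<gamma>)"

text \<open>The continuous linear map with \<open>e\<^sub>\<alpha> \<mapsto> \<phi> \<alpha>\<close>.\<close>

definition hext :: "'n::finite lat set \<Rightarrow> ('n lat \<Rightarrow> 'n ser) \<Rightarrow> 'n ser \<Rightarrow> 'n ser" where
  "hext C \<phi> x = (\<lambda>\<gamma>. \<Sum>\<^sub>\<infinity>\<alpha>\<in>basis_hat C. x \<alpha> * \<phi> \<alpha> \<gamma>)"

lemma hext_be: "\<alpha> \<in> basis_hat C \<Longrightarrow> hext C \<phi> (be C \<alpha>) = \<phi> \<alpha>"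
proof (rule ext)
  fix \<gamma> assume a: "\<alpha> \<in> basis_hat C"
  have "hext C \<phi> (be C \<alpha>) \<gamma> = (\<Sum>\<^sub>\<infinity>\<beta>\<in>{\<alpha>}. be C \<alpha> \<beta> * \<phi> \<beta> \<gamma>)"
    unfolding hext_def by (rule infsum_cong_neutral) (use a in \<open>auto simp: be_def\<close>)
  also have "\<dots> = \<phi> \<alpha> \<gamma>" using a by (simp add: be_def)
  finally show "hext C \<phi> (be C \<alpha>) \<gamma> = \<phi> \<alpha> \<gamma>" .
qed

definition Aut_hat :: "'n::finite lat set \<Rightarrow> ('n ser \<Rightarrow> 'n ser) set" where
  "Aut_hat C = {\<Phi>. bij_betw \<Phi> (ghat C) (ghat C) \<and>
     (\<forall>x\<in>ghat C. \<forall>y\<in>ghat C. \<Phi> (\<lambda>\<gamma>. x \<gamma> + y \<gamma>) = (\<lambda>\<gamma>. \<Phi> x \<gamma> + \<Phi> y \<gamma>)) \<and>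
     (\<forall>c. \<forall>x\<in>ghat C. \<Phi> (\<lambda>\<gamma>. c * x \<gamma>) = (\<lambda>\<gamma>. c * \<Phi> x \<gamma>)) \<and>
     (\<forall>x\<in>ghat C. \<forall>y\<in>ghat C. \<Phi> (hmult C x y) = hmult C (\<Phi> x) (\<Phi> y))}"

text \<open>
  An element \<open>v\<close> of \<open>\<Gamma> \<otimes> \<gg>\<close> (completed) is the vector of its components in the standard
  basis of \<open>\<Gamma>\<close>, and the pairing is extended by \<open>\<langle>\<alpha>, \<gamma> \<otimes> x\<rangle> = \<langle>\<alpha>, \<gamma>\<rangle> x\<close>.
\<close>

definition pair_tensor ::
  "('n::finite lat \<Rightarrow> 'n lat \<Rightarrow> int) \<Rightarrow> 'n lat \<Rightarrow> 'n ser ^ 'n \<Rightarrow> 'n ser" where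
  "pair_tensor pr \<alpha> v = (\<lambda>\<eta>. \<Sum>i\<in>UNIV. of_int (pr \<alpha> (axis i 1)) * (v $ i) \<eta>)"


section \<open>Stability data\<close>

text \<open>
  The data are given by \<open>\<Omega>\<close>, which determines \<open>DT\<close> and is determined by it through Moebius
  inversion. Since \<open>a(\<gamma>) = - DT(\<gamma>) e\<^sub>\<gamma>\<close>, the condition \<open>a(\<gamma>) \<noteq> 0\<close> reads \<open>DT Om \<gamma> \<noteq> 0\<close>. The vector
  \<open>\<gamma> = 0\<close>, divisible by every \<open>n\<close>, carries no datum.
\<close>

definition DT :: "('n::finite lat \<Rightarrow> rat) \<Rightarrow> 'n lat \<Rightarrow> rat" where
  "DT Om \<gamma> = (if \<gamma> = 0 then 0
     else (\<Sum>n\<in>{n::nat. n \<ge> 1 \<and> (\<forall>i. int n dvd \<gamma> $ i)}.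
             Om (\<chi> i. \<gamma> $ i div int n) / (of_nat n)\<^sup>2))"

text \<open>All norms on \<open>\<Gamma> \<otimes> \<real>\<close> give the same support condition; this is the Euclidean one.\<close>

definition stability_data :: "('n::finite lat \<Rightarrow> rat) \<Rightarrow> ('n lat \<Rightarrow> complex) \<Rightarrow> bool" where
  "stability_data Om Z \<longleftrightarrow>
     (\<forall>a b. Z (a + b) = Z a + Z b) \<and>
     (\<exists>K>0. \<forall>\<gamma>. DT Om \<gamma> \<noteq> 0 \<longrightarrow>
        norm (\<chi> i. real_of_int (\<gamma> $ i)) \<le> K * cmod (Z \<gamma>))"

definition ray :: "complex \<Rightarrow> complex set" where
  "ray w = {of_real t * w |t. t > 0}"

definition ell :: "('n::finite lat \<Rightarrow> complex) \<Rightarrow> 'n lat \<Rightarrow> complex set" where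
  "ell Z \<gamma> = ray (- Z \<gamma>)"

definition positive_data :: "'n::finite lat set \<Rightarrow> ('n lat \<Rightarrow> rat) \<Rightarrow> bool" where
  "positive_data C Om \<longleftrightarrow> (\<forall>\<gamma>. DT Om \<gamma> \<noteq> 0 \<longrightarrow> \<gamma> \<in> C)"

definition generic_data ::
  "('n::finite lat \<Rightarrow> 'n lat \<Rightarrow> int) \<Rightarrow> ('n lat \<Rightarrow> rat) \<Rightarrow> ('n lat \<Rightarrow> complex) \<Rightarrow> bool" where
  "generic_data pr Om Z \<longleftrightarrow>
     (\<forall>\<gamma> \<eta>. DT Om \<gamma> \<noteq> 0 \<and> DT Om \<eta> \<noteq> 0 \<and> ell Z \<gamma> = ell Z \<eta> \<longrightarrow> pr \<gamma> \<eta> = 0)"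

text \<open>Open, closed and half-open half-planes are all admitted.\<close>

definition half_plane :: "complex set \<Rightarrow> bool" where
  "half_plane H \<longleftrightarrow> (\<exists>w. w \<noteq> 0 \<and> {z. inner w z > 0} \<subseteq> H \<and> H \<subseteq> {z. inner w z \<ge> 0})"

text \<open>
  For \<open>A = UNIV\<close> the complement of all active rays in the punctured plane; for
  \<open>A = basis_le C k\<close> that of the finitely many rays active in \<open>\<gg>\<^sub>\<le>\<^sub>k\<close>.
\<close>

definition off_rays ::
  "('n::finite lat \<Rightarrow> rat) \<Rightarrow> ('n lat \<Rightarrow> complex) \<Rightarrow> 'n lat set \<Rightarrow> complex set" where
  "off_rays Om Z A = {z. z \<noteq> 0 \<and> (\<forall>\<gamma>\<in>A. DT Om \<gamma> \<noteq> 0 \<longrightarrow> z \<notin> ell Z \<gamma>)}"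

text \<open>
  In the infinite product, every factor with \<open>\<gamma>\<close> outside \<open>basis_le C k\<close> is \<open>1\<close> in \<open>\<gg>\<^sub>\<le>\<^sub>k\<close>
  (\<open>\<Omega>(\<gamma>) = 0\<close> for \<open>\<gamma>\<close> outside the cone), so each coefficient is eventually constant in \<open>k\<close>.
\<close>

definition AdS_basis ::
  "('n::finite lat \<Rightarrow> 'n lat \<Rightarrow> int) \<Rightarrow> 'n lat set \<Rightarrow> ('n lat \<Rightarrow> rat) \<Rightarrow> ('n lat \<Rightarrow> complex)
     \<Rightarrow> complex set \<Rightarrow> 'n lat \<Rightarrow> 'n ser" where
  "AdS_basis pr C Om Z l \<alpha> = hmult C (be C \<alpha>)
     (\<lambda>\<eta>. lim (\<lambda>k. hprod_mset C
        (image_mset (\<lambda>\<gamma>. hone_minus_pow C (be C \<gamma>) (of_rat (Om \<gamma> * of_int (pr \<gamma> \<alpha>))))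
          (mset_set {\<gamma> \<in> basis_le C k. - Z \<gamma> \<in> l})) \<eta>))"

definition AdS ::
  "('n::finite lat \<Rightarrow> 'n lat \<Rightarrow> int) \<Rightarrow> 'n lat set \<Rightarrow> ('n lat \<Rightarrow> rat) \<Rightarrow> ('n lat \<Rightarrow> complex)
     \<Rightarrow> complex set \<Rightarrow> 'n ser \<Rightarrow> 'n ser" where
  "AdS pr C Om Z l = hext C (AdS_basis pr C Om Z l)"


section \<open>Decorated rooted trees\<close>

text \<open>
  A value of type \<open>'a rtree\<close> is an isomorphism class of finite rooted trees decorated by \<open>'a\<close>.
  If all its entries are distinct, it is an actual rooted tree whose vertices are these entries.
\<close>

datatype 'a rtree = Node (rroot: 'a) "'a rtree multiset"

primrec entries :: "'a rtree \<Rightarrow> 'a multiset" where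
  "entries (Node a M) = add_mset a (\<Sum>\<^sub># (image_mset entries M))"

definition distinct_entries :: "'a rtree \<Rightarrow> bool" where
  "distinct_entries L \<longleftrightarrow> (\<forall>v. count (entries L) v \<le> 1)"

text \<open>Pairs of decorations at the two ends of the edges, the vertex nearer to the root second.\<close>

primrec edges :: "'a rtree \<Rightarrow> ('a \<times> 'a) multiset" where
  "edges (Node a M) = image_mset (\<lambda>t. (rroot t, a)) M + \<Sum>\<^sub># (image_mset edges M)"

definition tree_auts :: "'v rtree \<Rightarrow> ('v \<Rightarrow> 'a) \<Rightarrow> ('v \<Rightarrow> 'v) set" where
  "tree_auts L \<alpha> = {\<sigma>. \<sigma> permutes set_rtree L \<and> map_rtree \<sigma> L = L \<and>
     (\<forall>v\<in>set_rtree L. \<alpha> (\<sigma> v) = \<alpha> v)}"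

text \<open>
  The order of the automorphism group of any tree \<open>L\<close> with vertex decoration \<open>\<alpha>\<close> in the
  isomorphism class \<open>T\<close>.
\<close>

definition aut_order :: "'a rtree \<Rightarrow> nat" where
  "aut_order T = (THE m. \<exists>(L :: nat rtree) \<alpha>. distinct_entries L \<and> map_rtree \<alpha> L = T \<and>
     m = card (tree_auts L \<alpha>))"

definition treeW ::
  "('n::finite lat \<Rightarrow> 'n lat \<Rightarrow> int) \<Rightarrow> ('n lat \<Rightarrow> rat) \<Rightarrow> 'n lat rtree \<Rightarrow> rat ^ 'n" where
  "treeW pr Om T = (\<chi> i. DT Om (rroot T) * of_int (rroot T $ i) / of_nat (aut_order T) *
     (\<Prod>(a, b)\<in>#edges T. DT Om a * of_int (pr a b)))"


section \<open>The explicit solution\<close>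

text \<open>Rays are oriented from \<open>0\<close> to infinity.\<close>

definition ray_integral :: "complex \<Rightarrow> (complex \<Rightarrow> complex) \<Rightarrow> complex" where
  "ray_integral w f = (LBINT t:{0<..}. w * f (of_real t * w))"

definition rho :: "complex \<Rightarrow> complex \<Rightarrow> complex" where
  "rho z z' = 1 / (4 * of_real pi * \<i>) * ((z' + z) / (z' - z))"

definition X0 ::
  "'n::finite lat set \<Rightarrow> ('n lat \<Rightarrow> complex) \<Rightarrow> complex \<Rightarrow> 'n lat \<Rightarrow> 'n ser" where
  "X0 C Z z \<alpha> = (\<lambda>\<eta>. exp (Z \<alpha> / z + z * cnj (Z \<alpha>)) * be C \<alpha> \<eta>)"

text \<open>
  Integrals are taken coefficientwise. For a tree with an edge whose two ends define the same
  ray the inner integral is singular; then \<open>treeW\<close> vanishes by genericity.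
\<close>

primrec treeG ::
  "'n::finite lat set \<Rightarrow> ('n lat \<Rightarrow> complex) \<Rightarrow> 'n lat rtree \<Rightarrow> complex \<Rightarrow> 'n ser" where
  "treeG C Z (Node \<gamma> M) = (\<lambda>z \<eta>. ray_integral (- Z \<gamma>) (\<lambda>z'. 1 / z' * rho z z' *
     hmult C (X0 C Z z' \<gamma>) (hprod_mset C (image_mset (\<lambda>F. F z') (image_mset (treeG C Z) M))) \<eta>))"

fun treeG0 ::
  "'n::finite lat set \<Rightarrow> ('n lat \<Rightarrow> complex) \<Rightarrow> 'n lat rtree \<Rightarrow> 'n ser" where
  "treeG0 C Z (Node \<gamma> M) = (\<lambda>\<eta>. 1 / (4 * of_real pi * \<i>) * ray_integral (- Z \<gamma>) (\<lambda>z'. 1 / z' *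
     hmult C (X0 C Z z' \<gamma>) (hprod_mset C (image_mset (\<lambda>T'. treeG C Z T' z') M)) \<eta>))"

text \<open>The element \<open>- \<Sum>\<^sub>T W\<^sub>T F\<^sub>T\<close> of \<open>\<Gamma> \<otimes> \<gg>\<close> (completed).\<close>

definition neg_tree_sum ::
  "('n::finite lat \<Rightarrow> 'n lat \<Rightarrow> int) \<Rightarrow> ('n lat \<Rightarrow> rat) \<Rightarrow> ('n lat rtree \<Rightarrow> 'n ser)
     \<Rightarrow> 'n ser ^ 'n" where
  "neg_tree_sum pr Om F = (\<chi> i. (\<lambda>\<eta>. - (\<Sum>\<^sub>\<infinity>T. of_rat (treeW pr Om T $ i) * F T \<eta>)))"

definition X_basis ::
  "('n::finite lat \<Rightarrow> 'n lat \<Rightarrow> int) \<Rightarrow> 'n lat set \<Rightarrow> ('n lat \<Rightarrow> rat) \<Rightarrow> ('n lat \<Rightarrow> complex)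
     \<Rightarrow> complex \<Rightarrow> 'n lat \<Rightarrow> 'n ser" where
  "X_basis pr C Om Z z \<alpha> = hmult C (X0 C Z z \<alpha>)
     (hexp C (pair_tensor pr \<alpha> (neg_tree_sum pr Om (\<lambda>T. treeG C Z T z))))"

definition X_sol ::
  "('n::finite lat \<Rightarrow> 'n lat \<Rightarrow> int) \<Rightarrow> 'n lat set \<Rightarrow> ('n lat \<Rightarrow> rat) \<Rightarrow> ('n lat \<Rightarrow> complex)
     \<Rightarrow> complex \<Rightarrow> 'n ser \<Rightarrow> 'n ser" where
  "X_sol pr C Om Z z = hext C (X_basis pr C Om Z z)"

text \<open>The automorphism \<open>e\<^sup>c\<^sup>Z\<close>, where \<open>Z\<close> acts by \<open>e\<^sub>\<alpha> \<mapsto> Z(\<alpha>) e\<^sub>\<alpha>\<close>.\<close>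

definition exp_Z :: "('n::finite lat \<Rightarrow> complex) \<Rightarrow> complex \<Rightarrow> 'n ser \<Rightarrow> 'n ser" where
  "exp_Z Z c x = (\<lambda>\<gamma>. exp (c * Z \<gamma>) * x \<gamma>)"

text \<open>Convergence of endomorphisms in every quotient \<open>\<gg>\<^sub>\<le>\<^sub>k\<close>, not necessarily uniform in \<open>k\<close>.\<close>

definition tendsto_hat ::
  "'n::finite lat set \<Rightarrow> ('b \<Rightarrow> 'n ser \<Rightarrow> 'n ser) \<Rightarrow> ('n ser \<Rightarrow> 'n ser) \<Rightarrow> 'b filter \<Rightarrow> bool" where
  "tendsto_hat C \<Phi> \<Psi> F \<longleftrightarrow>
     (\<forall>k\<ge>1. \<forall>x\<in>ghat C. \<forall>\<gamma>\<in>basis_le C k. ((\<lambda>z. \<Phi> z x \<gamma>) \<longlongrightarrow> \<Psi> x \<gamma>) F)"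

text \<open>A point moving counterclockwise reaches \<open>z0\<close> from the side of smaller arguments.\<close>

definition at_ccw :: "complex \<Rightarrow> complex filter" where
  "at_ccw z0 = at z0 within {z. Im (z / z0) < 0}"

definition at_cw :: "complex \<Rightarrow> complex filter" where
  "at_cw z0 = at z0 within {z. Im (z / z0) > 0}"

text \<open>Approach to \<open>0\<close> along the direction of the unit vector \<open>u\<close>.\<close>

definition at_0_dir :: "complex \<Rightarrow> complex filter" where
  "at_0_dir u = inf (at 0) (filtercomap sgn (nhds u))"

end

theory Submission
  imports Defs "HOL-Complex_Analysis.Complex_Analysis"
begin

text \<open>
  In \<open>\<gg>\<close> (completed), \<open>exp(x)\<close> is the unique \<open>y\<close> with constant term \<open>1\<close> and \<open>D y = D x * y\<close> for all
  derivations \<open>D e\<^sub>\<gamma> = \<gamma>\<^sub>i e\<^sub>\<gamma>\<close>. This yields \<open>exp(x + y) = exp(x) exp(y)\<close>, the expansion of \<open>exp\<close> of a sum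
  over multisets, and \<open>(1 - e\<^sub>\<gamma>)\<^sup>c = exp(- c \<Sum>\<^sub>n e\<^sub>n\<^sub>\<gamma> / n)\<close>. A map \<open>e\<^sub>\<alpha> \<mapsto> c(\<alpha>) e\<^sub>\<alpha> exp(p(\<alpha>))\<close> with \<open>c\<close>
  multiplicative and \<open>p\<close> additive is triangular, hence an automorphism.

  Each \<open>G\<^sub>T\<close> is a scalar function times a basis vector. If \<open>W\<^sub>T\<close> is nonzero, adjacent
  vertices have nonzero pairing, hence different rays by genericity; so inductively \<open>G\<^sub>T\<close> is a Cauchy
  integral over its root ray of an exponentially decaying density that is holomorphic near this ray.
  Part (2) holds because the trees rooted on \<open>\<ell>\<^sub>\<alpha>\<close> pair trivially with \<open>\<alpha>\<close>, and part (4) is dominated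
  convergence. In part (3), the Plemelj jumps of the \<open>G\<^sub>T\<close> add up, because
  \<open>|Aut|\<close> of a tree is the product of those of its branches and of the factorials of their
  multiplicities, to \<open>\<Sum>\<^sub>\<gamma> DT(\<gamma>) \<langle>\<alpha>, \<gamma>\<rangle> X(e\<^sub>\<gamma>)\<close>, which is the image under \<open>X\<close> of the logarithm of the
  Stokes factor.
\<close>


section \<open>Exponentials in the completed algebra\<close>

text \<open>An abstract strictly convex cone carries no grading, so induction runs over the
  filtration by \<open>basis_le C k\<close>: splitting off a nonzero summand lowers the level by
  one. Every coefficient is then a finite expression, and the infinite sums over trees raise no
  question of convergence. The delicate part is the jump. On its root ray a tree function has two
  boundary values and no value in between, and the boundary values of X are built from them. The
  formula still closes up: the density of a tree with root \<gamma> at a point z0 of the ray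
  contains only branches that pair nontrivially with \<gamma>, hence live on other rays and are
  continuous at z0; conversely, in a boundary value of X(e_\<gamma>) the trees rooted on the ray of
  \<gamma> have coefficient zero. So the sum over trees with root \<gamma> can be computed with
  either boundary value. The jump is additive for logarithms and becomes composition after
  exponentiating. The form \<open>rho\<close> dz'/z' has residue 1 / (2 pi i) at z' = z, which makes
  each jump exactly minus the density.\<close>

definition mfact :: "'a multiset \<Rightarrow> nat" where
  "mfact M = (\<Prod>x\<in>set_mset M. fact (count M x))"

lemma mfact_empty [simp]: "mfact {#} = 1"
  by (simp add: mfact_def)

lemma mfact_pos: "mfact M > 0"
  by (simp add: mfact_def prod_pos)

lemma mfact_add [simp]: "mfact (add_mset x M) = Suc (count M x) * mfact M"
proof -
  have *: "(\<Prod>y\<in>set_mset M - {x}. fact (count (add_mset x M) y)) = (\<Prod>y\<in>set_mset M - {x}. fact (count M y) :: nat)"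
    by (rule prod.cong) auto
  have "mfact (add_mset x M) = fact (Suc (count M x)) * (\<Prod>y\<in>set_mset M - {x}. fact (count M y))"
    unfolding mfact_def set_mset_add_mset_insert by (subst prod.insert_remove) (use * in auto)
  moreover have "mfact M = fact (count M x) * (\<Prod>y\<in>set_mset M - {x}. fact (count M y))"
  proof (cases "x \<in># M")
    case True
    then show ?thesis unfolding mfact_def by (intro prod.remove) auto
  next
    case False
    then have "set_mset M - {x} = set_mset M" "count M x = 0" by (auto simp: not_in_iff)
    then show ?thesis by (simp add: mfact_def)
  qed
  ultimately show ?thesis by (simp only: fact_Suc mult.assoc of_nat_id)
qed

lemma sum_mset_count:
  fixes f :: "'a \<Rightarrow> 'b::comm_semiring_1"
  shows "(\<Sum>x\<in>#M. f x) = (\<Sum>x\<in>set_mset M. of_nat (count M x) * f x)"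
proof -
  \<comment> \<open>An index set A that does not change with M spares the induction the question
    whether y occurred before.\<close>
  have "(\<Sum>x\<in>#M. f x) = (\<Sum>x\<in>A. of_nat (count M x) * f x)" if "finite A" "set_mset M \<subseteq> A" for A
    using that(2)
  proof (induction M)
    case (add y M)
    have "(\<Sum>x\<in>A. of_nat (count (add_mset y M) x) * f x) =
        (\<Sum>x\<in>A. (if y = x then f x else 0) + of_nat (count M x) * f x)"
      by (rule sum.cong) (auto simp: algebra_simps)
    then show ?case using add that(1) by (simp add: sum.distrib)
  qed simp
  then show ?thesis by simp
qed

section \<open>Filtration and product of the completed algebra\<close>

locale cone_algebra =
  fixes C :: "'n::finite lat set"
  assumes cone: "strictly_convex_cone C"
    and fin_dim: "\<And>k. k \<ge> 1 \<Longrightarrow> finite (basis_le C k)"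
begin

abbreviation B where "B \<equiv> basis_hat C"

lemma zero_in_cone [simp]: "0 \<in> C"
  and add_in_cone: "a \<in> C \<Longrightarrow> b \<in> C \<Longrightarrow> a + b \<in> C"
  and cone_antisym: "a \<in> C \<Longrightarrow> - a \<in> C \<Longrightarrow> a = 0"
  using cone unfolding strictly_convex_cone_def by blast+

lemma sum_list_in_cone: "set xs \<subseteq> C \<Longrightarrow> sum_list xs \<in> C"
  by (induction xs) (auto intro: add_in_cone)

lemma cone_add_eq_0: "a \<in> C \<Longrightarrow> b \<in> C \<Longrightarrow> a + b = 0 \<Longrightarrow> a = 0"
  using cone_antisym[of a] by (simp add: eq_neg_iff_add_eq_0 add.commute minus_unique)

lemma cone_gt_add:
  assumes "a \<in> cone_gt C k" "b \<in> C" "b \<noteq> 0"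
  shows "a + b \<in> cone_gt C (Suc k)"
proof -
  obtain xs where xs: "a = sum_list xs" "set xs \<subseteq> C - {0}" "length xs > k"
    using assms by (auto simp: cone_gt_def)
  show ?thesis unfolding cone_gt_def
    by (rule CollectI, rule exI[of _ "xs @ [b]"]) (use xs assms in auto)
qed

lemma cone_gt_Suc: "cone_gt C (Suc k) \<subseteq> cone_gt C k"
  by (auto simp: cone_gt_def)

text \<open>Strict convexity enters here: nonzero elements of the cone cannot cancel. Hence the unit
  \<open>be C 0\<close> survives in every quotient.\<close>

lemma zero_in_basis_le [simp]: "0 \<in> basis_le C k"
proof -
  have "sum_list xs \<noteq> 0" if "set xs \<subseteq> C - {0}" "length xs > k" for xs
  proof -
    obtain a ys where "xs = a # ys" using \<open>length xs > k\<close> by (cases xs) auto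
    then show ?thesis
      using that sum_list_in_cone[of ys] cone_add_eq_0[of a "sum_list ys"] by auto
  qed
  then show ?thesis unfolding basis_le_def cone_gt_def by force
qed

text \<open>Level 0 is not among the quotients of the inverse limit; it is the base case for
  inductions on the level.\<close>

lemma basis_le_0: "basis_le C 0 = {0}"
proof -
  have "a \<in> cone_gt C 0" if "a \<in> C" "a \<noteq> 0" for a
    unfolding cone_gt_def by (rule CollectI, rule exI[of _ "[a]"]) (use that in auto)
  then show ?thesis using zero_in_basis_le[of 0] by (auto simp: basis_le_def)
qed

text \<open>\<open>cone_gt C k\<close> is an ideal of the cone, so its complement is closed under
  summands. A coefficient of a product therefore depends only on coefficients of the same
  level.\<close>

lemma basis_le_summand:
  assumes "a \<in> C" "b \<in> C" "a + b \<in> basis_le C k"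
  shows "a \<in> basis_le C k" "b \<in> basis_le C k"
proof -
  have *: "x \<in> basis_le C k" if "x \<in> C" "y \<in> C" "x + y \<in> basis_le C k" for x y
    using that cone_gt_add[of x k y] cone_gt_Suc[of k] by (cases "y = 0") (auto simp: basis_le_def)
  show "a \<in> basis_le C k" "b \<in> basis_le C k"
    using *[of a b] *[of b a] assms by (auto simp: add.commute)
qed

text \<open>The drop by one level is the substitute for a grading: nilpotency, the finiteness of the
  set of trees and the inductions on the height all rest on it.\<close>

lemma basis_le_proper_summand:
  assumes "a \<in> C" "b \<in> C" "b \<noteq> 0" "a + b \<in> basis_le C (Suc k)"
  shows "a \<in> basis_le C k"
  using assms cone_gt_add[of a k b] by (auto simp: basis_le_def)

lemma basis_le_subset_hat: "basis_le C k \<subseteq> B"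
  using basis_le_mono[of k "Suc k" C] unfolding basis_hat_def by (auto intro!: bexI[of _ "Suc k"])

lemma hat_obtain:
  assumes "\<gamma> \<in> B" obtains k where "k \<ge> 1" "\<gamma> \<in> basis_le C k"
  using assms by (auto simp: basis_hat_def)

lemma hat_subset_cone: "\<gamma> \<in> B \<Longrightarrow> \<gamma> \<in> C"
  by (auto simp: basis_hat_def basis_le_def)

lemma zero_in_hat [simp]: "0 \<in> B"
  using basis_le_subset_hat zero_in_basis_le by blast

lemma hat_summand:
  assumes "a \<in> C" "b \<in> C" "a + b \<in> B" shows "a \<in> B" "b \<in> B"
  using assms basis_le_summand[of a b] basis_le_subset_hat by (metis hat_obtain subsetD)+

text \<open>Partial sums of a triple stay in the basis if the total does, so truncating intermediate
  products loses nothing; associativity depends on this.\<close>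

lemma hat_summand3:
  assumes "a \<in> B" "b \<in> B" "c \<in> B" "a + (b + c) \<in> B" shows "a + b \<in> B" "b + c \<in> B"
proof -
  have "a \<in> C" "b \<in> C" "c \<in> C" "a + b \<in> C" "b + c \<in> C" "a + b + c \<in> B"
    using assms hat_subset_cone add_in_cone by (auto simp: add.assoc)
  then show "a + b \<in> B" "b + c \<in> B" using hat_summand assms(4) by blast+
qed

lemma finite_basis_le: "finite (basis_le C k)"
  using fin_dim[of "Suc k"] basis_le_mono[of k "Suc k" C] finite_subset by auto

text \<open>The first level at which e_\<gamma> survives: a stand-in for the degree, meaningful on
  \<open>B\<close> only, and the induction measure below.\<close>

definition ht :: "'n lat \<Rightarrow> nat" where "ht \<gamma> = (LEAST k. \<gamma> \<in> basis_le C k)"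

lemma ht_less:
  assumes "a \<in> C" "b \<in> C" "b \<noteq> 0" "a + b \<in> B"
  shows "ht a < ht (a + b)"
proof -
  have *: "a + b \<in> basis_le C (ht (a + b))"
    unfolding ht_def using hat_obtain[OF assms(4)] by (metis LeastI)
  have "a + b \<noteq> 0" using assms cone_add_eq_0[of b a] by (auto simp: add.commute)
  then obtain k where k: "ht (a + b) = Suc k"
    using * basis_le_0 by (cases "ht (a + b)") auto
  have "a \<in> basis_le C k" using basis_le_proper_summand assms * k by auto
  then have "ht a \<le> k" unfolding ht_def by (rule Least_le)
  then show ?thesis using k by simp
qed

definition dec :: "'n lat \<Rightarrow> ('n lat \<times> 'n lat) set" where
  "dec \<gamma> = {(a, b). a \<in> B \<and> b \<in> B \<and> a + b = \<gamma>}"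

lemma dec_basis_le:
  assumes "(a, b) \<in> dec \<gamma>" "\<gamma> \<in> basis_le C k"
  shows "a \<in> basis_le C k" "b \<in> basis_le C k"
  using assms basis_le_summand[of a b k] hat_subset_cone by (auto simp: dec_def)

lemma dec_basis_le_proper:
  assumes "(a, b) \<in> dec \<gamma>" "\<gamma> \<in> basis_le C (Suc k)" "a \<noteq> 0"
  shows "b \<in> basis_le C k"
  using assms basis_le_proper_summand[of b a k] hat_subset_cone by (auto simp: dec_def add.commute)

lemma dec_hat: "(a, b) \<in> dec \<gamma> \<Longrightarrow> a \<in> B \<and> b \<in> B"
  by (auto simp: dec_def)

lemma finite_dec: "\<gamma> \<in> B \<Longrightarrow> finite (dec \<gamma>)"
proof -
  assume "\<gamma> \<in> B"
  then obtain k where k: "\<gamma> \<in> basis_le C k" using hat_obtain by blast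
  have "dec \<gamma> \<subseteq> basis_le C k \<times> basis_le C k" using dec_basis_le[OF _ k] by auto
  then show ?thesis using finite_basis_le finite_subset by blast
qed

lemma hmult_dec: "hmult C x y \<gamma> = (if \<gamma> \<in> B then \<Sum>(a, b)\<in>dec \<gamma>. x a * y b else 0)"
  by (simp add: hmult_def dec_def)

lemma hmult_cong:
  assumes "\<And>\<eta>. \<eta> \<in> basis_le C k \<Longrightarrow> x \<eta> = x' \<eta>" "\<And>\<eta>. \<eta> \<in> basis_le C k \<Longrightarrow> y \<eta> = y' \<eta>"
    "\<gamma> \<in> basis_le C k"
  shows "hmult C x y \<gamma> = hmult C x' y' \<gamma>"
  unfolding hmult_dec using assms dec_basis_le[of _ _ \<gamma> k]
  by (intro if_cong sum.cong) auto

lemma hmult_comm: "hmult C x y = hmult C y x"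
proof (rule ext)
  fix \<gamma>
  have "(\<Sum>(a, b)\<in>dec \<gamma>. x a * y b) = (\<Sum>(a, b)\<in>dec \<gamma>. y a * x b)"
    by (rule sum.reindex_bij_witness[of _ prod.swap prod.swap]) (auto simp: dec_def add.commute)
  then show "hmult C x y \<gamma> = hmult C y x \<gamma>" by (simp add: hmult_dec)
qed

lemma hmult_assoc: "hmult C (hmult C x y) z = hmult C x (hmult C y z)"
proof (rule ext)
  fix \<gamma>
  show "hmult C (hmult C x y) z \<gamma> = hmult C x (hmult C y z) \<gamma>"
  proof (cases "\<gamma> \<in> B")
    case True
    have fin: "finite (dec a)" "finite (dec b)" if "(a, b) \<in> dec \<gamma>" for a b
      using that finite_dec dec_hat by blast+
    have "hmult C (hmult C x y) z \<gamma> = (\<Sum>p\<in>dec \<gamma>. \<Sum>q\<in>dec (fst p). x (fst q) * y (snd q) * z (snd p))"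
      unfolding hmult_dec using True
      by (auto simp: sum_distrib_right case_prod_unfold dec_def intro!: sum.cong)
    also have "\<dots> = (\<Sum>(p, q)\<in>Sigma (dec \<gamma>) (\<lambda>p. dec (fst p)). x (fst q) * y (snd q) * z (snd p))"
      by (rule sum.Sigma) (use True fin finite_dec in auto)
    \<comment> \<open>Both index sets list the triples (a, b, c) in \<open>B\<close> with a + b + c
      = \<gamma>, bracketed in the two ways.\<close>
    also have "\<dots> = (\<Sum>(p, q)\<in>Sigma (dec \<gamma>) (\<lambda>p. dec (snd p)). x (fst p) * (y (fst q) * z (snd q)))"
    proof -
      let ?f = "\<lambda>((p, c), (a, b)). ((a, b + c), (b, c))"
      let ?g = "\<lambda>((a, p), (b, c)). ((a + b, c), (a, b))"
      have 1: "?f s \<in> Sigma (dec \<gamma>) (\<lambda>p. dec (snd p))" "?g (?f s) = s"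
        if s: "s \<in> Sigma (dec \<gamma>) (\<lambda>p. dec (fst p))" for s
      proof -
        obtain p c a b where "s = ((p, c), (a, b))" by (metis surj_pair)
        then show "?f s \<in> Sigma (dec \<gamma>) (\<lambda>p. dec (snd p))" "?g (?f s) = s"
          using s True hat_summand3[of a b c] by (auto simp: dec_def add.assoc)
      qed
      have 2: "?g s \<in> Sigma (dec \<gamma>) (\<lambda>p. dec (fst p))" "?f (?g s) = s"
        if s: "s \<in> Sigma (dec \<gamma>) (\<lambda>p. dec (snd p))" for s
      proof -
        obtain a p b c where "s = ((a, p), (b, c))" by (metis surj_pair)
        then show "?g s \<in> Sigma (dec \<gamma>) (\<lambda>p. dec (fst p))" "?f (?g s) = s"
          using s True hat_summand3[of a b c] by (auto simp: dec_def add.assoc)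
      qed
      show ?thesis
        by (rule sum.reindex_bij_witness[of _ ?g ?f]) (use 1 2 in \<open>auto simp: mult.assoc\<close>)
    qed
    also have "\<dots> = (\<Sum>p\<in>dec \<gamma>. \<Sum>q\<in>dec (snd p). x (fst p) * (y (fst q) * z (snd q)))"
      by (rule sum.Sigma[symmetric]) (use True fin finite_dec in auto)
    also have "\<dots> = hmult C x (hmult C y z) \<gamma>"
      unfolding hmult_dec using True
      by (auto simp: sum_distrib_left case_prod_unfold dec_def intro!: sum.cong)
    finally show ?thesis .
  qed (simp add: hmult_dec)
qed

lemma hmult_left_comm: "hmult C x (hmult C y z) = hmult C y (hmult C x z)"
  by (metis hmult_assoc hmult_comm)

lemma hprod_mset_empty [simp]: "hprod_mset C {#} = be C 0"
  by (simp add: hprod_mset_def)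

lemma hprod_mset_add [simp]: "hprod_mset C (add_mset x M) = hmult C x (hprod_mset C M)"
proof -
  interpret comp_fun_commute "hmult C" by standard (auto simp: fun_eq_iff hmult_left_comm)
  show ?thesis by (simp add: hprod_mset_def)
qed

lemma ghat_D: "x \<in> ghat C \<Longrightarrow> \<gamma> \<notin> B \<Longrightarrow> x \<gamma> = 0"
  by (auto simp: ghat_def)

lemma hmult_in_ghat [simp]: "hmult C x y \<in> ghat C"
  by (auto simp: ghat_def hmult_dec split: if_splits)

lemma be_in_ghat [simp]: "be C \<alpha> \<in> ghat C"
  by (auto simp: ghat_def be_def)

lemma hmult_be:
  "hmult C (be C \<alpha>) y \<eta> = (if \<alpha> \<in> B \<and> \<eta> \<in> B \<and> \<eta> - \<alpha> \<in> B then y (\<eta> - \<alpha>) else 0)"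
proof (cases "\<eta> \<in> B")
  case True
  have "(\<Sum>(a, b)\<in>dec \<eta>. be C \<alpha> a * y b) =
      (\<Sum>(a, b)\<in>(if \<alpha> \<in> B \<and> \<eta> - \<alpha> \<in> B then {(\<alpha>, \<eta> - \<alpha>)} else {}). be C \<alpha> a * y b)"
    by (rule sum.mono_neutral_right) (use finite_dec True in \<open>auto simp: dec_def be_def split: if_splits\<close>)
  also have "\<dots> = (if \<alpha> \<in> B \<and> \<eta> - \<alpha> \<in> B then y (\<eta> - \<alpha>) else 0)" by (simp add: be_def)
  finally show ?thesis using True by (simp add: hmult_dec)
qed (simp add: hmult_dec)

lemma be_mult_be:
  assumes "a \<in> C" "b \<in> C" shows "hmult C (be C a) (be C b) = be C (a + b)"
  by (rule ext, subst hmult_be) (use hat_summand[OF assms] in \<open>auto simp: be_def\<close>)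

lemma hmult_lincomb_right:
  "hmult C x (\<lambda>\<gamma>. c * y \<gamma> + d * z \<gamma>) = (\<lambda>\<gamma>. c * hmult C x y \<gamma> + d * hmult C x z \<gamma>)"
  by (rule ext) (auto simp: hmult_dec sum_distrib_left sum.distrib algebra_simps case_prod_unfold)

lemma hmult_scale_right: "hmult C x (\<lambda>\<gamma>. c * y \<gamma>) = (\<lambda>\<gamma>. c * hmult C x y \<gamma>)"
  using hmult_lincomb_right[of x c y 0 y] by simp

lemma hmult_scale_left: "hmult C (\<lambda>\<gamma>. c * x \<gamma>) y = (\<lambda>\<gamma>. c * hmult C x y \<gamma>)"
  using hmult_scale_right[of y c x] by (simp add: hmult_comm[of _ y])

lemma hmult_add_left: "hmult C (\<lambda>\<gamma>. x \<gamma> + y \<gamma>) z = (\<lambda>\<gamma>. hmult C x z \<gamma> + hmult C y z \<gamma>)"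
  using hmult_lincomb_right[of z 1 x 1 y] by (simp add: hmult_comm[of _ z])

text \<open>The derivation \<open>e\<^sub>\<gamma> \<mapsto> \<gamma>\<^sub>i e\<^sub>\<gamma>\<close>.\<close>

definition hder :: "'n \<Rightarrow> 'n ser \<Rightarrow> 'n ser" where
  "hder i x = (\<lambda>\<gamma>. of_int (\<gamma> $ i) * x \<gamma>)"

lemma hder_hmult: "hder i (hmult C x y) = (\<lambda>\<gamma>. hmult C (hder i x) y \<gamma> + hmult C x (hder i y) \<gamma>)"
proof (rule ext)
  fix \<gamma>
  have "of_int (\<gamma> $ i) * (\<Sum>(a, b)\<in>dec \<gamma>. x a * y b) =
      (\<Sum>(a, b)\<in>dec \<gamma>. hder i x a * y b) + (\<Sum>(a, b)\<in>dec \<gamma>. x a * hder i y b)"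
    unfolding sum_distrib_left sum.distrib[symmetric]
    by (rule sum.cong) (auto simp: dec_def hder_def algebra_simps)
  then show "hder i (hmult C x y) \<gamma> = hmult C (hder i x) y \<gamma> + hmult C x (hder i y) \<gamma>"
    by (simp add: hmult_dec hder_def)
qed

section \<open>Powers, the exponential series and its differential equation\<close>

lemma hpow_0 [simp]: "hpow C x 0 = be C 0"
  and hpow_Suc [simp]: "hpow C x (Suc m) = hmult C x (hpow C x m)"
  by (simp_all add: hpow_def)

lemma hpow_in_ghat [simp]: "hpow C x m \<in> ghat C"
  by (cases m) auto

lemma hpow_cong:
  assumes "\<And>\<eta>. \<eta> \<in> basis_le C k \<Longrightarrow> x \<eta> = x' \<eta>" "\<gamma> \<in> basis_le C k"
  shows "hpow C x m \<gamma> = hpow C x' m \<gamma>"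
  using assms(2)
proof (induction m arbitrary: \<gamma>)
  case (Suc m)
  then show ?case using assms(1) by (simp, intro hmult_cong[of k]) auto
qed simp

text \<open>Without a constant term every factor contributes a nonzero exponent and uses up one
  level, so at level k at most k factors fit. The exponential series is thus a finite sum in each
  quotient.\<close>

lemma hpow_eq_0:
  assumes "x 0 = 0" "\<gamma> \<in> basis_le C k" "k < m"
  shows "hpow C x m \<gamma> = 0"
  using assms(2,3)
proof (induction m arbitrary: \<gamma> k)
  case (Suc m)
  have "x a * hpow C x m b = 0" if ab: "(a, b) \<in> dec \<gamma>" for a b
  proof (cases "a = 0")
    case False
    have "a + b = \<gamma>" "a \<in> C" "b \<in> C" using ab hat_subset_cone by (auto simp: dec_def)
    then have "\<gamma> \<noteq> 0" using False cone_add_eq_0[of a b] by auto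
    then obtain l where l: "k = Suc l" using Suc.prems basis_le_0 by (cases k) auto
    have "b \<in> basis_le C l" using dec_basis_le_proper[OF ab] Suc.prems False l by auto
    then show ?thesis using Suc.IH[of b l] Suc.prems l by auto
  qed (use assms in auto)
  then have "(\<Sum>(a, b)\<in>dec \<gamma>. x a * hpow C x m b) = 0" by (intro sum.neutral) auto
  then show ?case by (simp add: hmult_dec)
qed simp

lemma hder_hpow: "hder i (hpow C x (Suc m)) = (\<lambda>\<gamma>. of_nat (Suc m) * hmult C (hder i x) (hpow C x m) \<gamma>)"
proof (induction m)
  case 0
  have "hder i (be C 0) = (\<lambda>_. 0)" by (rule ext) (auto simp: hder_def be_def)
  then show ?case by (simp add: hder_hmult, intro ext) (simp add: hmult_dec)
next
  case (Suc m)
  have "hder i (hpow C x (Suc (Suc m))) =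
    (\<lambda>\<gamma>. hmult C (hder i x) (hpow C x (Suc m)) \<gamma> +
      of_nat (Suc m) * hmult C (hder i x) (hpow C x (Suc m)) \<gamma>)"
    unfolding hpow_Suc[of x "Suc m"] hder_hmult Suc.IH hmult_scale_right
    by (simp add: hmult_left_comm[of x])
  then show ?case by (simp add: algebra_simps)
qed

lemma hexp_eq_sum:
  assumes "x 0 = 0" "\<gamma> \<in> basis_le C k" "k \<le> n"
  shows "hexp C x \<gamma> = (\<Sum>m\<le>n. hpow C x m \<gamma> / fact m)"
  unfolding hexp_def by (rule suminf_finite) (use hpow_eq_0[of x \<gamma> k] assms in auto)

lemma hexp_in_ghat [simp]: "hexp C x \<in> ghat C"
proof -
  have "hexp C x \<gamma> = 0" if "\<gamma> \<notin> B" for \<gamma>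
    using that by (simp add: hexp_def ghat_D[OF hpow_in_ghat])
  then show ?thesis by (auto simp: ghat_def)
qed

lemma hexp_0: "x 0 = 0 \<Longrightarrow> hexp C x 0 = 1"
  by (subst hexp_eq_sum[of _ _ 0 0]) (auto simp: be_def)

lemma hexp_cong:
  assumes "\<And>\<eta>. \<eta> \<in> basis_le C k \<Longrightarrow> x \<eta> = x' \<eta>" "\<gamma> \<in> basis_le C k"
  shows "hexp C x \<gamma> = hexp C x' \<gamma>"
  unfolding hexp_def using hpow_cong[OF assms] by simp

lemma hder_hexp:
  assumes "x 0 = 0" shows "hder i (hexp C x) = hmult C (hder i x) (hexp C x)"
proof (rule ext)
  fix \<gamma>
  show "hder i (hexp C x) \<gamma> = hmult C (hder i x) (hexp C x) \<gamma>"
  proof (cases "\<gamma> \<in> B")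
    case True
    then obtain k where "k \<ge> 1" "\<gamma> \<in> basis_le C k" using hat_obtain by blast
    then obtain l where l: "\<gamma> \<in> basis_le C (Suc l)" by (cases k) auto
    have "hder i (hexp C x) \<gamma> = (\<Sum>m\<le>Suc l. hder i (hpow C x m) \<gamma> / fact m)"
      unfolding hder_def hexp_eq_sum[of x, OF assms l order.refl] sum_distrib_left by simp
    also have "\<dots> = (\<Sum>m\<le>l. hder i (hpow C x (Suc m)) \<gamma> / fact (Suc m))"
      by (subst sum.atMost_Suc_shift) (auto simp: hder_def be_def)
    also have "\<dots> = (\<Sum>m\<le>l. hmult C (hder i x) (hpow C x m) \<gamma> / fact m)"
      unfolding hder_hpow by (rule sum.cong) (auto simp: field_simps simp del: of_nat_Suc)
    also have "\<dots> = (\<Sum>(a, b)\<in>dec \<gamma>. hder i x a * (\<Sum>m\<le>l. hpow C x m b / fact m))"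
    proof -
      have "(\<Sum>m\<le>l. \<Sum>p\<in>dec \<gamma>. hder i x (fst p) * hpow C x m (snd p) / fact m) =
          (\<Sum>p\<in>dec \<gamma>. \<Sum>m\<le>l. hder i x (fst p) * hpow C x m (snd p) / fact m)"
        by (rule sum.swap)
      then show ?thesis
        using True by (simp add: hmult_dec sum_divide_distrib sum_distrib_left case_prod_unfold)
    qed
    \<comment> \<open>For a = 0 the derivation kills the term. For a \<noteq> 0 the summand b has
      level l, one below \<gamma>, so the shifted sum up to l is already all of
      \<open>hexp C x b\<close>.\<close>
    also have "\<dots> = (\<Sum>(a, b)\<in>dec \<gamma>. hder i x a * hexp C x b)"
    proof (rule sum.cong, goal_cases)
      case (2 p)
      obtain a b where p: "p = (a, b)" by (cases p)
      show ?case
      proof (cases "a = 0")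
        case False
        then have "b \<in> basis_le C l" using dec_basis_le_proper l 2 p by auto
        then show ?thesis using hexp_eq_sum[of x, OF assms, of b l l] p by simp
      qed (simp add: p hder_def)
    qed simp
    finally show ?thesis using True by (simp add: hmult_dec)
  qed (simp add: hmult_dec hder_def ghat_D)
qed

text \<open>At \<gamma> \<noteq> 0 some coordinate of \<gamma> is nonzero, and the corresponding
  equation determines the coefficient of y at \<gamma> from coefficients of smaller height: the term
  with a = 0 drops out because the derivation kills constants. The identities
  \<open>hexp_add\<close>, \<open>hexp_sum_msets\<close> and \<open>hone_minus_pow_be\<close> are
  reduced to this equation.\<close>

lemma hexp_unique:
  assumes x: "x 0 = 0" and y: "y \<in> ghat C" "y 0 = 1"
    and D: "\<And>i \<gamma>. \<gamma> \<in> B \<Longrightarrow> hder i y \<gamma> = hmult C (hder i x) y \<gamma>"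
  shows "y = hexp C x"
proof (rule ext)
  fix \<gamma>
  show "y \<gamma> = hexp C x \<gamma>"
  proof (cases "\<gamma> \<in> B")
    case True
    then show ?thesis
    proof (induction "ht \<gamma>" arbitrary: \<gamma> rule: less_induct)
      case less
      show ?case
      proof (cases "\<gamma> = 0")
        case False
        then obtain i where i: "\<gamma> $ i \<noteq> 0" by (auto simp: vec_eq_iff)
        have "hmult C (hder i x) y \<gamma> = hmult C (hder i x) (hexp C x) \<gamma>"
        proof -
          have "hder i x a * y b = hder i x a * hexp C x b" if "(a, b) \<in> dec \<gamma>" for a b
          proof (cases "a = 0")
            case False
            then have "ht b < ht \<gamma>" "b \<in> B"
              using that ht_less[of b a] less.prems hat_subset_cone by (auto simp: dec_def add.commute)
            then show ?thesis using less.hyps by simp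
          qed (simp add: hder_def)
          then show ?thesis unfolding hmult_dec by (intro if_cong sum.cong) auto
        qed
        then have "hder i y \<gamma> = hder i (hexp C x) \<gamma>"
          using D[OF less.prems, of i] hder_hexp[of x i, OF x] by simp
        then show ?thesis using i by (simp add: hder_def)
      qed (simp add: y hexp_0 x)
    qed
  qed (simp add: ghat_D[OF y(1)] ghat_D)
qed

lemma hexp_add:
  assumes "x 0 = 0" "y 0 = 0"
  shows "hexp C (\<lambda>\<gamma>. x \<gamma> + y \<gamma>) = hmult C (hexp C x) (hexp C y)"
proof (rule hexp_unique[symmetric])
  have dec0: "dec 0 = {(0, 0)}"
  proof -
    have "a = 0" if "a \<in> B" "b \<in> B" "a + b = 0" for a b
      using that cone_add_eq_0[of a b] hat_subset_cone by blast
    then show ?thesis by (fastforce simp: dec_def)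
  qed
  show "hmult C (hexp C x) (hexp C y) 0 = 1"
    using assms by (simp add: hmult_dec dec0 hexp_0)
  fix i \<gamma>
  have "hder i (\<lambda>\<gamma>. x \<gamma> + y \<gamma>) = (\<lambda>\<gamma>. hder i x \<gamma> + hder i y \<gamma>)"
    by (rule ext) (simp add: hder_def algebra_simps)
  then show "hder i (hmult C (hexp C x) (hexp C y)) \<gamma> =
      hmult C (hder i (\<lambda>\<gamma>. x \<gamma> + y \<gamma>)) (hmult C (hexp C x) (hexp C y)) \<gamma>"
    by (simp add: hder_hmult hder_hexp assms hmult_add_left hmult_assoc hmult_left_comm[of "hder i y"])
qed (use assms in auto)

lemma hexp_zero: "hexp C (\<lambda>_. 0) = be C 0"
  by (rule hexp_unique[symmetric], simp_all) (auto simp: be_def hder_def hmult_dec)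

section \<open>Limits and holomorphy in the finite-dimensional quotients\<close>

lemma tendsto_hmult:
  assumes "\<And>\<eta>. \<eta> \<in> basis_le C k \<Longrightarrow> ((\<lambda>z. x z \<eta>) \<longlongrightarrow> x' \<eta>) F"
    and "\<And>\<eta>. \<eta> \<in> basis_le C k \<Longrightarrow> ((\<lambda>z. y z \<eta>) \<longlongrightarrow> y' \<eta>) F"
    and "\<gamma> \<in> basis_le C k"
  shows "((\<lambda>z. hmult C (x z) (y z) \<gamma>) \<longlongrightarrow> hmult C x' y' \<gamma>) F"
  unfolding hmult_dec case_prod_unfold
  using assms dec_basis_le[of _ _ \<gamma> k] by (auto intro!: tendsto_sum tendsto_mult)

lemma holomorphic_on_hmult:
  assumes "\<And>\<eta>. \<eta> \<in> basis_le C k \<Longrightarrow> (\<lambda>z. x z \<eta>) holomorphic_on S"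
    and "\<And>\<eta>. \<eta> \<in> basis_le C k \<Longrightarrow> (\<lambda>z. y z \<eta>) holomorphic_on S"
    and "\<gamma> \<in> basis_le C k"
  shows "(\<lambda>z. hmult C (x z) (y z) \<gamma>) holomorphic_on S"
  unfolding hmult_dec case_prod_unfold
  using assms dec_basis_le[of _ _ \<gamma> k]
  by (cases "\<gamma> \<in> B") (auto intro!: holomorphic_on_sum holomorphic_on_mult)

lemma tendsto_hexp:
  assumes "\<And>\<eta>. \<eta> \<in> basis_le C k \<Longrightarrow> ((\<lambda>z. x z \<eta>) \<longlongrightarrow> x' \<eta>) F"
    and "\<And>z. x z 0 = 0" "x' 0 = 0" "\<gamma> \<in> basis_le C k"
  shows "((\<lambda>z. hexp C (x z) \<gamma>) \<longlongrightarrow> hexp C x' \<gamma>) F"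
proof -
  have "((\<lambda>z. hpow C (x z) m \<eta>) \<longlongrightarrow> hpow C x' m \<eta>) F" if "\<eta> \<in> basis_le C k" for m \<eta>
    using that by (induction m arbitrary: \<eta>) (auto intro: tendsto_hmult assms(1))
  then show ?thesis
    using assms by (simp add: hexp_eq_sum[of _ \<gamma> k k] tendsto_sum tendsto_divide)
qed

lemma holomorphic_on_hexp:
  assumes "\<And>\<eta>. \<eta> \<in> basis_le C k \<Longrightarrow> (\<lambda>z. x z \<eta>) holomorphic_on S"
    and "\<And>z. x z 0 = 0" "\<gamma> \<in> basis_le C k"
  shows "(\<lambda>z. hexp C (x z) \<gamma>) holomorphic_on S"
proof -
  have "(\<lambda>z. hpow C (x z) m \<eta>) holomorphic_on S" if "\<eta> \<in> basis_le C k" for m \<eta>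
    using that by (induction m arbitrary: \<eta>) (auto intro: holomorphic_on_hmult assms(1))
  then show ?thesis
    using assms by (simp add: hexp_eq_sum[of _ \<gamma> k k] holomorphic_on_sum holomorphic_on_divide)
qed

lemma sum_mset_in_cone: "(\<And>T. T \<in># M \<Longrightarrow> f T \<in> C) \<Longrightarrow> (\<Sum>T\<in>#M. f T) \<in> C"
  by (induction M) (auto intro: add_in_cone)

section \<open>The exponential of a sum over generators as a sum over multisets\<close>

context
  fixes G :: "'i set" and deg :: "'i \<Rightarrow> 'n lat"
  assumes deg: "T \<in> G \<Longrightarrow> deg T \<in> C - {0}"
    and fin: "\<eta> \<in> B \<Longrightarrow> finite {T \<in> G. deg T = \<eta>}"
begin

definition msets :: "'n lat \<Rightarrow> 'i multiset set" where
  "msets \<eta> = {M. set_mset M \<subseteq> G \<and> (\<Sum>T\<in>#M. deg T) = \<eta>}"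

lemma msets_remove:
  assumes "M \<in> msets \<eta>" "T \<in># M" "\<eta> \<in> B"
  shows "T \<in> G" "(deg T, \<eta> - deg T) \<in> dec \<eta>" "M - {#T#} \<in> msets (\<eta> - deg T)"
proof -
  show T: "T \<in> G" using assms by (auto simp: msets_def)
  have eq: "M = add_mset T (M - {#T#})" using assms by simp
  have "(\<Sum>T\<in>#M. deg T) = deg T + (\<Sum>T\<in>#M - {#T#}. deg T)" by (subst eq) simp
  then have *: "\<eta> = deg T + (\<Sum>T\<in>#M - {#T#}. deg T)" using assms by (simp add: msets_def)
  have "set_mset (M - {#T#}) \<subseteq> G" using assms by (auto simp: msets_def dest: in_diffD)
  then have "(\<Sum>T\<in>#M - {#T#}. deg T) \<in> C" by (intro sum_mset_in_cone) (use deg in auto)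
  with * T deg assms(3) show "(deg T, \<eta> - deg T) \<in> dec \<eta>"
    using hat_summand[of "deg T" "\<eta> - deg T"] by (auto simp: dec_def)
  show "M - {#T#} \<in> msets (\<eta> - deg T)"
    using * \<open>set_mset (M - {#T#}) \<subseteq> G\<close> by (simp add: msets_def)
qed

lemma msets_0: "msets 0 = {{#}}"
proof -
  have "M = {#}" if "M \<in> msets 0" for M
  proof (rule ccontr)
    assume "M \<noteq> {#}"
    then obtain T where "T \<in># M" by blast
    from msets_remove[OF that this] deg[of T] hat_subset_cone cone_add_eq_0[of "deg T" "0 - deg T"]
    show False by (auto simp: dec_def)
  qed
  then show ?thesis by (auto simp: msets_def)
qed

text \<open>Removing one member from a nonempty multiset strictly lowers the height of its degree,
  and only finitely many members have a given degree.\<close>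

lemma finite_msets: "\<eta> \<in> B \<Longrightarrow> finite (msets \<eta>)"
proof (induction "ht \<eta>" arbitrary: \<eta> rule: less_induct)
  case less
  show ?case
  proof (cases "\<eta> = 0")
    case False
    let ?D = "{(a, b) \<in> dec \<eta>. a \<noteq> 0}"
    have "finite (msets b)" if "(a, b) \<in> dec \<eta>" "a \<noteq> 0" for a b
      by (rule less.hyps) (use that hat_subset_cone ht_less[of b a] less.prems in \<open>auto simp: dec_def add.commute\<close>)
    moreover have "finite ?D" by (rule finite_subset[OF _ finite_dec[OF less.prems]]) auto
    ultimately have "finite (\<Union>(a, b)\<in>?D. \<Union>T\<in>{T \<in> G. deg T = a}. add_mset T ` msets b)"
      using fin dec_hat by (intro finite_UN_I) auto
    moreover have "msets \<eta> \<subseteq> (\<Union>(a, b)\<in>?D. \<Union>T\<in>{T \<in> G. deg T = a}. add_mset T ` msets b)"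
    proof
      fix M assume M: "M \<in> msets \<eta>"
      with False have "M \<noteq> {#}" by (auto simp: msets_def)
      then obtain T where T: "T \<in># M" by blast
      have "M = add_mset T (M - {#T#})" using T by simp
      then show "M \<in> (\<Union>(a, b)\<in>?D. \<Union>T\<in>{T \<in> G. deg T = a}. add_mset T ` msets b)"
        using msets_remove[OF M T less.prems] deg[of T]
        by (intro UN_I[of "(deg T, \<eta> - deg T)"]) auto
    qed
    ultimately show ?thesis by (rule rev_finite_subset)
  qed (simp add: msets_0)
qed

text \<open>The multinomial formula in exponential form. Its right-hand side solves the differential
  equation of \<open>hexp_unique\<close>: a derivation applied to the term of M marks one member T,
  and removing T splits this term into the one of T and the one of the remaining multiset.\<close>

lemma hexp_sum_msets:
  fixes d :: "'i \<Rightarrow> complex"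
  defines "x \<equiv> \<lambda>\<eta>. if \<eta> \<in> B then \<Sum>T\<in>{T \<in> G. deg T = \<eta>}. d T else 0"
  assumes \<eta>: "\<eta> \<in> B"
  shows "hexp C x \<eta> = (\<Sum>M\<in>msets \<eta>. (\<Prod>T\<in>#M. d T) / of_nat (mfact M))"
proof -
  define q where "q M = (\<Prod>T\<in>#M. d T) / of_nat (mfact M)" for M
  define y where "y \<eta> = (if \<eta> \<in> B then \<Sum>M\<in>msets \<eta>. q M else 0)" for \<eta>
  \<comment> \<open>The multiplicity of T in the larger multiset is the quotient of the two values
    of \<open>mfact\<close>.\<close>
  have q_add: "of_nat (count (add_mset T M) T) * q (add_mset T M) = d T * q M" for T M
  proof -
    have "(of_nat (mfact M) :: complex) \<noteq> 0" "(of_nat (Suc (count M T)) :: complex) \<noteq> 0"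
      using mfact_pos[of M] by (simp_all del: of_nat_Suc)
    then show ?thesis by (simp add: q_def del: of_nat_Suc mult_Suc)
  qed
  have x0: "x 0 = 0" unfolding x_def using deg by (auto intro!: sum.neutral)
  have "y = hexp C x"
  proof (rule hexp_unique[of x, OF x0])
    show "y \<in> ghat C" by (auto simp: ghat_def y_def)
    show "y 0 = 1" by (simp add: y_def msets_0 q_def)
    fix i \<gamma> assume \<gamma>: "\<gamma> \<in> B"
    let ?g = "\<lambda>T. of_int (deg T $ i) :: complex"
    have "hder i y \<gamma> = (\<Sum>M\<in>msets \<gamma>. of_int (\<gamma> $ i) * q M)"
      using \<gamma> by (simp add: hder_def y_def sum_distrib_left)
    also have "\<dots> = (\<Sum>M\<in>msets \<gamma>. \<Sum>T\<in>set_mset M. ?g T * (of_nat (count M T) * q M))"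
    proof (rule sum.cong)
      fix M assume "M \<in> msets \<gamma>"
      then have "\<gamma> $ i = (\<Sum>T\<in>#M. deg T) $ i" by (simp add: msets_def)
      also have "\<dots> = (\<Sum>T\<in>#M. deg T $ i)" by (induction M) auto
      also have "\<dots> = (\<Sum>T\<in>set_mset M. of_nat (count M T) * deg T $ i)"
        by (rule sum_mset_count)
      finally have "(of_int (\<gamma> $ i) :: complex) = (\<Sum>T\<in>set_mset M. of_nat (count M T) * ?g T)" by simp
      then show "of_int (\<gamma> $ i) * q M = (\<Sum>T\<in>set_mset M. ?g T * (of_nat (count M T) * q M))"
        by (simp add: sum_distrib_left mult_ac)
    qed simp
    also have "\<dots> = (\<Sum>(M, T)\<in>Sigma (msets \<gamma>) set_mset. ?g T * (of_nat (count M T) * q M))"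
      by (rule sum.Sigma) (use finite_msets \<gamma> in auto)
    \<comment> \<open>A multiset with a marked member T corresponds to T together with the rest; the
      component p records how the degree splits.\<close>
    also have "\<dots> = (\<Sum>(p, T, M)\<in>Sigma (dec \<gamma>) (\<lambda>(a, b). {T \<in> G. deg T = a} \<times> msets b). ?g T * (d T * q M))"
    proof -
      let ?f = "\<lambda>(M, T). ((deg T, \<gamma> - deg T), T, M - {#T#})"
      let ?h = "\<lambda>((a, b), T, M). (add_mset T M, T)"
      have 1: "?f s \<in> Sigma (dec \<gamma>) (\<lambda>(a, b). {T \<in> G. deg T = a} \<times> msets b)" "?h (?f s) = s"
        "(case ?f s of (p, T, M) \<Rightarrow> ?g T * (d T * q M)) = (case s of (M, T) \<Rightarrow> ?g T * (of_nat (count M T) * q M))"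
        if s: "s \<in> Sigma (msets \<gamma>) set_mset" for s
      proof -
        obtain M T where [simp]: "s = (M, T)" by (cases s)
        have MT: "M \<in> msets \<gamma>" "T \<in># M" using s by auto
        note r = msets_remove[OF MT \<gamma>]
        show "?f s \<in> Sigma (dec \<gamma>) (\<lambda>(a, b). {T \<in> G. deg T = a} \<times> msets b)" "?h (?f s) = s"
          using r MT by auto
        show "(case ?f s of (p, T, M) \<Rightarrow> ?g T * (d T * q M)) = (case s of (M, T) \<Rightarrow> ?g T * (of_nat (count M T) * q M))"
          using q_add[of T "M - {#T#}"] MT by simp
      qed
      have 2: "?h s \<in> Sigma (msets \<gamma>) set_mset" "?f (?h s) = s"
        if s: "s \<in> Sigma (dec \<gamma>) (\<lambda>(a, b). {T \<in> G. deg T = a} \<times> msets b)" for s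
        using s by (auto simp: msets_def dec_def)
      show ?thesis by (rule sum.reindex_bij_witness[of _ ?h ?f]) (fact 1 2)+
    qed
    also have "\<dots> = (\<Sum>p\<in>dec \<gamma>. \<Sum>(T, M)\<in>{T \<in> G. deg T = fst p} \<times> msets (snd p). ?g T * (d T * q M))"
    proof (subst sum.Sigma)
      show "\<forall>p\<in>dec \<gamma>. finite ({T \<in> G. deg T = fst p} \<times> msets (snd p))"
        using fin finite_msets by (auto simp: dec_def)
    qed (use finite_dec \<gamma> in \<open>auto simp: case_prod_unfold\<close>)
    also have "\<dots> = (\<Sum>p\<in>dec \<gamma>. \<Sum>T\<in>{T \<in> G. deg T = fst p}. \<Sum>M\<in>msets (snd p). ?g T * (d T * q M))"
      unfolding sum.cartesian_product ..
    also have "\<dots> = (\<Sum>p\<in>dec \<gamma>. hder i x (fst p) * y (snd p))"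
    proof (rule sum.cong)
      fix p assume "p \<in> dec \<gamma>"
      then have p: "fst p \<in> B" "snd p \<in> B" by (auto simp: dec_def)
      have "(\<Sum>T\<in>{T \<in> G. deg T = fst p}. \<Sum>M\<in>msets (snd p). ?g T * (d T * q M)) =
          (\<Sum>T\<in>{T \<in> G. deg T = fst p}. of_int (fst p $ i) * d T * y (snd p))"
        using p by (intro sum.cong) (auto simp: y_def sum_distrib_left mult_ac)
      also have "\<dots> = hder i x (fst p) * y (snd p)"
        using p by (simp add: hder_def x_def sum_distrib_left sum_distrib_right)
      finally show "(\<Sum>T\<in>{T \<in> G. deg T = fst p}. \<Sum>M\<in>msets (snd p). ?g T * (d T * q M)) =
          hder i x (fst p) * y (snd p)" .
    qed simp
    also have "\<dots> = hmult C (hder i x) y \<gamma>"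
      using \<gamma> by (simp add: hmult_dec case_prod_unfold)
    finally show "hder i y \<gamma> = hmult C (hder i x) y \<gamma>" .
  qed
  then have "y \<eta> = hexp C x \<eta>" by (rule fun_cong)
  then show ?thesis using \<eta> by (simp add: y_def q_def)
qed

end

section \<open>The binomial series of 1 - e_\<gamma>\<close>

lemma hpow_be:
  assumes "\<gamma> \<in> C" shows "hpow C (be C \<gamma>) m = be C (int m *s \<gamma>) \<and> int m *s \<gamma> \<in> C"
proof (induction m)
  case 0
  have "int 0 *s \<gamma> = 0" by simp
  then show ?case by simp
next
  case (Suc m)
  have "int (Suc m) *s \<gamma> = \<gamma> + int m *s \<gamma>" by (simp add: vector_sadd_rdistrib)
  then show ?case using Suc assms be_mult_be add_in_cone by simp
qed

text \<open>The coefficient of t^m in the equation t y' = - c t / (1 - t) * y for y = (1 -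
  t)^c.\<close>

lemma gbinomial_alternating_sum:
  fixes c :: complex
  shows "of_nat m * (- 1) ^ m * (c gchoose m) = - c * (\<Sum>l<m. (- 1) ^ l * (c gchoose l))"
proof (induction m)
  case (Suc m)
  have "of_nat (Suc m) * (c gchoose Suc m) = (c - of_nat m) * (c gchoose m)"
    using gbinomial_absorption[of m c] gbinomial_absorb_comp[of c m] by (simp add: algebra_simps)
  then have e: "(- 1) ^ m * (of_nat (Suc m) * (c gchoose Suc m)) = (- 1) ^ m * ((c - of_nat m) * (c gchoose m))"
    by (rule arg_cong)
  have "of_nat (Suc m) * (- 1) ^ Suc m * (c gchoose Suc m) = - ((- 1) ^ m * (of_nat (Suc m) * (c gchoose Suc m)))"
    by simp
  also have "\<dots> = (of_nat m - c) * (- 1) ^ m * (c gchoose m)"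
    unfolding e by (simp add: algebra_simps)
  finally have "of_nat (Suc m) * (- 1) ^ Suc m * (c gchoose Suc m) = (of_nat m - c) * (- 1) ^ m * (c gchoose m)" .
  then show ?case using Suc.IH by (simp add: algebra_simps)
qed simp

lemma scale_inj: "\<gamma> \<noteq> 0 \<Longrightarrow> int m *s \<gamma> = int l *s \<gamma> \<longleftrightarrow> m = l"
  by (auto simp: vec_eq_iff)

text \<open>All exponents involved are multiples of \<gamma>, so the differential equation reduces
  to the one-variable identity \<open>gbinomial_alternating_sum\<close>. The inner sum has at most
  one term; written as a sum it can later be exchanged with a sum over \<gamma>.\<close>

lemma hone_minus_pow_be:
  assumes \<gamma>: "\<gamma> \<in> C" "\<gamma> \<noteq> 0"
  shows "hone_minus_pow C (be C \<gamma>) c =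
    hexp C (\<lambda>\<eta>. if \<eta> \<in> B then \<Sum>n | n \<ge> 1 \<and> \<eta> = int n *s \<gamma>. - c / of_nat n else 0)"
proof -
  define x where "x \<eta> = (if \<eta> \<in> B then \<Sum>n | n \<ge> 1 \<and> \<eta> = int n *s \<gamma>. - c / of_nat n else 0)" for \<eta>
  let ?y = "hone_minus_pow C (be C \<gamma>) c"
  have hone: "?y \<eta> = (\<Sum>m. (c gchoose m) * (- 1) ^ m * be C (int m *s \<gamma>) \<eta>)" for \<eta>
    using hpow_be[OF \<gamma>(1)] by (simp add: hone_minus_pow_def)
  have y_scale: "?y (int m *s \<gamma>) = (c gchoose m) * (- 1) ^ m"
    if "int m *s \<gamma> \<in> B" for m
    unfolding hone using that \<gamma>(2)
    by (subst suminf_finite[of "{m}"]) (auto simp: be_def scale_inj)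
  have y_other: "?y \<eta> = 0" if "\<And>m. \<eta> \<noteq> int m *s \<gamma>" for \<eta>
    unfolding hone using that by (subst suminf_finite[of "{}"]) (auto simp: be_def)
  have y_hat: "?y \<eta> = 0" if "\<eta> \<notin> B" for \<eta>
    unfolding hone using that by (subst suminf_finite[of "{}"]) (auto simp: be_def)
  have x_scale: "x (int m *s \<gamma>) = - c / of_nat m" if "int m *s \<gamma> \<in> B" "m \<ge> 1" for m
  proof -
    have "{n. n \<ge> 1 \<and> int m *s \<gamma> = int n *s \<gamma>} = {m}" using that \<gamma>(2) by (auto simp: scale_inj)
    then show ?thesis using that by (simp add: x_def)
  qed
  have x_other: "x \<eta> = 0" if "\<And>m. m \<ge> 1 \<Longrightarrow> \<eta> \<noteq> int m *s \<gamma>" for \<eta>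
    unfolding x_def using that by (auto intro!: sum.neutral)
  have x0: "x 0 = 0" using \<gamma>(2) scale_inj[of \<gamma> _ 0] by (intro x_other) auto
  have "?y = hexp C x"
  proof (rule hexp_unique[of x, OF x0])
    show "?y \<in> ghat C" using y_hat by (auto simp: ghat_def)
    show "?y 0 = 1" using y_scale[of 0] by simp
    fix i \<eta> assume \<eta>: "\<eta> \<in> B"
    show "hder i ?y \<eta> = hmult C (hder i x) ?y \<eta>"
    proof (cases "\<exists>m. \<eta> = int m *s \<gamma>")
      case False
      have "hder i x a * ?y b = 0" if "(a, b) \<in> dec \<eta>" for a b
      proof (rule ccontr)
        assume "hder i x a * ?y b \<noteq> 0"
        then have "x a \<noteq> 0" "?y b \<noteq> 0" by (auto simp: hder_def)
        then obtain j l where "a = int j *s \<gamma>" "b = int l *s \<gamma>" using x_other y_other by metis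
        then have "\<eta> = int (j + l) *s \<gamma>" using that by (simp add: dec_def vector_sadd_rdistrib)
        then show False using False by blast
      qed
      then have "hmult C (hder i x) ?y \<eta> = 0" by (auto simp: hmult_dec intro!: sum.neutral)
      then show ?thesis using y_other[of \<eta>] False by (simp add: hder_def)
    next
      case True
      then obtain m where m: "\<eta> = int m *s \<gamma>" by blast
      \<comment> \<open>The splittings of m \<gamma> that contribute; l = m is left out because the
        logarithm has no constant term.\<close>
      let ?e = "\<lambda>l. (int (m - l) *s \<gamma>, int l *s \<gamma>)"
      have sum_e: "int (m - l) *s \<gamma> + int l *s \<gamma> = \<eta>" if "l < m" for l
        using that m by (simp add: vec_eq_iff algebra_simps of_nat_diff)
      have in_hat: "int (m - l) *s \<gamma> \<in> B" "int l *s \<gamma> \<in> B" if "l < m" for l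
        using hat_summand[of "int (m - l) *s \<gamma>" "int l *s \<gamma>"] hpow_be[OF \<gamma>(1)] sum_e[OF that] \<eta>
        by auto
      have "hmult C (hder i x) ?y \<eta> = (\<Sum>(a, b)\<in>dec \<eta>. hder i x a * ?y b)"
        using \<eta> by (simp add: hmult_dec)
      also have "\<dots> = (\<Sum>(a, b)\<in>?e ` {..<m}. hder i x a * ?y b)"
      proof (rule sum.mono_neutral_right)
        show "?e ` {..<m} \<subseteq> dec \<eta>" using in_hat sum_e by (auto simp: dec_def)
        show "\<forall>p\<in>dec \<eta> - ?e ` {..<m}. (case p of (a, b) \<Rightarrow> hder i x a * ?y b) = 0"
        proof (intro ballI, rule ccontr)
          fix q assume q: "q \<in> dec \<eta> - ?e ` {..<m}" "(case q of (a, b) \<Rightarrow> hder i x a * ?y b) \<noteq> 0"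
          obtain a b where "q = (a, b)" by (cases q)
          with q have ab: "(a, b) \<in> dec \<eta>" "(a, b) \<notin> ?e ` {..<m}" "hder i x a \<noteq> 0" "?y b \<noteq> 0" by auto
          then have "x a \<noteq> 0" by (auto simp: hder_def)
          then obtain j l where jl: "a = int j *s \<gamma>" "j \<ge> 1" "b = int l *s \<gamma>"
            using x_other y_other ab by metis
          then have "int m *s \<gamma> = int (j + l) *s \<gamma>"
            using ab m by (simp add: dec_def vector_sadd_rdistrib)
          then have "m = j + l" using scale_inj[OF \<gamma>(2), of m "j + l"] by blast
          then have "(a, b) = ?e l" "l < m" using jl by auto
          then show False using ab(2) by blast
        qed
      qed (use \<eta> finite_dec in auto)
      also have "\<dots> = (\<Sum>l<m. hder i x (int (m - l) *s \<gamma>) * ?y (int l *s \<gamma>))"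
        by (subst sum.reindex) (auto simp: inj_on_def scale_inj \<gamma>(2))
      also have "\<dots> = (\<Sum>l<m. of_int (\<gamma> $ i) * (- c * ((- 1) ^ l * (c gchoose l))))"
      proof (rule sum.cong)
        fix l assume "l \<in> {..<m}"
        then have l: "l < m" by simp
        define d where "d = m - l"
        have d: "d \<ge> 1" "int d *s \<gamma> \<in> B" using in_hat(1)[OF l] l by (auto simp: d_def)
        have "hder i x (int d *s \<gamma>) = of_nat d * of_int (\<gamma> $ i) * (- c / of_nat d)"
          using x_scale[OF d(2,1)] by (simp add: hder_def)
        also have "\<dots> = - c * of_int (\<gamma> $ i)" using d by simp
        finally have "hder i x (int (m - l) *s \<gamma>) = - c * of_int (\<gamma> $ i)" by (simp only: d_def)
        then show "hder i x (int (m - l) *s \<gamma>) * ?y (int l *s \<gamma>) =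
            of_int (\<gamma> $ i) * (- c * ((- 1) ^ l * (c gchoose l)))"
          using y_scale in_hat(2)[OF l] by (simp add: mult_ac)
      qed simp
      also have "\<dots> = of_int (\<gamma> $ i) * (of_nat m * (- 1) ^ m * (c gchoose m))"
        unfolding gbinomial_alternating_sum by (simp add: sum_distrib_left)
      also have "\<dots> = hder i ?y \<eta>" using \<eta> m y_scale by (simp add: hder_def)
      finally show ?thesis by simp
    qed
  qed
  then show ?thesis unfolding x_def .
qed


subsection \<open>Triangular automorphisms\<close>

text \<open>Triangularity along the cone. It makes the infinite sum in \<open>hext\<close> finite at
  each exponent, so that no summability has to be discussed.\<close>

definition lower :: "('n lat \<Rightarrow> 'n ser) \<Rightarrow> bool" where
  "lower \<phi> \<longleftrightarrow> (\<forall>\<alpha> \<eta>. \<phi> \<alpha> \<eta> \<noteq> 0 \<longrightarrow> \<eta> \<in> B \<and> \<alpha> \<in> B \<and> \<eta> - \<alpha> \<in> B)"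

lemma hext_eq_sum:
  assumes "lower \<phi>" "\<eta> \<in> basis_le C k"
  shows "hext C \<phi> x \<eta> = (\<Sum>\<alpha>\<in>basis_le C k. x \<alpha> * \<phi> \<alpha> \<eta>)"
proof -
  have "\<alpha> \<in> basis_le C k" if "\<phi> \<alpha> \<eta> \<noteq> 0" for \<alpha>
    using that assms basis_le_summand[of \<alpha> "\<eta> - \<alpha>" k] hat_subset_cone by (auto simp: lower_def)
  then have "hext C \<phi> x \<eta> = (\<Sum>\<^sub>\<infinity>\<alpha>\<in>basis_le C k. x \<alpha> * \<phi> \<alpha> \<eta>)"
    unfolding hext_def using basis_le_subset_hat by (intro infsum_cong_neutral) auto
  then show ?thesis using finite_basis_le by simp
qed

lemma hext_in_ghat: "lower \<phi> \<Longrightarrow> hext C \<phi> x \<in> ghat C"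
proof -
  assume "lower \<phi>"
  then have "\<phi> \<alpha> \<eta> = 0" if "\<eta> \<notin> B" for \<alpha> \<eta> using that by (auto simp: lower_def)
  then show ?thesis by (auto simp: ghat_def hext_def intro: infsum_0)
qed

lemma hext_lincomb:
  assumes "lower \<phi>"
  shows "hext C \<phi> (\<lambda>\<gamma>. c * x \<gamma> + d * y \<gamma>) = (\<lambda>\<gamma>. c * hext C \<phi> x \<gamma> + d * hext C \<phi> y \<gamma>)"
proof (rule ext)
  fix \<eta>
  show "hext C \<phi> (\<lambda>\<gamma>. c * x \<gamma> + d * y \<gamma>) \<eta> = c * hext C \<phi> x \<eta> + d * hext C \<phi> y \<eta>"
  proof (cases "\<eta> \<in> B")
    case True
    then obtain k where "\<eta> \<in> basis_le C k" using hat_obtain by blast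
    then show ?thesis
      by (simp add: hext_eq_sum[OF assms] sum_distrib_left sum.distrib algebra_simps)
  qed (simp add: ghat_D[OF hext_in_ghat[OF assms]])
qed

definition tw_basis :: "('n lat \<Rightarrow> complex) \<Rightarrow> ('n lat \<Rightarrow> 'n ser) \<Rightarrow> 'n lat \<Rightarrow> 'n ser" where
  "tw_basis c p \<alpha> = hmult C (\<lambda>\<eta>. c \<alpha> * be C \<alpha> \<eta>) (hexp C (p \<alpha>))"

definition twist :: "('n lat \<Rightarrow> complex) \<Rightarrow> ('n lat \<Rightarrow> 'n ser) \<Rightarrow> 'n ser \<Rightarrow> 'n ser" where
  "twist c p = hext C (tw_basis c p)"

lemma tw_basis_eq:
  "tw_basis c p \<alpha> \<eta> = (if \<alpha> \<in> B \<and> \<eta> \<in> B \<and> \<eta> - \<alpha> \<in> B then c \<alpha> * hexp C (p \<alpha>) (\<eta> - \<alpha>) else 0)"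
  by (simp add: tw_basis_def hmult_scale_left hmult_be)

lemma lower_tw_basis: "lower (tw_basis c p)"
  by (auto simp: lower_def tw_basis_eq split: if_splits)

lemma tw_basis_in_ghat [simp]: "tw_basis c p \<alpha> \<in> ghat C"
  by (simp add: tw_basis_def)

lemma twist_eq_sum:
  "\<eta> \<in> basis_le C k \<Longrightarrow> twist c p x \<eta> = (\<Sum>\<alpha>\<in>basis_le C k. x \<alpha> * tw_basis c p \<alpha> \<eta>)"
  unfolding twist_def by (rule hext_eq_sum[OF lower_tw_basis])

lemma twist_in_ghat [simp]: "twist c p x \<in> ghat C"
  unfolding twist_def by (rule hext_in_ghat[OF lower_tw_basis])

lemma twist_be: "twist c p (be C \<alpha>) = tw_basis c p \<alpha>"
proof (cases "\<alpha> \<in> B")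
  case False
  then have "be C \<alpha> = (\<lambda>_. 0)" "tw_basis c p \<alpha> = (\<lambda>_. 0)" by (auto simp: be_def tw_basis_eq)
  then show ?thesis by (simp add: twist_def hext_def)
qed (simp add: twist_def hext_be)

text \<open>Continuity of \<open>twist\<close>: at a fixed exponent both its own sum and the one
  defining \<open>hext\<close> are finite, so they may be swapped.\<close>

lemma twist_comp_hext:
  assumes "lower \<psi>" shows "twist c p (hext C \<psi> x) = hext C (\<lambda>\<alpha>. twist c p (\<psi> \<alpha>)) x"
proof (rule ext)
  fix \<eta>
  have low: "lower (\<lambda>\<alpha>. twist c p (\<psi> \<alpha>))" unfolding lower_def
  proof (intro allI impI)
    fix \<alpha> \<eta> assume nz: "twist c p (\<psi> \<alpha>) \<eta> \<noteq> 0"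
    then have \<eta>: "\<eta> \<in> B" using ghat_D[OF twist_in_ghat] by metis
    then obtain k where k: "\<eta> \<in> basis_le C k" using hat_obtain by blast
    have "(\<Sum>\<beta>\<in>basis_le C k. \<psi> \<alpha> \<beta> * tw_basis c p \<beta> \<eta>) \<noteq> 0"
      using nz by (simp add: twist_eq_sum[OF k])
    then obtain \<beta> where "\<psi> \<alpha> \<beta> * tw_basis c p \<beta> \<eta> \<noteq> 0"
      by (rule sum.not_neutral_contains_not_neutral)
    then have "\<psi> \<alpha> \<beta> \<noteq> 0" "tw_basis c p \<beta> \<eta> \<noteq> 0" by auto
    then have *: "\<alpha> \<in> B" "\<beta> - \<alpha> \<in> B" "\<eta> - \<beta> \<in> B"
      using assms lower_tw_basis by (auto simp: lower_def)
    then have "(\<eta> - \<beta>) + (\<beta> - \<alpha>) \<in> C" using add_in_cone hat_subset_cone by blast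
    then have "\<eta> - \<alpha> \<in> B" using hat_summand(2)[of \<alpha> "\<eta> - \<alpha>"] * \<eta> hat_subset_cone by simp
    then show "\<eta> \<in> B \<and> \<alpha> \<in> B \<and> \<eta> - \<alpha> \<in> B" using \<eta> * by simp
  qed
  show "twist c p (hext C \<psi> x) \<eta> = hext C (\<lambda>\<alpha>. twist c p (\<psi> \<alpha>)) x \<eta>"
  proof (cases "\<eta> \<in> B")
    case True
    then obtain k where k: "\<eta> \<in> basis_le C k" using hat_obtain by blast
    have "twist c p (hext C \<psi> x) \<eta> =
        (\<Sum>\<beta>\<in>basis_le C k. \<Sum>\<alpha>\<in>basis_le C k. x \<alpha> * \<psi> \<alpha> \<beta> * tw_basis c p \<beta> \<eta>)"
      by (simp add: twist_eq_sum[OF k] hext_eq_sum[OF assms] sum_distrib_right)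
    also have "\<dots> = (\<Sum>\<alpha>\<in>basis_le C k. \<Sum>\<beta>\<in>basis_le C k. x \<alpha> * \<psi> \<alpha> \<beta> * tw_basis c p \<beta> \<eta>)"
      by (rule sum.swap)
    also have "\<dots> = hext C (\<lambda>\<alpha>. twist c p (\<psi> \<alpha>)) x \<eta>"
      by (simp add: twist_eq_sum[OF k] hext_eq_sum[OF low k] sum_distrib_left mult.assoc)
    finally show ?thesis .
  qed (use ghat_D[OF twist_in_ghat] ghat_D[OF hext_in_ghat[OF low]] in simp)
qed

context
  fixes c :: "'n lat \<Rightarrow> complex" and p :: "'n lat \<Rightarrow> 'n ser"
  assumes c_add: "\<And>a b. c (a + b) = c a * c b" and c_nz: "\<And>a. c a \<noteq> 0"
    and p_add: "\<And>a b. p (a + b) = (\<lambda>\<eta>. p a \<eta> + p b \<eta>)" and p_0: "\<And>a. p a 0 = 0"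
begin

lemma tw_basis_add:
  assumes "\<alpha> \<in> C" "\<beta> \<in> C"
  shows "hmult C (tw_basis c p \<alpha>) (tw_basis c p \<beta>) = tw_basis c p (\<alpha> + \<beta>)"
proof -
  have tw: "tw_basis c p a = (\<lambda>\<gamma>. c a * hmult C (be C a) (hexp C (p a)) \<gamma>)" for a
    by (simp add: tw_basis_def hmult_scale_left)
  have "hmult C (hmult C a E) (hmult C b F) = hmult C (hmult C a b) (hmult C E F)" for a b E F
    by (simp add: hmult_assoc hmult_left_comm[of E])
  then show ?thesis
    by (simp add: tw hmult_scale_left hmult_scale_right be_mult_be assms c_add p_add hexp_add p_0 mult_ac)
qed

lemma c_zero: "c 0 = 1"
  using c_add[of 0 0] c_nz[of 0] by simp

lemma tw_basis_0: "tw_basis c p 0 = be C 0"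
proof -
  have "p 0 = (\<lambda>_. 0)" using p_add[of 0 0] by (auto simp: fun_eq_iff)
  then show ?thesis by (simp add: tw_basis_def hexp_zero c_zero be_mult_be)
qed

lemma tw_basis_diag: "\<alpha> \<in> B \<Longrightarrow> tw_basis c p \<alpha> \<alpha> = c \<alpha>"
  by (simp add: tw_basis_eq hexp_0 p_0)

lemma twist_hmult: "twist c p (hmult C x y) = hmult C (twist c p x) (twist c p y)"
proof (rule ext)
  fix \<eta>
  let ?t = "tw_basis c p"
  show "twist c p (hmult C x y) \<eta> = hmult C (twist c p x) (twist c p y) \<eta>"
  proof (cases "\<eta> \<in> B")
    case True
    then obtain k where k: "\<eta> \<in> basis_le C k" using hat_obtain by blast
    let ?K = "basis_le C k"
    have KB: "\<alpha> \<in> B" "\<alpha> \<in> C" if "\<alpha> \<in> ?K" for \<alpha>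
      using that basis_le_subset_hat hat_subset_cone by blast+
    have "hmult C (twist c p x) (twist c p y) \<eta> =
        (\<Sum>q\<in>dec \<eta>. (\<Sum>\<alpha>\<in>?K. x \<alpha> * ?t \<alpha> (fst q)) * (\<Sum>\<beta>\<in>?K. y \<beta> * ?t \<beta> (snd q)))"
    proof -
      have "twist c p x (fst q) * twist c p y (snd q) =
          (\<Sum>\<alpha>\<in>?K. x \<alpha> * ?t \<alpha> (fst q)) * (\<Sum>\<beta>\<in>?K. y \<beta> * ?t \<beta> (snd q))" if "q \<in> dec \<eta>" for q
        using that dec_basis_le[of "fst q" "snd q" \<eta> k] k by (simp add: twist_eq_sum[of _ k])
      then show ?thesis using True by (simp add: hmult_dec case_prod_unfold)
    qed
    also have "\<dots> = (\<Sum>q\<in>dec \<eta>. \<Sum>(\<alpha>, \<beta>)\<in>?K \<times> ?K. x \<alpha> * y \<beta> * (?t \<alpha> (fst q) * ?t \<beta> (snd q)))"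
      by (simp add: sum_product sum.cartesian_product mult_ac)
    also have "\<dots> = (\<Sum>(\<alpha>, \<beta>)\<in>?K \<times> ?K. \<Sum>q\<in>dec \<eta>. x \<alpha> * y \<beta> * (?t \<alpha> (fst q) * ?t \<beta> (snd q)))"
      unfolding case_prod_unfold by (rule sum.swap)
    also have "\<dots> = (\<Sum>(\<alpha>, \<beta>)\<in>?K \<times> ?K. x \<alpha> * y \<beta> * ?t (\<alpha> + \<beta>) \<eta>)"
    proof (rule sum.cong, goal_cases)
      case (2 q)
      then have "hmult C (?t (fst q)) (?t (snd q)) \<eta> = ?t (fst q + snd q) \<eta>"
        using KB by (auto simp: tw_basis_add)
      then show ?case using True by (simp add: hmult_dec case_prod_unfold sum_distrib_left[symmetric])
    qed simp
    \<comment> \<open>Pairs are regrouped by their sum. A pair whose sum leaves level k has no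
      counterpart in the new index set, but the image of such a sum has no coefficient at
      \<eta>.\<close>
    also have "\<dots> = (\<Sum>(\<epsilon>, \<alpha>, \<beta>)\<in>Sigma ?K dec. x \<alpha> * y \<beta> * ?t \<epsilon> \<eta>)"
    proof (rule sym, rule sum.reindex_bij_betw_not_neutral[of "{}" "{(\<alpha>, \<beta>) \<in> ?K \<times> ?K. \<alpha> + \<beta> \<notin> ?K}"
          "\<lambda>(\<epsilon>, q). q" "Sigma ?K dec" "?K \<times> ?K" "\<lambda>(\<alpha>, \<beta>). x \<alpha> * y \<beta> * ?t (\<alpha> + \<beta>) \<eta>", THEN trans[rotated]])
      show "finite {(\<alpha>, \<beta>) \<in> ?K \<times> ?K. \<alpha> + \<beta> \<notin> ?K}"
        by (rule finite_subset[of _ "?K \<times> ?K"]) (auto simp: finite_basis_le)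
      show "bij_betw (\<lambda>(\<epsilon>, q). q) (Sigma ?K dec - {}) (?K \<times> ?K - {(\<alpha>, \<beta>) \<in> ?K \<times> ?K. \<alpha> + \<beta> \<notin> ?K})"
        by (rule bij_betwI[of _ _ _ "\<lambda>(\<alpha>, \<beta>). (\<alpha> + \<beta>, \<alpha>, \<beta>)"]) (auto dest: dec_basis_le KB simp: dec_def)
      show "(case q of (\<alpha>, \<beta>) \<Rightarrow> x \<alpha> * y \<beta> * ?t (\<alpha> + \<beta>) \<eta>) = 0"
        if "q \<in> {(\<alpha>, \<beta>) \<in> ?K \<times> ?K. \<alpha> + \<beta> \<notin> ?K}" for q
      proof -
        obtain \<alpha> \<beta> where q: "q = (\<alpha>, \<beta>)" by (cases q)
        have "\<not> (\<alpha> + \<beta> \<in> B \<and> \<eta> - (\<alpha> + \<beta>) \<in> B)"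
          using basis_le_summand(1)[of "\<alpha> + \<beta>" "\<eta> - (\<alpha> + \<beta>)" k] k that hat_subset_cone q by auto
        then show ?thesis by (auto simp: q tw_basis_eq)
      qed
    qed (auto simp: dec_def intro!: sum.cong)
    also have "\<dots> = (\<Sum>\<epsilon>\<in>?K. \<Sum>(\<alpha>, \<beta>)\<in>dec \<epsilon>. x \<alpha> * y \<beta> * ?t \<epsilon> \<eta>)"
      using finite_basis_le finite_dec KB by (subst sum.Sigma) auto
    also have "\<dots> = twist c p (hmult C x y) \<eta>"
      using KB by (auto simp: twist_eq_sum[OF k] hmult_dec sum_distrib_right case_prod_unfold intro!: sum.cong)
    finally show ?thesis by simp
  qed (simp add: ghat_D[OF twist_in_ghat] hmult_dec)
qed

lemma twist_at_0: "twist c p x 0 = x 0"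
  by (subst twist_eq_sum[of _ 0]) (auto simp: basis_le_0 tw_basis_diag c_zero)

text \<open>A homomorphism preserves powers, and since the constant term is preserved the same
  cut-off k serves x and its image. Only finite sums have to be compared.\<close>

lemma twist_hexp:
  assumes x: "x 0 = 0" shows "twist c p (hexp C x) = hexp C (twist c p x)"
proof (rule ext)
  fix \<eta>
  have pow: "twist c p (hpow C x m) = hpow C (twist c p x) m" for m
    by (induction m) (simp_all add: twist_be tw_basis_0 twist_hmult)
  show "twist c p (hexp C x) \<eta> = hexp C (twist c p x) \<eta>"
  proof (cases "\<eta> \<in> B")
    case True
    then obtain k where k: "\<eta> \<in> basis_le C k" using hat_obtain by blast
    have "twist c p (hexp C x) \<eta> =
        (\<Sum>\<alpha>\<in>basis_le C k. \<Sum>m\<le>k. hpow C x m \<alpha> * tw_basis c p \<alpha> \<eta> / fact m)"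
      by (simp add: twist_eq_sum[OF k] hexp_eq_sum[of x _ k k, OF x] sum_distrib_right)
    also have "\<dots> = (\<Sum>m\<le>k. \<Sum>\<alpha>\<in>basis_le C k. hpow C x m \<alpha> * tw_basis c p \<alpha> \<eta> / fact m)"
      by (rule sum.swap)
    also have "\<dots> = hexp C (twist c p x) \<eta>"
      using k x by (simp add: hexp_eq_sum[of "twist c p x" _ k k] twist_at_0 pow[symmetric]
          twist_eq_sum[OF k] sum_divide_distrib)
    finally show ?thesis .
  qed (simp add: ghat_D)
qed

text \<open>As a matrix ordered by height, \<open>twist\<close> is triangular with the nonzero
  entries c \<gamma> on the diagonal; bijectivity follows by substitution.\<close>

lemma twist_diag_plus:
  assumes "\<gamma> \<in> B"
  shows "twist c p x \<gamma> = c \<gamma> * x \<gamma> + (\<Sum>\<alpha> | \<alpha> \<in> B \<and> ht \<alpha> < ht \<gamma> \<and> \<gamma> - \<alpha> \<in> B. x \<alpha> * tw_basis c p \<alpha> \<gamma>)"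
proof -
  obtain k where k: "\<gamma> \<in> basis_le C k" using hat_obtain assms by blast
  have sub: "{\<alpha>. \<alpha> \<in> B \<and> ht \<alpha> < ht \<gamma> \<and> \<gamma> - \<alpha> \<in> B} \<subseteq> basis_le C k - {\<gamma>}"
  proof
    fix \<alpha> assume "\<alpha> \<in> {\<alpha>. \<alpha> \<in> B \<and> ht \<alpha> < ht \<gamma> \<and> \<gamma> - \<alpha> \<in> B}"
    then show "\<alpha> \<in> basis_le C k - {\<gamma>}"
      using basis_le_summand(1)[of \<alpha> "\<gamma> - \<alpha>" k] hat_subset_cone k by auto
  qed
  have "tw_basis c p \<alpha> \<gamma> = 0" if "\<alpha> \<in> basis_le C k - {\<gamma>} - {\<alpha>. \<alpha> \<in> B \<and> ht \<alpha> < ht \<gamma> \<and> \<gamma> - \<alpha> \<in> B}" for \<alpha>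
    using that ht_less[of \<alpha> "\<gamma> - \<alpha>"] hat_subset_cone assms by (auto simp: tw_basis_eq)
  then have "(\<Sum>\<alpha> | \<alpha> \<in> B \<and> ht \<alpha> < ht \<gamma> \<and> \<gamma> - \<alpha> \<in> B. x \<alpha> * tw_basis c p \<alpha> \<gamma>) =
      (\<Sum>\<alpha>\<in>basis_le C k - {\<gamma>}. x \<alpha> * tw_basis c p \<alpha> \<gamma>)"
    using sub finite_basis_le by (intro sum.mono_neutral_left) auto
  then show ?thesis
    unfolding twist_eq_sum[OF k] using k assms finite_basis_le by (simp add: sum.remove[of _ \<gamma>] tw_basis_diag)
qed

lemma twist_Aut: "twist c p \<in> Aut_hat C"
proof -
  have "inj_on (twist c p) (ghat C)"
  proof (rule inj_onI, rule ext)
    fix x y \<gamma> assume xy: "x \<in> ghat C" "y \<in> ghat C" "twist c p x = twist c p y"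
    show "x \<gamma> = y \<gamma>"
    proof (cases "\<gamma> \<in> B")
      case True
      then show ?thesis
      proof (induction "ht \<gamma>" arbitrary: \<gamma> rule: less_induct)
        case less
        have "twist c p x \<gamma> = twist c p y \<gamma>" using xy by simp
        then have "c \<gamma> * x \<gamma> = c \<gamma> * y \<gamma>"
          unfolding twist_diag_plus[OF less.prems] using less.hyps by (simp cong: conj_cong)
        then show ?case using c_nz by simp
      qed
    qed (simp add: xy(1,2)[THEN ghat_D])
  qed
  moreover have "twist c p ` ghat C = ghat C"
  proof
    show "ghat C \<subseteq> twist c p ` ghat C"
    proof
      fix y assume y: "y \<in> ghat C"
      \<comment> \<open>One step of forward substitution for the equation
        \<open>twist c p x = y\<close>. It uses f at smaller heights only, so a well-founded fixed
        point exists.\<close>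
      define H where "H f \<gamma> = (if \<gamma> \<in> B then
         (y \<gamma> - (\<Sum>\<alpha> | \<alpha> \<in> B \<and> ht \<alpha> < ht \<gamma> \<and> \<gamma> - \<alpha> \<in> B. f \<alpha> * tw_basis c p \<alpha> \<gamma>)) / c \<gamma> else 0)" for f \<gamma>
      define x where "x = wfrec (Wellfounded.measure ht) H"
      have x: "x \<gamma> = H x \<gamma>" for \<gamma>
      proof -
        have "x \<gamma> = H (cut x (Wellfounded.measure ht) \<gamma>) \<gamma>" unfolding x_def by (rule wfrec) simp
        also have "\<dots> = H x \<gamma>" unfolding H_def by (auto simp: cut_def)
        finally show ?thesis .
      qed
      have "x \<gamma> = 0" if "\<gamma> \<notin> B" for \<gamma> using that by (subst x) (simp add: H_def)
      then have "x \<in> ghat C" by (auto simp: ghat_def)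
      moreover have "twist c p x = y"
      proof (rule ext)
        fix \<gamma> show "twist c p x \<gamma> = y \<gamma>"
        proof (cases "\<gamma> \<in> B")
          case True
          have "x \<gamma> = (y \<gamma> - (\<Sum>\<alpha> | \<alpha> \<in> B \<and> ht \<alpha> < ht \<gamma> \<and> \<gamma> - \<alpha> \<in> B. x \<alpha> * tw_basis c p \<alpha> \<gamma>)) / c \<gamma>"
            using True by (subst x) (simp add: H_def)
          then show ?thesis unfolding twist_diag_plus[OF True, of x] using c_nz[of \<gamma>] by simp
        qed (use y in \<open>simp add: ghat_D\<close>)
      qed
      ultimately show "y \<in> twist c p ` ghat C" by blast
    qed
  qed auto
  ultimately show ?thesis
    using hext_lincomb[OF lower_tw_basis[of c p], of 1 _ 1] hext_lincomb[OF lower_tw_basis[of c p], of _ _ 0]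
    by (auto simp: Aut_hat_def bij_betw_def twist_hmult twist_def[symmetric])
qed

end

end


section \<open>Automorphisms of decorated trees\<close>

lemma set_entries [simp]: "set_mset (entries T) = set_rtree T"
  by (induction T) auto

lemma entries_map: "entries (map_rtree f T) = image_mset f (entries T)"
proof (induction T)
  case (Node a M)
  then have "image_mset (\<lambda>t. entries (map_rtree f t)) M = image_mset (\<lambda>t. image_mset f (entries t)) M"
    by (intro image_mset_cong) auto
  moreover have "(\<Sum>t\<in>#M. image_mset f (entries t)) = image_mset f (\<Sum>t\<in>#M. entries t)"
    by (induction M) auto
  ultimately show ?case by (simp add: multiset.map_comp comp_def)
qed

lemma rroot_in_set [simp]: "rroot T \<in> set_rtree T"
  by (cases T) auto

lemma finite_set_rtree [simp]: "finite (set_rtree T)"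
  by (metis finite_set_mset set_entries)

section \<open>Labelled forests and their isomorphisms\<close>

definition forest_set :: "'v rtree multiset \<Rightarrow> 'v set" where
  "forest_set N = (\<Union>t\<in>set_mset N. set_rtree t)"

definition forest_distinct :: "'v rtree multiset \<Rightarrow> bool" where
  "forest_distinct N \<longleftrightarrow> (\<forall>v. count (\<Sum>t\<in>#N. entries t) v \<le> 1)"

lemma forest_set_simps [simp]:
  "forest_set {#} = {}" "forest_set (add_mset t N) = set_rtree t \<union> forest_set N"
  by (auto simp: forest_set_def)

lemma set_rtree_Node: "set_rtree (Node a N) = {a} \<union> forest_set N"
  by (auto simp: forest_set_def)

lemma set_forest_entries: "set_mset (\<Sum>t\<in>#N. entries t) = forest_set N"
  by (auto simp: forest_set_def)

lemma count_forest_entries: "count (\<Sum>t\<in>#N. entries t) v = 0 \<longleftrightarrow> v \<notin> forest_set N"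
  by (simp only: set_forest_entries[symmetric] count_eq_zero_iff)

lemma finite_forest_set [simp]: "finite (forest_set N)"
  by (simp add: forest_set_def)

lemma distinct_Node: "distinct_entries (Node a N) \<longleftrightarrow> a \<notin> forest_set N \<and> forest_distinct N"
  using count_forest_entries[of N a] by (force simp: distinct_entries_def forest_distinct_def)

lemma forest_distinct_add:
  "forest_distinct (add_mset t N) \<longleftrightarrow>
     distinct_entries t \<and> forest_distinct N \<and> set_rtree t \<inter> forest_set N = {}"
proof -
  have "(x + y \<le> 1) = (x \<le> 1 \<and> y \<le> 1 \<and> \<not> (0 < x \<and> 0 < y))" for x y :: nat by auto
  moreover have "(0 < count (entries t) v \<and> 0 < count (\<Sum>t\<in>#N. entries t) v) \<longleftrightarrow>
      v \<in> set_rtree t \<inter> forest_set N" for v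
    unfolding set_entries[symmetric] set_forest_entries[symmetric] by simp
  ultimately show ?thesis
    by (simp only: distinct_entries_def forest_distinct_def image_mset_add_mset sum_mset.add_mset
        count_union) blast
qed

text \<open>Labelled branches share no vertex, so they cannot repeat even when their decorations
  agree. This turns multiplicities of decorated branches into cardinalities.\<close>

lemma forest_distinct_count: "forest_distinct N \<Longrightarrow> t \<in># N \<Longrightarrow> count N t = 1"
proof -
  assume N: "forest_distinct N" "t \<in># N"
  then obtain N1 where N1: "N = add_mset t N1" by (metis multi_member_split)
  then have "rroot t \<notin> forest_set N1" using N(1) rroot_in_set[of t] unfolding N1 forest_distinct_add by blast
  then have "t \<notin># N1" using rroot_in_set[of t] by (auto simp: forest_set_def)
  then show "count N t = 1" by (simp add: N1 not_in_iff)
qed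

text \<open>Extensionality pins the values outside the domain, so a map on a disjoint union is the
  same as its two restrictions; independent choices on separate branches multiply.\<close>

lemma card_extensional_glue:
  assumes "A \<inter> D = {}" "X \<subseteq> extensional A" "Y \<subseteq> extensional D"
  shows "card {\<sigma> \<in> extensional (A \<union> D). restrict \<sigma> A \<in> X \<and> restrict \<sigma> D \<in> Y} = card X * card Y"
proof -
  have "bij_betw (\<lambda>\<sigma>. (restrict \<sigma> A, restrict \<sigma> D))
      {\<sigma> \<in> extensional (A \<union> D). restrict \<sigma> A \<in> X \<and> restrict \<sigma> D \<in> Y} (X \<times> Y)"
  proof (rule bij_betwI[where g = "\<lambda>(f, g) x. if x \<in> A then f x else g x"])
    have *: "restrict (\<lambda>x. if x \<in> A then f x else g x) A = f"
      "restrict (\<lambda>x. if x \<in> A then f x else g x) D = g" if "f \<in> X" "g \<in> Y" for f g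
      using that assms by (auto simp: fun_eq_iff extensional_def restrict_def subset_iff)
    show "(\<lambda>(f, g) x. if x \<in> A then f x else g x) \<in>
        X \<times> Y \<rightarrow> {\<sigma> \<in> extensional (A \<union> D). restrict \<sigma> A \<in> X \<and> restrict \<sigma> D \<in> Y}"
      using * assms(3) by (auto simp: extensional_def subset_iff)
    show "(restrict ((\<lambda>(f, g) x. if x \<in> A then f x else g x) y) A,
        restrict ((\<lambda>(f, g) x. if x \<in> A then f x else g x) y) D) = y" if "y \<in> X \<times> Y" for y
      using that * by auto
  qed (auto simp: fun_eq_iff extensional_def restrict_def)
  then show ?thesis by (simp add: bij_betw_same_card card_cartesian_product)
qed

text \<open>Maps between two trees rather than automorphisms of one, because an automorphism may
  carry a branch to another branch. Injectivity comes for free when the entries of the target are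
  distinct.\<close>

definition tree_isos :: "('v \<Rightarrow> 'a) \<Rightarrow> 'v rtree \<Rightarrow> 'v rtree \<Rightarrow> ('v \<Rightarrow> 'v) set" where
  "tree_isos \<alpha> L L' = {\<sigma> \<in> extensional (set_rtree L). map_rtree \<sigma> L = L' \<and>
     (\<forall>v\<in>set_rtree L. \<alpha> (\<sigma> v) = \<alpha> v)}"

definition forest_isos :: "('v \<Rightarrow> 'a) \<Rightarrow> 'v rtree multiset \<Rightarrow> 'v rtree multiset \<Rightarrow> ('v \<Rightarrow> 'v) set" where
  "forest_isos \<alpha> N N' = {\<sigma> \<in> extensional (forest_set N). image_mset (map_rtree \<sigma>) N = N' \<and>
     (\<forall>v\<in>forest_set N. \<alpha> (\<sigma> v) = \<alpha> v)}"

text \<open>A recursion on isomorphism classes that refers to no labelling;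
  \<open>aut_order_eq\<close> identifies it with \<open>aut_order\<close>.\<close>

primrec autn :: "'a rtree \<Rightarrow> nat" where
  "autn (Node a M) = \<Prod>\<^sub># (image_mset autn M) * mfact M"

lemma map_rtree_restrict:
  "set_rtree t \<subseteq> A \<Longrightarrow> map_rtree (restrict \<sigma> A) t = map_rtree \<sigma> t"
  by (rule rtree.map_cong) auto

lemma image_map_rtree_restrict:
  "forest_set N \<subseteq> A \<Longrightarrow> image_mset (map_rtree (restrict \<sigma> A)) N = image_mset (map_rtree \<sigma>) N"
  by (rule image_mset_cong, rule map_rtree_restrict) (auto simp: forest_set_def)

lemma tree_isos_label: "\<sigma> \<in> tree_isos \<alpha> L L' \<Longrightarrow> map_rtree \<alpha> L' = map_rtree \<alpha> L"
  using rtree.map_cong[of L L "\<alpha> \<circ> \<sigma>" \<alpha>] by (auto simp: tree_isos_def rtree.map_comp)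

text \<open>An isomorphism chooses the image of t among the branches of N' with the same decoration
  and is then free on the rest; the successive numbers of choices multiply up to
  \<open>mfact\<close>. The first assumption is the induction hypothesis of
  \<open>card_tree_isos\<close> for the branches.\<close>

lemma card_forest_isos:
  assumes "\<And>t L'. t \<in># N \<Longrightarrow> distinct_entries t \<Longrightarrow> distinct_entries L' \<Longrightarrow>
      map_rtree \<alpha> t = map_rtree \<alpha> L' \<Longrightarrow> card (tree_isos \<alpha> t L') = autn (map_rtree \<alpha> t)"
    and "forest_distinct N" "forest_distinct N'"
    and "image_mset (map_rtree \<alpha>) N = image_mset (map_rtree \<alpha>) N'"
  shows "card (forest_isos \<alpha> N N') =
    (\<Prod>t\<in>#N. autn (map_rtree \<alpha> t)) * mfact (image_mset (map_rtree \<alpha>) N)"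
  using assms
proof (induction N arbitrary: N')
  case empty
  then have "forest_isos \<alpha> {#} N' = {\<lambda>_. undefined}" by (auto simp: forest_isos_def)
  then show ?case by simp
next
  case (add t N)
  let ?l = "map_rtree \<alpha>"
  let ?X = "\<lambda>t'. {\<sigma> \<in> extensional (set_rtree t \<union> forest_set N).
      restrict \<sigma> (set_rtree t) \<in> tree_isos \<alpha> t t' \<and>
      restrict \<sigma> (forest_set N) \<in> forest_isos \<alpha> N (N' - {#t'#})}"
  have dis: "distinct_entries t" "forest_distinct N" "set_rtree t \<inter> forest_set N = {}"
    using add.prems(2) by (auto simp: forest_distinct_add)
  have "forest_isos \<alpha> (add_mset t N) N' = (\<Union>t'\<in>set_mset N'. ?X t')"
  proof (intro equalityI subsetI)
    fix \<sigma> assume \<sigma>: "\<sigma> \<in> forest_isos \<alpha> (add_mset t N) N'"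
    then have "N' = add_mset (map_rtree \<sigma> t) (image_mset (map_rtree \<sigma>) N)"
      by (auto simp: forest_isos_def)
    with \<sigma> show "\<sigma> \<in> (\<Union>t'\<in>set_mset N'. ?X t')"
      by (intro UN_I[of "map_rtree \<sigma> t"])
        (auto simp: forest_isos_def tree_isos_def map_rtree_restrict image_map_rtree_restrict)
  next
    fix \<sigma> assume "\<sigma> \<in> (\<Union>t'\<in>set_mset N'. ?X t')"
    then show "\<sigma> \<in> forest_isos \<alpha> (add_mset t N) N'"
      by (auto simp: forest_isos_def tree_isos_def map_rtree_restrict image_map_rtree_restrict)
  qed
  moreover have "card (\<Union>t'\<in>set_mset N'. ?X t') = (\<Sum>t'\<in>set_mset N'. card (?X t'))"
  proof (rule card_UN_disjoint')
    show "disjoint_family_on ?X (set_mset N')"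
      by (auto simp: disjoint_family_on_def tree_isos_def)
    fix t'
    \<comment> \<open>Adding up cardinalities needs finite sets; the values of these maps are
      confined to the vertices of the targets.\<close>
    have "?X t' \<subseteq> PiE (set_rtree t \<union> forest_set N) (\<lambda>_. set_rtree t' \<union> forest_set N')"
    proof
      fix \<sigma> assume \<sigma>: "\<sigma> \<in> ?X t'"
      have "\<sigma> v \<in> set_rtree t'" if "v \<in> set_rtree t" for v
        using \<sigma> that by (auto simp: tree_isos_def map_rtree_restrict rtree.set_map)
      moreover have "\<sigma> v \<in> forest_set N'" if "v \<in> forest_set N" for v
      proof -
        obtain s where s: "s \<in># N" "v \<in> set_rtree s" using \<open>v \<in> forest_set N\<close> by (auto simp: forest_set_def)
        have "image_mset (map_rtree \<sigma>) N = N' - {#t'#}"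
          using \<sigma> by (simp add: forest_isos_def image_map_rtree_restrict)
        then have "map_rtree \<sigma> s \<in># N' - {#t'#}" using s by (metis image_eqI set_image_mset)
        moreover have "\<sigma> v \<in> set_rtree (map_rtree \<sigma> s)" using s by (simp add: rtree.set_map)
        ultimately show ?thesis by (auto simp: forest_set_def dest: in_diffD)
      qed
      ultimately show "\<sigma> \<in> PiE (set_rtree t \<union> forest_set N) (\<lambda>_. set_rtree t' \<union> forest_set N')"
        using \<sigma> by (intro PiE_I) (auto simp: extensional_def)
    qed
    then show "finite (?X t')" by (rule finite_subset) (auto intro!: finite_PiE)
  qed simp
  moreover have "card (?X t') = (if ?l t' = ?l t
      then autn (?l t) * ((\<Prod>t\<in>#N. autn (?l t)) * mfact (image_mset ?l N)) else 0)"
    if t': "t' \<in># N'" for t'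
  proof -
    have X: "card (?X t') = card (tree_isos \<alpha> t t') * card (forest_isos \<alpha> N (N' - {#t'#}))"
      by (rule card_extensional_glue) (use dis in \<open>auto simp: tree_isos_def forest_isos_def\<close>)
    show ?thesis
    proof (cases "?l t' = ?l t")
      case True
      obtain N1 where N1: "N' = add_mset t' N1" using t' by (metis multi_member_split)
      have "distinct_entries t'" "forest_distinct N1"
        using add.prems(3) by (auto simp: N1 forest_distinct_add)
      moreover have "image_mset ?l N = image_mset ?l N1" using add.prems(4) True by (simp add: N1)
      ultimately show ?thesis
        using X True add.IH[of N1] add.prems(1) dis by (simp add: N1)
    next
      case False
      then have "tree_isos \<alpha> t t' = {}" using tree_isos_label[of _ \<alpha> t t'] by blast
      then show ?thesis using X False by simp
    qed
  qed
  \<comment> \<open>The labelled branches of N' are pairwise different, so the number of those with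
    a given decoration is the multiplicity of that decoration.\<close>
  moreover have "card {t' \<in> set_mset N'. ?l t' = ?l t} = Suc (count (image_mset ?l N) (?l t))"
  proof -
    have "count (image_mset ?l N') (?l t) = card {t' \<in> set_mset N'. ?l t' = ?l t}"
      unfolding count_image_mset using forest_distinct_count[OF add.prems(3)]
      by (simp add: vimage_def Int_def conj_commute)
    then show ?thesis unfolding add.prems(4)[symmetric] by simp
  qed
  ultimately show ?case by (simp add: sum.If_cases Int_def algebra_simps)
qed

lemma card_tree_isos:
  assumes "distinct_entries L" "distinct_entries L'" "map_rtree \<alpha> L = map_rtree \<alpha> L'"
  shows "card (tree_isos \<alpha> L L') = autn (map_rtree \<alpha> L)"
  using assms
proof (induction L arbitrary: L')
  case (Node v N)
  obtain v' N' where L': "L' = Node v' N'" by (cases L')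
  let ?X = "{\<sigma> \<in> extensional {v}. \<sigma> v = v'}"
  have dis: "v \<notin> forest_set N" "forest_distinct N" "forest_distinct N'"
    using Node.prems by (auto simp: L' distinct_Node)
  have lab: "\<alpha> v' = \<alpha> v" "image_mset (map_rtree \<alpha>) N = image_mset (map_rtree \<alpha>) N'"
    using Node.prems by (auto simp: L')
  have "tree_isos \<alpha> (Node v N) L' = {\<sigma> \<in> extensional ({v} \<union> forest_set N).
      restrict \<sigma> {v} \<in> ?X \<and> restrict \<sigma> (forest_set N) \<in> forest_isos \<alpha> N N'}"
    unfolding tree_isos_def forest_isos_def set_rtree_Node L'
    using lab by (auto simp: image_map_rtree_restrict)
  then have "card (tree_isos \<alpha> (Node v N) L') = card ?X * card (forest_isos \<alpha> N N')"
    using card_extensional_glue[of "{v}" "forest_set N" ?X "forest_isos \<alpha> N N'"] dis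
    by (auto simp: forest_isos_def)
  moreover have "?X = {restrict (\<lambda>_. v') {v}}" by (auto simp: fun_eq_iff extensional_def)
  moreover have "card (forest_isos \<alpha> N N') =
      (\<Prod>t\<in>#N. autn (map_rtree \<alpha> t)) * mfact (image_mset (map_rtree \<alpha>) N)"
    by (rule card_forest_isos) (use Node.IH dis lab in auto)
  ultimately show ?case by (simp add: multiset.map_comp comp_def)
qed

text \<open>The two encodings differ only outside the vertex set: identity there versus
  \<open>undefined\<close>. A map that preserves the tree is onto its finite vertex set, hence a
  permutation.\<close>

lemma card_tree_auts: "card (tree_auts L \<alpha>) = card (tree_isos \<alpha> L L)"
proof (rule bij_betw_same_card[of "\<lambda>\<sigma>. restrict \<sigma> (set_rtree L)"])
  show "bij_betw (\<lambda>\<sigma>. restrict \<sigma> (set_rtree L)) (tree_auts L \<alpha>) (tree_isos \<alpha> L L)"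
  proof (rule bij_betwI[where g = "\<lambda>\<sigma> x. if x \<in> set_rtree L then \<sigma> x else x"])
    show "(\<lambda>\<sigma> x. if x \<in> set_rtree L then \<sigma> x else x) \<in> tree_isos \<alpha> L L \<rightarrow> tree_auts L \<alpha>"
    proof
      fix \<sigma> assume \<sigma>: "\<sigma> \<in> tree_isos \<alpha> L L"
      let ?f = "\<lambda>x. if x \<in> set_rtree L then \<sigma> x else x"
      have map: "map_rtree ?f L = L"
        using \<sigma> rtree.map_cong[of L L ?f \<sigma>] by (auto simp: tree_isos_def)
      then have img: "?f ` set_rtree L = set_rtree L" by (metis rtree.set_map)
      then have "bij_betw ?f (set_rtree L) (set_rtree L)"
        unfolding bij_betw_def using finite_surj_inj[of "set_rtree L" ?f] by simp
      then have "?f permutes set_rtree L" by (rule bij_imp_permutes) auto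
      then show "?f \<in> tree_auts L \<alpha>" using \<sigma> map by (auto simp: tree_auts_def tree_isos_def)
    qed
  qed (auto simp: tree_auts_def tree_isos_def map_rtree_restrict fun_eq_iff extensional_def
      permutes_not_in)
qed

text \<open>Labels are pairs of a number and the decoration. The free lower bound n on the numbers
  is what keeps the branches disjoint in the induction.\<close>

lemma labelled_tree_exists:
  "\<exists>L. distinct_entries L \<and> map_rtree snd L = T \<and> (\<forall>v\<in>set_rtree L. (n::nat) \<le> fst v)"
proof (induction T arbitrary: n)
  case (Node a M)
  have "\<exists>N. forest_distinct N \<and> image_mset (map_rtree snd) N = M \<and> (\<forall>v\<in>forest_set N. n \<le> fst v)" for n :: nat
    using Node.IH
  proof (induction M)
    case empty
    show ?case by (rule exI[of _ "{#}"]) (simp add: forest_distinct_def)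
  next
    case (add t M)
    then obtain N where N: "forest_distinct N" "image_mset (map_rtree snd) N = M" "\<forall>v\<in>forest_set N. n \<le> fst v"
      by auto
    \<comment> \<open>Beyond all numbers used in N, so the new branch shares no label with
      it.\<close>
    define m where "m = Suc (Max (insert n (fst ` forest_set N)))"
    have m: "n \<le> m" "\<And>v. v \<in> forest_set N \<Longrightarrow> fst v < m"
      unfolding m_def less_Suc_eq_le by (auto simp: Max_ge_iff intro: le_SucI)
    obtain L where L: "distinct_entries L" "map_rtree snd L = t" "\<forall>v\<in>set_rtree L. m \<le> fst v"
      using add.prems[of t m] by auto
    then have "forest_distinct (add_mset L N)" using N(1) m(2) by (fastforce simp: forest_distinct_add)
    then show ?case using N L m(1) by (intro exI[of _ "add_mset L N"]) auto
  qed
  then obtain N where N: "forest_distinct N" "image_mset (map_rtree snd) N = M"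
      "\<forall>v\<in>forest_set N. Suc n \<le> fst v"
    by blast
  then have "(n, a) \<notin> forest_set N" by fastforce
  moreover have "n \<le> fst v" if "v \<in> forest_set N" for v using N(3) that Suc_leD by blast
  ultimately show ?case
    using N by (intro exI[of _ "Node (n, a) N"]) (auto simp: distinct_Node set_rtree_Node simp del: rtree.set)
qed

lemma labelled_nat_tree_exists:
  "\<exists>(L :: nat rtree) \<alpha>. distinct_entries L \<and> map_rtree \<alpha> L = T"
proof -
  obtain L :: "(nat \<times> 'a) rtree" where L: "distinct_entries L" "map_rtree snd L = T"
    using labelled_tree_exists[of T 0] by blast
  obtain f :: "nat \<times> 'a \<Rightarrow> nat" where f: "inj_on f (set_rtree L)"
    using finite_imp_inj_to_nat_seg[OF finite_set_rtree[of L]] by blast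
  have "entries L = mset_set (set_rtree L)"
  proof (rule multiset_eqI)
    fix v
    have "count (entries L) v \<le> 1" using L(1) unfolding distinct_entries_def by blast
    moreover have "count (entries L) v = 0 \<longleftrightarrow> v \<notin> set_rtree L"
      by (simp only: set_entries[symmetric] count_eq_zero_iff)
    ultimately show "count (entries L) v = count (mset_set (set_rtree L)) v"
      by (auto simp: count_mset_set')
  qed
  then have "entries (map_rtree f L) = mset_set (f ` set_rtree L)"
    by (simp add: entries_map image_mset_mset_set[OF f])
  then have "distinct_entries (map_rtree f L)" by (auto simp: distinct_entries_def count_mset_set')
  moreover have "map_rtree (snd \<circ> inv_into (set_rtree L) f) (map_rtree f L) = T"
    unfolding rtree.map_comp L(2)[symmetric] by (rule rtree.map_cong) (use f in auto)
  ultimately show ?thesis by blast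
qed

text \<open>This justifies the definite description: a labelling by natural numbers exists, and
  every such labelling yields the same count.\<close>

lemma aut_order_eq: "aut_order T = autn T"
  unfolding aut_order_def
proof (rule the_equality)
  show "\<exists>(L :: nat rtree) \<alpha>. distinct_entries L \<and> map_rtree \<alpha> L = T \<and> autn T = card (tree_auts L \<alpha>)"
    using labelled_nat_tree_exists[of T] card_tree_isos card_tree_auts by metis
  show "\<exists>(L :: nat rtree) \<alpha>. distinct_entries L \<and> map_rtree \<alpha> L = T \<and> m = card (tree_auts L \<alpha>)
      \<Longrightarrow> m = autn T" for m
    using card_tree_isos card_tree_auts by metis
qed

text \<open>The scalar factor of W_T, separated from the root vector, so that pairing W_T with
  \<alpha> just multiplies it by \<open>pr \<alpha> (rroot T)\<close>.\<close>

definition tree_weight ::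
  "('n::finite lat \<Rightarrow> 'n lat \<Rightarrow> int) \<Rightarrow> ('n lat \<Rightarrow> rat) \<Rightarrow> 'n lat rtree \<Rightarrow> rat" where
  "tree_weight pr Om T = DT Om (rroot T) / of_nat (aut_order T) *
     (\<Prod>(a, b)\<in>#edges T. DT Om a * of_int (pr a b))"

lemma treeW_eq: "treeW pr Om T $ i = of_int (rroot T $ i) * tree_weight pr Om T"
  by (simp add: treeW_def tree_weight_def)

lemma prod_mset_of_nat: "of_nat (\<Prod>x\<in>#M. f x) = (\<Prod>x\<in>#M. of_nat (f x) :: 'a::comm_semiring_1)"
  by (induction M) auto

lemma prod_mset_divide: "(\<Prod>x\<in>#M. f x / g x) = (\<Prod>x\<in>#M. f x) / (\<Prod>x\<in>#M. g x :: 'a::field)"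
  by (induction M) auto

lemma prod_mset_edges:
  "(\<Prod>e\<in>#edges (Node a M). f e) = (\<Prod>t\<in>#M. f (rroot t, a) * (\<Prod>e\<in>#edges t. f e))"
proof -
  have "(\<Prod>e\<in>#(\<Sum>t\<in>#M. edges t). f e) = (\<Prod>t\<in>#M. \<Prod>e\<in>#edges t. f e)"
    by (induction M) auto
  then show ?thesis by (simp add: multiset.map_comp comp_def prod_mset.distrib)
qed

text \<open>The denominator \<open>mfact M\<close> is the one occurring in
  \<open>hexp_sum_msets\<close>; because of it the trees with a fixed root sum up to an
  exponential.\<close>

lemma tree_weight_Node:
  "tree_weight pr Om (Node a M) =
     DT Om a * (\<Prod>T\<in>#M. tree_weight pr Om T * of_int (pr (rroot T) a)) / of_nat (mfact M)"
proof -
  have "(\<Prod>T\<in>#M. tree_weight pr Om T * of_int (pr (rroot T) a)) =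
      (\<Prod>T\<in>#M. (DT Om (rroot T) * of_int (pr (rroot T) a) *
         (\<Prod>(a, b)\<in>#edges T. DT Om a * of_int (pr a b))) / of_nat (autn T))"
    by (simp add: tree_weight_def aut_order_eq mult_ac)
  also have "\<dots> = (\<Prod>T\<in>#M. DT Om (rroot T) * of_int (pr (rroot T) a) *
         (\<Prod>(a, b)\<in>#edges T. DT Om a * of_int (pr a b))) / (\<Prod>T\<in>#M. of_nat (autn T))"
    by (rule prod_mset_divide)
  finally have *: "(\<Prod>T\<in>#M. tree_weight pr Om T * of_int (pr (rroot T) a)) =
      (\<Prod>(a, b)\<in>#edges (Node a M). DT Om a * of_int (pr a b)) / (\<Prod>T\<in>#M. of_nat (autn T))"
    by (simp only: prod_mset_edges prod.case)
  show ?thesis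
    unfolding * by (simp add: tree_weight_def aut_order_eq prod_mset_of_nat del: edges.simps)
qed


section \<open>Cauchy integrals over rays\<close>

text \<open>Dominated convergence for a complex parameter. The exceptional point c, a null set, is
  where the limiting kernel may be singular.\<close>

lemma tendsto_integral_within:
  fixes s :: "complex \<Rightarrow> real \<Rightarrow> complex"
  assumes s: "\<And>z. z \<in> S \<Longrightarrow> z \<noteq> z0 \<Longrightarrow> s z \<in> borel_measurable lborel"
    and f: "f \<in> borel_measurable lborel" and w: "integrable lborel (w :: real \<Rightarrow> real)"
    and lim: "\<And>t. t \<noteq> c \<Longrightarrow> ((\<lambda>z. s z t) \<longlongrightarrow> f t) (at z0 within S)"
    and bound: "\<And>z t. z \<in> S \<Longrightarrow> z \<noteq> z0 \<Longrightarrow> norm (s z t) \<le> w t"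
  shows "((\<lambda>z. \<integral>t. s z t \<partial>lborel) \<longlongrightarrow> (\<integral>t. f t \<partial>lborel)) (at z0 within S)"
  unfolding tendsto_at_iff_sequentially comp_def
proof (intro allI impI)
  fix X assume X: "\<forall>i. X i \<in> S - {z0}" "X \<longlonglongrightarrow> z0"
  show "(\<lambda>i. \<integral>t. s (X i) t \<partial>lborel) \<longlonglongrightarrow> (\<integral>t. f t \<partial>lborel)"
  proof (rule integral_dominated_convergence[where w = w])
    have "(\<lambda>i. s (X i) t) \<longlonglongrightarrow> f t" if "t \<noteq> c" for t
      using lim[OF that] X unfolding tendsto_at_iff_sequentially comp_def by blast
    then show "AE t in lborel. (\<lambda>i. s (X i) t) \<longlonglongrightarrow> f t"
      by (intro AE_I'[of "{c}"]) auto
  qed (use X s f w bound in auto)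
qed

lemma integral_lincomb4:
  fixes f1 f2 f3 f4 :: "real \<Rightarrow> complex"
  assumes "integrable lborel f1" "integrable lborel f2" "integrable lborel f3" "integrable lborel f4"
  shows "(\<integral>t. (f1 t + 2 * f2 t - f3 t) + c * f4 t \<partial>lborel) =
    (\<integral>t. f1 t \<partial>lborel) + 2 * (\<integral>t. f2 t \<partial>lborel) - (\<integral>t. f3 t \<partial>lborel) + c * (\<integral>t. f4 t \<partial>lborel)"
  using assms by simp

section \<open>The normalised kernel on the positive half-line\<close>

definition ray_kernel :: "complex \<Rightarrow> real \<Rightarrow> complex" where
  "ray_kernel v t = (of_real t + v) / (of_real t - v)"

text \<open>With z = v w and z' = t w the quotient (z' + z) / (z' - z) depends on v and t only, so
  every ray is reduced to the positive half-line.\<close>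

definition ray_transform :: "(real \<Rightarrow> complex) \<Rightarrow> complex \<Rightarrow> complex" where
  "ray_transform g v = (\<integral>t. g t * ray_kernel v t \<partial>lborel)"

text \<open>Separation from the half-line relative to the size of v. Being uniform on sectors, it
  serves both along whole rays and for v tending to 0.\<close>

definition ray_sep :: "real \<Rightarrow> complex \<Rightarrow> bool" where
  "ray_sep m v \<longleftrightarrow> v \<noteq> 0 \<and> (\<forall>t>0. m * norm v \<le> norm (of_real t - v))"

lemma ray_kernel_measurable [measurable]: "ray_kernel v \<in> borel_measurable borel"
  unfolding ray_kernel_def by measurable

lemma ray_sep_pos: "ray_sep m v \<Longrightarrow> m > 0 \<Longrightarrow> t > 0 \<Longrightarrow> norm (of_real t - v) > 0"
  unfolding ray_sep_def by (metis less_le_trans mult_pos_pos zero_less_norm_iff)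

lemma ray_kernel_bound:
  assumes "ray_sep m v" "m > 0" "t > 0"
  shows "norm (ray_kernel v t) \<le> 1 + 2 / m" "norm (of_real t / (of_real t - v)) \<le> 1 + 1 / m"
proof -
  have pos: "norm (of_real t - v) > 0" using ray_sep_pos assms by blast
  have *: "norm (v / (of_real t - v)) \<le> 1 / m"
    using assms pos by (simp add: ray_sep_def norm_divide field_simps)
  have nz: "of_real t - v \<noteq> 0" using pos by simp
  \<comment> \<open>Splitting off 1 leaves v / (t - v), which \<open>ray_sep\<close> bounds
    directly.\<close>
  have e: "ray_kernel v t = 1 + 2 * (v / (of_real t - v))"
    "of_real t / (of_real t - v) = 1 + v / (of_real t - v)"
    using nz by (simp_all add: ray_kernel_def field_simps)
  have "norm (2 * (v / (of_real t - v))) \<le> 2 / m" using * by (simp only: norm_mult) simp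
  then show "norm (ray_kernel v t) \<le> 1 + 2 / m"
    unfolding e using norm_triangle_ineq[of 1 "2 * (v / (of_real t - v))"] by (simp only: norm_one)
  show "norm (of_real t / (of_real t - v)) \<le> 1 + 1 / m"
    unfolding e using norm_triangle_ineq[of 1 "v / (of_real t - v)"] * by (simp only: norm_one)
qed

lemma ray_sep_near:
  assumes "u \<notin> nonneg_Reals" "norm u = 1"
  obtains m where "m > 0" "\<And>v. v \<noteq> 0 \<Longrightarrow> dist (sgn v) u < m \<Longrightarrow> ray_sep m v"
proof -
  \<comment> \<open>Half the distance of u from the half-line; the other half absorbs the deviation
    of \<open>sgn v\<close> from u.\<close>
  define m where "m = infdist u nonneg_Reals / 2"
  have "infdist u nonneg_Reals > 0"
  proof (rule infdist_pos_not_in_closed)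
    show "closed (nonneg_Reals :: complex set)" by simp
    show "(nonneg_Reals :: complex set) \<noteq> {}" using nonneg_Reals_zero_I by blast
  qed fact
  then have "m > 0" by (simp add: m_def)
  moreover have "ray_sep m v" if "v \<noteq> 0" "dist (sgn v) u < m" for v
    unfolding ray_sep_def
  proof (intro conjI allI impI)
    fix t :: real assume t: "t > 0"
    have "2 * m \<le> dist u (of_real (t / norm v))"
      using infdist_le[of "of_real (t / norm v)" "nonneg_Reals" u] t that(1) by (simp add: m_def)
    also have "\<dots> \<le> dist (sgn v) u + dist (sgn v) (of_real (t / norm v))"
      by (metis dist_commute dist_triangle)
    finally have "m \<le> dist (sgn v) (of_real (t / norm v))" using that(2) by simp
    then have "m * norm v \<le> norm (sgn v - of_real (t / norm v)) * norm v"
      by (intro mult_right_mono) (auto simp: dist_norm)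
    also have "\<dots> = norm ((sgn v - of_real (t / norm v)) * of_real (norm v))"
      by (simp add: norm_mult)
    also have "(sgn v - of_real (t / norm v)) * of_real (norm v) = v - of_real t"
      using that(1) by (simp add: sgn_eq field_simps)
    finally show "m * norm v \<le> norm (of_real t - v)" by (simp add: norm_minus_commute)
  qed (use that in auto)
  ultimately show thesis using that by blast
qed

lemma sgn_not_nonneg_Real:
  assumes "v \<notin> nonneg_Reals" shows "sgn (v :: complex) \<notin> nonneg_Reals"
proof
  assume "sgn v \<in> nonneg_Reals"
  then have "sgn v * of_real (norm v) \<in> nonneg_Reals" by (intro nonneg_Reals_mult_I) auto
  then show False using assms by (simp add: sgn_eq split: if_splits)
qed

lemma ray_sep_exists:
  assumes "v \<notin> nonneg_Reals" obtains m where "m > 0" "ray_sep m v"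
proof -
  have "v \<noteq> 0" using assms by auto
  then show thesis
    using ray_sep_near[OF sgn_not_nonneg_Real[OF assms]] that by (metis dist_self norm_sgn)
qed

context
  fixes g :: "real \<Rightarrow> complex"
  assumes g: "integrable lborel g" and g0: "\<And>t. t \<le> 0 \<Longrightarrow> g t = 0"
begin

lemma g_measurable [measurable]: "g \<in> borel_measurable borel"
  using borel_measurable_integrable[OF g] by simp

lemma ray_transform_bound_pointwise:
  assumes "ray_sep m v" "m > 0"
  shows "norm (g t * ray_kernel v t) \<le> (1 + 2 / m) * norm (g t)"
proof (cases "t > 0")
  case True
  then show ?thesis using ray_kernel_bound(1)[OF assms True]
    by (simp add: norm_mult mult.commute[of "norm (g t)"] mult_right_mono)
qed (simp add: g0)

lemma ray_transform_integrable:
  assumes "ray_sep m v" "m > 0"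
  shows "integrable lborel (\<lambda>t. g t * ray_kernel v t)"
proof (rule Bochner_Integration.integrable_bound)
  show "integrable lborel (\<lambda>t. (1 + 2 / m) * norm (g t))" using g by auto
  show "AE t in lborel. norm (g t * ray_kernel v t) \<le> norm ((1 + 2 / m) * norm (g t))"
    using ray_transform_bound_pointwise[OF assms] assms(2) by (intro AE_I2) (simp add: abs_mult)
qed simp

lemma ray_transform_bound:
  assumes "ray_sep m v" "m > 0"
  shows "norm (ray_transform g v) \<le> (1 + 2 / m) * (\<integral>t. norm (g t) \<partial>lborel)"
proof -
  have "norm (ray_transform g v) \<le> (\<integral>t. norm (g t * ray_kernel v t) \<partial>lborel)"
    unfolding ray_transform_def by (rule integral_norm_bound)
  also have "\<dots> \<le> (\<integral>t. (1 + 2 / m) * norm (g t) \<partial>lborel)"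
    by (rule integral_mono)
      (use g ray_transform_integrable[OF assms] ray_transform_bound_pointwise[OF assms] in auto)
  finally show ?thesis by simp
qed

text \<open>Differentiation under the integral sign: the difference quotient is again an integral,
  dominated on a sector around v0.\<close>

lemma ray_transform_differentiable:
  assumes "v0 \<notin> nonneg_Reals"
  shows "ray_transform g field_differentiable at v0"
proof -
  have nz: "v0 \<noteq> 0" using assms by auto
  have "sgn v0 \<notin> nonneg_Reals" by (rule sgn_not_nonneg_Real) fact
  then obtain m where m: "m > 0" "\<And>v. v \<noteq> 0 \<Longrightarrow> dist (sgn v) (sgn v0) < m \<Longrightarrow> ray_sep m v"
    using ray_sep_near[of "sgn v0"] nz by (auto simp: norm_sgn)
  define S where "S = {v. v \<noteq> 0 \<and> dist (sgn v) (sgn v0) < m}"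
  have "eventually (\<lambda>v. v \<in> S) (nhds v0)"
  proof -
    have "((\<lambda>v. sgn v) \<longlongrightarrow> sgn v0) (nhds v0)"
      using nz by (intro tendsto_sgn) (auto simp: filterlim_ident)
    then have "eventually (\<lambda>v. dist (sgn v) (sgn v0) < m) (nhds v0)" using m(1) tendstoD by blast
    moreover have "eventually (\<lambda>v. v \<noteq> 0) (nhds v0)" using nz by (rule t1_space_nhds)
    ultimately show ?thesis unfolding S_def by eventually_elim simp
  qed
  then have int: "v0 \<in> interior S" unfolding eventually_nhds interior_def by blast
  then have S: "v0 \<in> S" using interior_subset by blast
  \<comment> \<open>The difference quotient in v of (t + v) / (t - v), weighted by g; for v = v0 it
    is the derivative.\<close>
  define q where "q v t = g t * (2 * of_real t / ((of_real t - v) * (of_real t - v0)))" for v t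
  have sep: "ray_sep m v" if "v \<in> S" for v using that m(2) by (auto simp: S_def)
  have diff: "(ray_transform g v - ray_transform g v0) / (v - v0) = (\<integral>t. q v t \<partial>lborel)"
    if v: "v \<in> S" "v \<noteq> v0" for v
  proof -
    have "ray_transform g v - ray_transform g v0 =
        (\<integral>t. g t * ray_kernel v t - g t * ray_kernel v0 t \<partial>lborel)"
      unfolding ray_transform_def using ray_transform_integrable m(1) sep[OF S] sep[OF v(1)]
      by (subst Bochner_Integration.integral_diff) auto
    also have "\<dots> = (\<integral>t. q v t * (v - v0) \<partial>lborel)"
    proof (rule Bochner_Integration.integral_cong)
      fix t :: real
      show "g t * ray_kernel v t - g t * ray_kernel v0 t = q v t * (v - v0)"
      proof (cases "t > 0")
        case True
        then have "of_real t - v \<noteq> 0" "of_real t - v0 \<noteq> 0"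
          using ray_sep_pos m(1) sep[OF S] sep[OF v(1)] by fastforce+
        then have "ray_kernel v t - ray_kernel v0 t =
            2 * of_real t / ((of_real t - v) * (of_real t - v0)) * (v - v0)"
          unfolding ray_kernel_def by (simp add: divide_simps) (simp add: algebra_simps)
        then show ?thesis by (simp add: q_def right_diff_distrib[symmetric])
      qed (simp add: g0 q_def)
    qed simp
    finally show ?thesis using v(2) by (simp add: integral_mult_left_zero)
  qed
  have "((\<lambda>v. \<integral>t. q v t \<partial>lborel) \<longlongrightarrow> (\<integral>t. q v0 t \<partial>lborel)) (at v0 within S)"
  proof (rule tendsto_integral_within[where c = 0])
    show "q v \<in> borel_measurable lborel" for v unfolding q_def by measurable
    then show "q v0 \<in> borel_measurable lborel" .
    show "integrable lborel (\<lambda>t. norm (g t) * (2 * (1 + 1 / m) / (m * norm v0)))"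
      using g by auto
    fix t :: real
    show "((\<lambda>v. q v t) \<longlongrightarrow> q v0 t) (at v0 within S)"
    proof (cases "t > 0")
      case True
      then have "of_real t - v0 \<noteq> 0" using ray_sep_pos m(1) sep[OF S] by fastforce
      then show ?thesis unfolding q_def by (auto intro!: tendsto_intros)
    qed (simp add: q_def g0)
    fix v assume v: "v \<in> S"
    show "norm (q v t) \<le> norm (g t) * (2 * (1 + 1 / m) / (m * norm v0))"
    proof (cases "t > 0")
      case True
      have "norm (of_real t / (of_real t - v)) \<le> 1 + 1 / m" using ray_kernel_bound(2) sep v m(1) True by blast
      moreover have "1 / norm (of_real t - v0) \<le> 1 / (m * norm v0)"
        using sep[OF S] True nz m(1) by (intro divide_left_mono) (auto simp: ray_sep_def intro!: mult_pos_pos ray_sep_pos[OF sep[OF S]])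
      ultimately have "norm (of_real t / (of_real t - v)) * (1 / norm (of_real t - v0)) \<le> (1 + 1 / m) * (1 / (m * norm v0))"
        using m(1) by (intro mult_mono) auto
      then have "norm (g t) * (2 * (norm (of_real t / (of_real t - v)) * (1 / norm (of_real t - v0))))
        \<le> norm (g t) * (2 * ((1 + 1 / m) * (1 / (m * norm v0))))"
        by (intro mult_left_mono) auto
      then show ?thesis by (simp add: q_def norm_mult norm_divide)
    qed (simp add: q_def g0)
  qed
  then have "((\<lambda>v. \<integral>t. q v t \<partial>lborel) \<longlongrightarrow> (\<integral>t. q v0 t \<partial>lborel)) (at v0)"
    using at_within_interior[OF int] by simp
  moreover have "eventually (\<lambda>v. (ray_transform g v - ray_transform g v0) / (v - v0) = (\<integral>t. q v t \<partial>lborel)) (at v0)"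
    unfolding eventually_at_topological using int diff interior_subset open_interior by blast
  ultimately have "((\<lambda>v. (ray_transform g v - ray_transform g v0) / (v - v0)) \<longlongrightarrow> (\<integral>t. q v0 t \<partial>lborel)) (at v0)"
    using tendsto_cong by fast
  then show ?thesis unfolding field_differentiable_def has_field_derivative_iff by blast
qed

text \<open>On a set separated from the half-line the kernel stays bounded, and it tends to 1 for
  every t \<noteq> 0.\<close>

lemma ray_transform_at_0:
  assumes "m > 0" "\<And>v. v \<in> S \<Longrightarrow> ray_sep m v"
  shows "(ray_transform g \<longlongrightarrow> (\<integral>t. g t \<partial>lborel)) (at 0 within S)"
  unfolding ray_transform_def
proof (rule tendsto_integral_within[where c = 0 and w = "\<lambda>t. (1 + 2 / m) * norm (g t)"])
  show "((\<lambda>v. g t * ray_kernel v t) \<longlongrightarrow> g t) (at 0 within S)" if "t \<noteq> 0" for t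
  proof -
    have "((\<lambda>v. g t * ray_kernel v t) \<longlongrightarrow> g t * ((of_real t + 0) / (of_real t - 0))) (at 0 within S)"
      unfolding ray_kernel_def using that by (intro tendsto_intros) auto
    then show ?thesis using that by simp
  qed
qed (use assms g ray_transform_bound_pointwise in auto)

text \<open>Boundary values without principal values. Near t0 the singular part of the integrand is
  2 F(t) / (t - v) with F(t) = t g(t). Subtracting a value of F leaves a bounded quotient, and the
  remaining integral of 1 / (t - v) is a difference of logarithms. Only its limit c1 depends on the
  side of approach.\<close>

lemma ray_transform_limit:
  fixes t0 :: real and c1 :: complex
  defines "a \<equiv> t0 / 2" and "b \<equiv> 2 * t0"
  assumes t0: "t0 > 0" and S: "\<And>v. v \<in> S \<Longrightarrow> Im v \<noteq> 0 \<and> dist v (of_real t0) < t0 / 4"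
    and lip: "\<And>s t. s \<in> {a..b} \<Longrightarrow> t \<in> {a..b} \<Longrightarrow>
      norm (of_real s * g s - of_real t * g t) \<le> L * \<bar>s - t\<bar>"
    and c: "((\<lambda>v. Ln (of_real b - v) - Ln (of_real a - v)) \<longlongrightarrow> c1) (at (of_real t0) within S)"
  shows "(ray_transform g \<longlongrightarrow>
     (\<integral>t. indicator (- {a..b}) t *\<^sub>R g t * ray_kernel (of_real t0) t \<partial>lborel)
     + 2 * (\<integral>t. indicator {a..b} t *\<^sub>R ((of_real t * g t - of_real t0 * g t0) / (of_real t - of_real t0)) \<partial>lborel)
     - (\<integral>t. indicator {a..b} t *\<^sub>R g t \<partial>lborel) + 2 * (of_real t0 * g t0) * c1) (at (of_real t0) within S)"
proof -
  let ?at = "at (of_real t0 :: complex) within S"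
  define F where "F t = of_real t * g t" for t
  have ab: "0 < a" "a < t0" "t0 < b" "a \<le> b" using t0 by (auto simp: a_def b_def)
  have SD: "\<bar>Re v - t0\<bar> < t0 / 4" "Im v \<noteq> 0" "norm (v - of_real t0) < t0 / 4" "Re v \<in> {a..b}" if "v \<in> S" for v
  proof -
    have n: "norm (v - of_real t0) < t0 / 4" using S that by (simp add: dist_norm)
    then show "norm (v - of_real t0) < t0 / 4" .
    have "\<bar>Re v - t0\<bar> \<le> norm (v - of_real t0)" using abs_Re_le_cmod[of "v - of_real t0"] by simp
    then show "\<bar>Re v - t0\<bar> < t0 / 4" using n by linarith
    then have "t0 - t0 / 4 < Re v" "Re v < t0 + t0 / 4" by linarith+
    then show "Re v \<in> {a..b}" using t0 unfolding a_def b_def atLeastAtMost_iff by linarith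
    show "Im v \<noteq> 0" using S that by blast
  qed
  have nz: "of_real t - v \<noteq> 0" if "v \<in> S" for v and t :: real
    using SD(2)[OF that] by (auto simp: complex_eq_iff)
  have L0: "L \<ge> 0" using lip[of a b] ab norm_ge_zero order_trans
    by (smt (verit) atLeastAtMost_iff zero_le_mult_iff)
  have F_meas [measurable]: "F \<in> borel_measurable borel" unfolding F_def by measurable
  let ?outer = "\<lambda>v t. indicator (- {a..b}) t *\<^sub>R g t * ray_kernel v t"
  \<comment> \<open>The value of F is subtracted at Re v, not at t0: since |t - Re v| \<le> |t - v|,
    the Lipschitz bound then controls the quotient uniformly in v.\<close>
  let ?quot = "\<lambda>v t. indicator {a..b} t *\<^sub>R ((F t - F (Re v)) / (of_real t - v))"
  let ?inv = "\<lambda>v t. indicator {a..b} t *\<^sub>R (1 / (of_real t - v))"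
  let ?inner = "\<lambda>t. indicator {a..b} t *\<^sub>R g t"
  \<comment> \<open>11 = 1 + 2 * 5: off [a, b] the distance from t to v exceeds t0 / 4, while |v|
    \<le> 5 t0 / 4.\<close>
  have outer_bound: "norm (?outer v t) \<le> 11 * norm (g t)" if "norm (v - of_real t0) < t0 / 4" for v t
  proof (cases "t \<in> {a..b} \<or> t \<le> 0")
    case False
    then have t: "t > 0" "t < a \<or> t > b" by auto
    have "t0 / 2 \<le> \<bar>t - t0\<bar>" using t(2) t0 by (auto simp: a_def b_def)
    also have "\<bar>t - t0\<bar> = norm (of_real t - of_real t0 :: complex)" by (metis norm_of_real of_real_diff)
    also have "\<dots> \<le> norm (of_real t - v) + norm (v - of_real t0)" by (metis dist_norm dist_triangle)
    finally have d: "t0 / 4 < norm (of_real t - v)" using that by linarith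
    have "norm v \<le> norm (v - of_real t0) + norm (of_real t0 :: complex)" using norm_triangle_sub[of v "of_real t0"] by simp
    then have z: "norm v \<le> 5 * (t0 / 4)" using that t0 by simp
    have "norm (v / (of_real t - v)) \<le> 5"
      using d z t0 by (simp add: norm_divide divide_le_eq)
    moreover have "ray_kernel v t = 1 + 2 * (v / (of_real t - v))"
    proof -
      have "of_real t - v \<noteq> 0" using d t0 by force
      then show ?thesis by (simp add: ray_kernel_def field_simps)
    qed
    moreover have "norm (2 * (v / (of_real t - v))) \<le> 10"
      using calculation(1) by (simp only: norm_mult) simp
    ultimately have "norm (ray_kernel v t) \<le> 11"
      using norm_triangle_ineq[of 1 "2 * (v / (of_real t - v))"] by (simp only: norm_one)
    then have "norm (g t) * norm (ray_kernel v t) \<le> norm (g t) * 11" by (intro mult_left_mono) auto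
    then show ?thesis using False by (simp add: norm_mult mult.commute)
  qed (auto simp: g0)
  have outer_int: "integrable lborel (?outer v)" if "norm (v - of_real t0) < t0 / 4" for v
    by (rule Bochner_Integration.integrable_bound[of _ "\<lambda>t. 11 * norm (g t)"])
      (use g outer_bound[OF that] in auto)
  have quot_bound: "norm (?quot v t) \<le> indicator {a..b} t * L" if "v \<in> S" for v t
  proof (cases "t \<in> {a..b}")
    case True
    have "norm (F t - F (Re v)) \<le> L * \<bar>t - Re v\<bar>" unfolding F_def using lip True SD(4)[OF that] by blast
    also have "\<bar>t - Re v\<bar> \<le> norm (of_real t - v)" using abs_Re_le_cmod[of "of_real t - v"] by simp
    finally have "norm (F t - F (Re v)) \<le> L * norm (of_real t - v)" using L0 by (simp add: mult_left_mono)
    then show ?thesis using True nz[OF that, of t] by (simp add: norm_divide divide_le_eq)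
  qed simp
  have ind_int: "integrable lborel (\<lambda>t. indicator {a..b} t * L)" using ab by (intro integrable_mult_left integrable_real_indicator) auto
  have quot_int: "integrable lborel (?quot v)" if "v \<in> S" for v
    by (rule Bochner_Integration.integrable_bound[OF ind_int])
      (use quot_bound[OF that] L0 in \<open>auto intro!: AE_I2 order_trans[OF quot_bound[OF that]]\<close>)
  have inv_int: "integrable lborel (?inv v)" if "v \<in> S" for v
    by (rule borel_integrable_atLeastAtMost'[unfolded set_integrable_def])
      (use nz[OF that] in \<open>auto intro!: continuous_intros\<close>)
  have inv_eq: "(\<integral>t. ?inv v t \<partial>lborel) = Ln (of_real b - v) - Ln (of_real a - v)" if "v \<in> S" for v
  proof (rule integral_FTC_Icc)
    show "continuous_on {a..b} (\<lambda>t. 1 / (of_real t - v))" using nz[OF that] by (auto intro!: continuous_intros)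
    fix t assume "a \<le> t" "t \<le> b"
    have "of_real t - v \<notin> \<real>\<^sub>\<le>\<^sub>0" using SD(2)[OF that] by (auto simp: complex_nonpos_Reals_iff)
    then have "((\<lambda>w. Ln (w - v)) has_field_derivative 1 / (of_real t - v)) (at (of_real t))"
      by (auto intro!: derivative_eq_intros simp: field_simps)
    then show "((\<lambda>t. Ln (of_real t - v)) has_vector_derivative 1 / (of_real t - v)) (at t within {a..b})"
      by (rule has_vector_derivative_real_field)
  qed (use ab in auto)
  have inner_int: "integrable lborel ?inner" using g by (intro integrable_mult_indicator) auto
  have decomp: "ray_transform g v = (\<integral>t. ?outer v t \<partial>lborel) + 2 * (\<integral>t. ?quot v t \<partial>lborel)
      - (\<integral>t. ?inner t \<partial>lborel) + 2 * F (Re v) * (Ln (of_real b - v) - Ln (of_real a - v))"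
    if v: "v \<in> S" for v
  proof -
    have "ray_transform g v =
        (\<integral>t. (?outer v t + 2 * ?quot v t - ?inner t) + 2 * F (Re v) * ?inv v t \<partial>lborel)"
      unfolding ray_transform_def
    proof (rule Bochner_Integration.integral_cong)
      fix t :: real
      show "g t * ray_kernel v t = (?outer v t + 2 * ?quot v t - ?inner t) + 2 * F (Re v) * ?inv v t"
      proof (cases "t \<in> {a..b}")
        case True
        have "g t * ray_kernel v t = 2 * F t / (of_real t - v) - g t"
          using nz[OF v, of t] by (simp add: ray_kernel_def F_def divide_simps) (simp add: algebra_simps)
        then show ?thesis using True by (simp add: diff_divide_distrib algebra_simps)
      qed simp
    qed simp
    also have "\<dots> = (\<integral>t. ?outer v t \<partial>lborel) + 2 * (\<integral>t. ?quot v t \<partial>lborel)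
        - (\<integral>t. ?inner t \<partial>lborel) + 2 * F (Re v) * (\<integral>t. ?inv v t \<partial>lborel)"
      by (rule integral_lincomb4[OF outer_int[OF SD(3)[OF v]] quot_int[OF v] inner_int inv_int[OF v]])
    finally show ?thesis unfolding inv_eq[OF v] .
  qed
  have FRe: "((\<lambda>v. F (Re v)) \<longlongrightarrow> F t0) ?at"
  proof (rule LIM_zero_cancel, rule Lim_null_comparison)
    show "\<forall>\<^sub>F v in ?at. norm (F (Re v) - F t0) \<le> L * \<bar>Re v - t0\<bar>"
      unfolding eventually_at_filter F_def using SD(4) lip ab by (intro always_eventually) auto
    have "((\<lambda>v. L * \<bar>Re v - t0\<bar>) \<longlongrightarrow> L * \<bar>Re (of_real t0) - t0\<bar>) ?at"
      by (intro tendsto_intros)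
    then show "((\<lambda>v. L * \<bar>Re v - t0\<bar>) \<longlongrightarrow> 0) ?at" by simp
  qed
  have outer_lim: "((\<lambda>v. \<integral>t. ?outer v t \<partial>lborel) \<longlongrightarrow> (\<integral>t. ?outer (of_real t0) t \<partial>lborel)) ?at"
  proof (rule tendsto_integral_within[where c = t0 and w = "\<lambda>t. 11 * norm (g t)"])
    fix t assume "t \<noteq> t0"
    then have "of_real t - of_real t0 \<noteq> (0 :: complex)" by simp
    then show "((\<lambda>v. ?outer v t) \<longlongrightarrow> ?outer (of_real t0) t) ?at"
      unfolding ray_kernel_def by (intro tendsto_intros)
  qed (use g outer_bound SD(3) in auto)
  have quot_lim: "((\<lambda>v. \<integral>t. ?quot v t \<partial>lborel) \<longlongrightarrow>
      (\<integral>t. indicator {a..b} t *\<^sub>R ((F t - F t0) / (of_real t - of_real t0)) \<partial>lborel)) ?at"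
  proof (rule tendsto_integral_within[where c = t0 and w = "\<lambda>t. indicator {a..b} t * L"])
    fix t assume "t \<noteq> t0"
    then have "of_real t - of_real t0 \<noteq> (0 :: complex)" by simp
    then show "((\<lambda>v. ?quot v t) \<longlongrightarrow> indicator {a..b} t *\<^sub>R ((F t - F t0) / (of_real t - of_real t0)))
        ?at"
      by (intro tendsto_intros FRe)
  qed (use ind_int quot_bound in auto)
  have "((\<lambda>v. (\<integral>t. ?outer v t \<partial>lborel) + 2 * (\<integral>t. ?quot v t \<partial>lborel)
      - (\<integral>t. ?inner t \<partial>lborel) + 2 * F (Re v) * (Ln (of_real b - v) - Ln (of_real a - v))) \<longlongrightarrow>
     (\<integral>t. ?outer (of_real t0) t \<partial>lborel)
     + 2 * (\<integral>t. indicator {a..b} t *\<^sub>R ((F t - F t0) / (of_real t - of_real t0)) \<partial>lborel)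
     - (\<integral>t. ?inner t \<partial>lborel) + 2 * F t0 * c1) ?at"
    by (intro tendsto_intros outer_lim quot_lim FRe c)
  moreover have "\<forall>\<^sub>F v in ?at. ray_transform g v =
      (\<integral>t. ?outer v t \<partial>lborel) + 2 * (\<integral>t. ?quot v t \<partial>lborel)
      - (\<integral>t. ?inner t \<partial>lborel) + 2 * F (Re v) * (Ln (of_real b - v) - Ln (of_real a - v))"
    unfolding eventually_at_filter using decomp by (intro always_eventually) auto
  ultimately show ?thesis unfolding F_def using tendsto_cong by fast
qed

text \<open>The one-sided limits differ only in the constant c1 of
  \<open>ray_transform_limit\<close>: for v near t0 the number t0 / 2 - v lies near the negative
  axis, where the boundary values of \<open>Ln\<close> differ by 2 pi i.\<close>

lemma ray_transform_jump:
  assumes t0: "t0 > 0"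
    and lip: "\<And>s t. s \<in> {t0 / 2..2 * t0} \<Longrightarrow> t \<in> {t0 / 2..2 * t0} \<Longrightarrow>
      norm (of_real s * g s - of_real t * g t) \<le> L * \<bar>s - t\<bar>"
  obtains P M where
    "(ray_transform g \<longlongrightarrow> P) (at (of_real t0) within {v. Im v < 0})"
    "(ray_transform g \<longlongrightarrow> M) (at (of_real t0) within {v. Im v > 0})"
    "P - M = - 4 * of_real pi * \<i> * (of_real t0 * g t0)"
proof -
  let ?a = "t0 / 2" and ?b = "2 * t0"
  let ?L = "Ln (of_real ?b - of_real t0) - Ln (of_real t0 - of_real ?a) :: complex"
  let ?D = "ball (of_real t0) (t0 / 4) :: complex set"
  have lnb: "((\<lambda>v. Ln (of_real ?b - v)) \<longlongrightarrow> Ln (of_real ?b - of_real t0)) (at (of_real t0) within S)"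
    and lna: "((\<lambda>v. Ln (v - of_real ?a)) \<longlongrightarrow> Ln (of_real t0 - of_real ?a)) (at (of_real t0) within S)" for S
    using t0 by (intro tendsto_intros; simp add: complex_nonpos_Reals_iff)+
  \<comment> \<open>Passing to v - t0 / 2 moves the logarithm away from its cut, so that it has a
    limit; the side survives as a constant.\<close>
  have minus: "Ln (of_real ?a - v) = Ln (v - of_real ?a) + (if Im v < 0 then \<i> * pi else - \<i> * pi)"
    if "Im v \<noteq> 0" for v
    using that Ln_minus[of "v - of_real ?a"] by (auto simp: complex_eq_iff)
  have side: "((\<lambda>v. Ln (of_real ?b - v) - Ln (of_real ?a - v)) \<longlongrightarrow> ?L - e) (at (of_real t0) within S)"
    (is "(?f \<longlongrightarrow> _) ?F") if "\<And>v. v \<in> S \<Longrightarrow> Ln (of_real ?a - v) = Ln (v - of_real ?a) + e" for S e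
  proof -
    have "((\<lambda>v. Ln (of_real ?b - v) - (Ln (v - of_real ?a) + e)) \<longlongrightarrow>
        Ln (of_real ?b - of_real t0) - (Ln (of_real t0 - of_real ?a) + e)) ?F"
      by (intro tendsto_intros lna lnb)
    moreover have "\<forall>\<^sub>F v in ?F. ?f v = Ln (of_real ?b - v) - (Ln (v - of_real ?a) + e)"
      unfolding eventually_at_filter using that by (intro always_eventually) auto
    ultimately show ?thesis using tendsto_cong by (fastforce simp: algebra_simps)
  qed
  have neg: "((\<lambda>v. Ln (of_real ?b - v) - Ln (of_real ?a - v)) \<longlongrightarrow> ?L - \<i> * pi)
      (at (of_real t0) within {v. Im v < 0} \<inter> ?D)"
    by (rule side, subst minus) auto
  have pos: "((\<lambda>v. Ln (of_real ?b - v) - Ln (of_real ?a - v)) \<longlongrightarrow> ?L - - \<i> * pi)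
      (at (of_real t0) within {v. Im v > 0} \<inter> ?D)"
    by (rule side, subst minus) auto
  \<comment> \<open>\<open>ray_transform_limit\<close> wants v within t0 / 4 of t0, a restriction
    the filter does not see.\<close>
  have local: "at (of_real t0) within S \<inter> ?D = at (of_real t0) within S" for S :: "complex set"
    by (rule at_within_nhd[of _ ?D]) (use t0 in auto)
  note lim = ray_transform_limit[OF t0 _ lip]
  show thesis
    by (rule that[OF lim[OF _ _ _ neg, unfolded local] lim[OF _ _ _ pos, unfolded local]])
      (auto simp: dist_commute algebra_simps)
qed

end

section \<open>Cauchy integrals over an arbitrary ray\<close>

definition ray_cauchy :: "complex \<Rightarrow> (complex \<Rightarrow> complex) \<Rightarrow> complex \<Rightarrow> complex" where
  "ray_cauchy w f z = ray_integral w (\<lambda>z'. 1 / z' * rho z z' * f z')"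

text \<open>The density with respect to dt after the substitution z' = t w; the factor 1 / t stems
  from dz' / z'.\<close>

definition ray_density :: "complex \<Rightarrow> (complex \<Rightarrow> complex) \<Rightarrow> real \<Rightarrow> complex" where
  "ray_density w f t = indicator {0<..} t *\<^sub>R (f (of_real t * w) / of_real t)"

text \<open>The decay is that of X^0 on its own ray: exp(- 1 / t) outweighs 1 / t at the origin,
  exp(- c t) gives integrability at infinity. Holomorphy near the ray supplies the Lipschitz bound
  for the jump.\<close>

definition ray_admissible :: "complex \<Rightarrow> (complex \<Rightarrow> complex) \<Rightarrow> bool" where
  "ray_admissible w f \<longleftrightarrow> w \<noteq> 0 \<and> (\<exists>U. open U \<and> ray w \<subseteq> U \<and> f holomorphic_on U) \<and>
     (\<exists>K c. c > 0 \<and> (\<forall>t>0. norm (f (of_real t * w)) \<le> K * exp (- 1 / t - c * t)))"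

lemma ray_cauchy_eq:
  assumes "w \<noteq> 0"
  shows "ray_cauchy w f z = 1 / (4 * of_real pi * \<i>) * ray_transform (ray_density w f) (z / w)"
proof -
  have "indicator {0<..} t *\<^sub>R (w * (1 / (of_real t * w) * rho z (of_real t * w) * f (of_real t * w))) =
      1 / (4 * of_real pi * \<i>) * (ray_density w f t * ray_kernel (z / w) t)" for t :: real
  proof (cases "t > 0")
    case True
    have "ray_kernel (z / w) t = ((of_real t + z / w) * w) / ((of_real t - z / w) * w)"
      unfolding ray_kernel_def using assms by simp
    also have "\<dots> = (of_real t * w + z) / (of_real t * w - z)"
      using assms by (simp add: algebra_simps)
    finally show ?thesis using True assms by (simp add: rho_def ray_density_def mult_ac)
  qed (simp add: ray_density_def)
  then show ?thesis
    by (simp add: ray_cauchy_def ray_integral_def set_lebesgue_integral_def ray_transform_def)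
qed

lemma ray_integral_eq:
  assumes "w \<noteq> 0"
  shows "ray_integral w (\<lambda>z'. 1 / z' * f z') = (\<integral>t. ray_density w f t \<partial>lborel)"
proof -
  have "indicator {0<..} t *\<^sub>R (w * (1 / (of_real t * w) * f (of_real t * w))) = ray_density w f t" for t :: real
    using assms by (simp add: ray_density_def indicator_def)
  then show ?thesis by (simp add: ray_integral_def set_lebesgue_integral_def)
qed

lemma integrable_exp_decay:
  assumes "c > 0" shows "integrable lborel (\<lambda>t. indicator {0<..} t * exp (- c * t) :: real)"
proof (rule Bochner_Integration.integrable_bound)
  have "LIM t at_top. - c * t :> at_bot"
    using assms filterlim_tendsto_neg_mult_at_bot[OF tendsto_const[of "- c"] _ filterlim_ident] by simp
  then have "((\<lambda>t. exp (- c * t)) \<longlongrightarrow> 0) at_top" by (rule filterlim_compose[OF exp_at_bot])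
  then have "((\<lambda>t. - exp (- c * t) / c) \<longlongrightarrow> - 0 / c) at_top"
    using assms by (intro tendsto_intros) auto
  then have "(\<integral>\<^sup>+t. ennreal (exp (- c * t)) * indicator {0..} t \<partial>lborel) = - 0 / c - (- exp (- c * 0) / c)"
    by (intro nn_integral_FTC_atLeast) (use assms in \<open>auto intro!: derivative_eq_intros\<close>)
  then have "(\<integral>\<^sup>+t. ennreal (exp (- c * t) * indicator {0..} t) \<partial>lborel) = ennreal (1 / c)"
    by (simp add: ennreal_mult' ennreal_indicator)
  then show "integrable lborel (\<lambda>t. exp (- c * t) * indicator {0..} t :: real)"
    by (intro integrableI_nonneg) (auto simp: ennreal_less_top)
  show "AE t in lborel. norm (indicator {0<..} t * exp (- c * t)) \<le> norm (exp (- c * t) * indicator {0..} t :: real)"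
    by (intro AE_I2) (simp add: indicator_def)
qed simp

lemma in_ray: "t > 0 \<Longrightarrow> of_real t * w \<in> ray w"
  by (auto simp: ray_def)

lemma ray_nonneg_Reals: "w \<noteq> 0 \<Longrightarrow> z / w \<in> nonneg_Reals \<longleftrightarrow> z = 0 \<or> z \<in> ray w"
proof -
  assume w: "w \<noteq> 0"
  have "z / w = of_real t \<longleftrightarrow> z = of_real t * w" for t using w by (simp add: field_simps)
  then show ?thesis unfolding nonneg_Reals_def ray_def
    using w by (auto simp: image_iff less_le)
qed

lemma ray_density_0: "t \<le> 0 \<Longrightarrow> ray_density w f t = 0"
  by (simp add: ray_density_def)

lemma ray_density_integrable:
  assumes "ray_admissible w f" shows "integrable lborel (ray_density w f)"
proof -
  from assms obtain U K c where U: "open U" "ray w \<subseteq> U" "f holomorphic_on U"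
    and K: "c > 0" "\<And>t. t > 0 \<Longrightarrow> norm (f (of_real t * w)) \<le> K * exp (- 1 / t - c * t)"
    unfolding ray_admissible_def by blast
  have "continuous_on {0<..} (\<lambda>t. f (of_real t * w))"
    by (rule continuous_on_compose2[OF holomorphic_on_imp_continuous_on[OF U(3)]])
      (use U(2) in_ray in \<open>auto intro!: continuous_intros\<close>)
  then have meas: "ray_density w f \<in> borel_measurable borel"
    unfolding ray_density_def
    by (intro borel_measurable_continuous_on_indicator continuous_intros) auto
  show ?thesis
  proof (rule Bochner_Integration.integrable_bound)
    show "integrable lborel (\<lambda>t. K * (indicator {0<..} t * exp (- c * t)))"
      using integrable_exp_decay[OF K(1)] by simp
    show "AE t in lborel. norm (ray_density w f t) \<le> norm (K * (indicator {0<..} t * exp (- c * t)))"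
    proof (rule AE_I2)
      fix t :: real
      show "norm (ray_density w f t) \<le> norm (K * (indicator {0<..} t * exp (- c * t)))"
      proof (cases "t > 0")
        case True
        have "0 \<le> K * exp (- 1 / t - c * t)" using K(2)[OF True] norm_ge_zero order_trans by blast
        then have K0: "K \<ge> 0" by (simp add: zero_le_mult_iff)
        \<comment> \<open>This bounds exp(- 1 / t) / t by 1 and so disposes of the singularity of
          dz' / z' at the origin.\<close>
        have "1 + 1 / t \<le> exp (1 / t)" by (rule exp_ge_add_one_self)
        then have "1 / t * exp (- 1 / t) \<le> 1" using True by (simp add: exp_minus field_simps)
        then have "K * exp (- c * t) * (1 / t * exp (- 1 / t)) \<le> K * exp (- c * t) * 1"
          using K0 by (intro mult_left_mono) auto
        moreover have "norm (f (of_real t * w)) / t \<le> K * exp (- 1 / t - c * t) / t"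
          using K(2)[OF True] True by (simp add: divide_right_mono)
        moreover have "K * exp (- 1 / t - c * t) / t = K * exp (- c * t) * (1 / t * exp (- 1 / t))"
          by (simp add: exp_diff exp_minus field_simps)
        ultimately have "norm (f (of_real t * w)) / t \<le> K * exp (- c * t)" by linarith
        then show ?thesis using True K0 by (simp add: ray_density_def norm_divide)
      qed (simp add: ray_density_def)
    qed
  qed (use meas in simp)
qed

text \<open>For t > 0, t times the density is f along the ray, and the derivative of f is bounded on
  a compact segment.\<close>

lemma ray_density_lipschitz:
  assumes "ray_admissible w f" "a > 0"
  obtains L where "\<And>s t. s \<in> {a..b} \<Longrightarrow> t \<in> {a..b} \<Longrightarrow>
    norm (of_real s * ray_density w f s - of_real t * ray_density w f t) \<le> L * \<bar>s - t\<bar>"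
proof -
  from assms obtain U where U: "open U" "ray w \<subseteq> U" "f holomorphic_on U"
    unfolding ray_admissible_def by blast
  let ?S = "(\<lambda>t. of_real t * w) ` {a..b}"
  have SU: "?S \<subseteq> U" using assms(2) U(2) in_ray by fastforce
  have "compact ?S" by (intro compact_continuous_image continuous_intros) auto
  moreover have "continuous_on ?S (deriv f)"
    using holomorphic_on_imp_continuous_on[OF holomorphic_deriv[OF U(3,1)]] continuous_on_subset SU by blast
  ultimately have "bounded (deriv f ` ?S)" by (metis compact_continuous_image compact_imp_bounded)
  then obtain D where D: "\<And>z. z \<in> ?S \<Longrightarrow> norm (deriv f z) \<le> D" unfolding bounded_iff by blast
  have "convex ?S" by (intro convex_linear_image) (auto intro!: linearI simp: algebra_simps scaleR_conv_of_real)
  then have lip: "norm (f x - f y) \<le> D * norm (x - y)" if "x \<in> ?S" "y \<in> ?S" for x y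
  proof (rule field_differentiable_bound[where f' = "deriv f"])
    fix z assume "z \<in> ?S"
    then have "(f has_field_derivative deriv f z) (at z)" using SU by (intro holomorphic_derivI[OF U(3,1)]) auto
    then show "(f has_field_derivative deriv f z) (at z within ?S)" by (rule has_field_derivative_at_within)
  qed (use D that in auto)
  have "norm (of_real s * ray_density w f s - of_real t * ray_density w f t) \<le> D * norm w * \<bar>s - t\<bar>"
    if "s \<in> {a..b}" "t \<in> {a..b}" for s t
  proof -
    have "norm (of_real s * w - of_real t * w) = norm w * \<bar>s - t\<bar>"
      by (metis left_diff_distrib mult.commute norm_mult norm_of_real of_real_diff)
    moreover have "norm (f (of_real s * w) - f (of_real t * w)) \<le> D * norm (of_real s * w - of_real t * w)"
      by (rule lip) (use that in blast)+
    ultimately show ?thesis using that assms(2) by (simp add: ray_density_def mult.assoc)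
  qed
  then show thesis using that by blast
qed

context
  fixes w :: complex and f :: "complex \<Rightarrow> complex"
  assumes adm: "ray_admissible w f"
begin

lemma ray_w_nonzero: "w \<noteq> 0"
  using adm by (simp add: ray_admissible_def)

lemma ray_cauchy_differentiable:
  assumes "z \<noteq> 0" "z \<notin> ray w"
  shows "ray_cauchy w f field_differentiable at z"
proof -
  let ?g = "ray_density w f"
  have "ray_transform ?g field_differentiable at (z / w)"
    by (rule ray_transform_differentiable[OF ray_density_integrable[OF adm] ray_density_0])
      (use assms ray_w_nonzero in \<open>auto simp: ray_nonneg_Reals\<close>)
  moreover have "(\<lambda>z. z / w) field_differentiable at z"
    using ray_w_nonzero by (auto intro!: derivative_intros)
  ultimately have "ray_transform ?g \<circ> (\<lambda>z. z / w) field_differentiable at z"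
    by (intro field_differentiable_compose) auto
  then have "(\<lambda>z. 1 / (4 * of_real pi * \<i>) * (ray_transform ?g \<circ> (\<lambda>z. z / w)) z) field_differentiable at z"
    by (intro derivative_intros)
  moreover have "ray_cauchy w f = (\<lambda>z. 1 / (4 * of_real pi * \<i>) * (ray_transform ?g \<circ> (\<lambda>z. z / w)) z)"
    by (rule ext) (simp add: ray_cauchy_eq[OF ray_w_nonzero])
  ultimately show ?thesis by (simp only:)
qed

text \<open>Scaling v by s > 0 preserves \<open>ray_sep m\<close>, so one constant serves the whole
  ray. Applied to the branches of a tree, this shows that they do not spoil the decay of the density
  on the root ray.\<close>

lemma ray_cauchy_bounded_on_ray:
  assumes "v \<noteq> 0" "v \<notin> ray w"
  obtains K where "\<And>s. s > 0 \<Longrightarrow> norm (ray_cauchy w f (of_real s * v)) \<le> K"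
proof -
  let ?g = "ray_density w f"
  have "v / w \<notin> nonneg_Reals" using assms ray_w_nonzero by (simp add: ray_nonneg_Reals)
  then obtain m where m: "m > 0" "ray_sep m (v / w)" using ray_sep_exists by blast
  have "ray_sep m (of_real s * v / w)" if "s > 0" for s
    unfolding ray_sep_def
  proof (intro conjI allI impI)
    show "of_real s * v / w \<noteq> 0" using that assms ray_w_nonzero by simp
    fix t :: real assume "t > 0"
    then have "m * norm (v / w) \<le> norm (of_real (t / s) - v / w)"
      using m(2) that unfolding ray_sep_def by (metis divide_pos_pos)
    then have "s * (m * norm (v / w)) \<le> s * norm (of_real (t / s) - v / w)"
      using that by (intro mult_left_mono) auto
    also have "\<dots> = norm (of_real s * (of_real (t / s) - v / w))" using that by (simp add: norm_mult)
    also have "of_real s * (of_real (t / s) - v / w) = of_real t - of_real s * v / w"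
      using that by (simp add: algebra_simps)
    finally show "m * norm (of_real s * v / w) \<le> norm (of_real t - of_real s * v / w)"
      using that by (simp add: norm_mult norm_divide mult_ac)
  qed
  then have "norm (ray_cauchy w f (of_real s * v)) \<le>
      norm (1 / (4 * of_real pi * \<i>)) * ((1 + 2 / m) * (\<integral>t. norm (?g t) \<partial>lborel))" if "s > 0" for s
    unfolding ray_cauchy_eq[OF ray_w_nonzero] norm_mult using that m
    by (intro mult_left_mono ray_transform_bound ray_density_integrable[OF adm]) (auto simp: ray_density_0)
  then show thesis using that by blast
qed

lemma ray_cauchy_jump:
  assumes "z0 \<in> ray w"
  obtains P M where "(ray_cauchy w f \<longlongrightarrow> P) (at_ccw z0)" "(ray_cauchy w f \<longlongrightarrow> M) (at_cw z0)" "P - M = - f z0"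
proof -
  let ?g = "ray_density w f" and ?c = "1 / (4 * of_real pi * \<i>) :: complex"
  obtain t0 where t0: "t0 > 0" "z0 = of_real t0 * w" using assms by (auto simp: ray_def)
  obtain L where "\<And>s t. s \<in> {t0 / 2..2 * t0} \<Longrightarrow> t \<in> {t0 / 2..2 * t0} \<Longrightarrow>
      norm (of_real s * ?g s - of_real t * ?g t) \<le> L * \<bar>s - t\<bar>"
    using ray_density_lipschitz[OF adm, of "t0 / 2" "2 * t0"] t0(1) by auto
  then obtain P M where PM:
    "(ray_transform ?g \<longlongrightarrow> P) (at (of_real t0) within {v. Im v < 0})"
    "(ray_transform ?g \<longlongrightarrow> M) (at (of_real t0) within {v. Im v > 0})"
    "P - M = - 4 * of_real pi * \<i> * (of_real t0 * ?g t0)"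
    using ray_transform_jump[OF ray_density_integrable[OF adm] ray_density_0 t0(1)] by metis
  \<comment> \<open>Division by w carries the sides of z0 to the sides of t0, because z / w is z /
    z0 times the positive number t0. Q stands for either sign condition.\<close>
  have lim: "filterlim (\<lambda>z. z / w) (at (of_real t0) within {v. Q (Im v)}) (at z0 within {z. Q (Im (z / z0))})"
    if Q: "\<And>x. Q (x / t0) \<longleftrightarrow> Q x" for Q :: "real \<Rightarrow> bool"
    unfolding filterlim_at
  proof
    show "((\<lambda>z. z / w) \<longlongrightarrow> of_real t0) (at z0 within {z. Q (Im (z / z0))})"
      by (rule tendsto_eq_intros refl)+ (use ray_w_nonzero t0 in auto)
    have Im_eq: "Im (z / z0) = Im (z / w) / t0" for z
    proof -
      have "z / z0 = (z / w) / of_real t0" using t0 by (simp add: divide_simps mult.commute)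
      then show ?thesis by (simp only: Im_divide_of_real)
    qed
    then show "\<forall>\<^sub>F z in at z0 within {z. Q (Im (z / z0))}. z / w \<in> {v. Q (Im v)} \<and> z / w \<noteq> of_real t0"
    proof -
      have "Q (Im (z / z0)) \<longleftrightarrow> Q (Im (z / w))" for z by (simp only: Im_eq Q)
      moreover have "z / w \<noteq> of_real t0" if "z \<noteq> z0" for z using that t0 ray_w_nonzero by (metis nonzero_eq_divide_eq)
      ultimately show ?thesis unfolding eventually_at_filter by (intro always_eventually) auto
    qed
  qed
  have "(ray_cauchy w f \<longlongrightarrow> ?c * P) (at_ccw z0)" "(ray_cauchy w f \<longlongrightarrow> ?c * M) (at_cw z0)"
  proof -
    have "filterlim (\<lambda>z. z / w) (at (of_real t0) within {v. Im v < 0}) (at z0 within {z. Im (z / z0) < 0})"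
      using lim[of "\<lambda>x. x < 0"] t0(1) by (simp add: divide_less_0_iff)
    from filterlim_compose[OF PM(1) this] show "(ray_cauchy w f \<longlongrightarrow> ?c * P) (at_ccw z0)"
      unfolding at_ccw_def ray_cauchy_eq[OF ray_w_nonzero, abs_def] by (rule tendsto_mult_left)
    have "filterlim (\<lambda>z. z / w) (at (of_real t0) within {v. Im v > 0}) (at z0 within {z. Im (z / z0) > 0})"
      using lim[of "\<lambda>x. x > 0"] t0(1) by (simp add: zero_less_divide_iff)
    from filterlim_compose[OF PM(2) this] show "(ray_cauchy w f \<longlongrightarrow> ?c * M) (at_cw z0)"
      unfolding at_cw_def ray_cauchy_eq[OF ray_w_nonzero, abs_def] by (rule tendsto_mult_left)
  qed
  moreover have "?c * P - ?c * M = - f z0"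
    unfolding right_diff_distrib[symmetric] PM(3) using t0 by (simp add: ray_density_def)
  ultimately show thesis using that by blast
qed

text \<open>Since \<open>sgn z\<close> tends to u, the points z / w eventually lie in a sector that
  avoids the half-line, where \<open>ray_transform_at_0\<close> applies.\<close>

lemma ray_cauchy_at_0_dir:
  assumes u: "norm u = 1" "u \<notin> ray w"
  shows "(ray_cauchy w f \<longlongrightarrow> 1 / (4 * of_real pi * \<i>) * ray_integral w (\<lambda>z'. 1 / z' * f z')) (at_0_dir u)"
proof -
  have "u \<noteq> 0" using u by auto
  then have "u / w \<notin> nonneg_Reals" using u ray_w_nonzero by (simp add: ray_nonneg_Reals)
  then have "sgn (u / w) \<notin> nonneg_Reals" by (rule sgn_not_nonneg_Real)
  moreover have "norm (sgn (u / w)) = 1"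
    using \<open>u \<noteq> 0\<close> ray_w_nonzero unfolding norm_sgn by (simp only: divide_eq_0_iff) simp
  ultimately obtain m where m: "m > 0" "\<And>v. v \<noteq> 0 \<Longrightarrow> dist (sgn v) (sgn (u / w)) < m \<Longrightarrow> ray_sep m v"
    using ray_sep_near by blast
  define S where "S = {v. v \<noteq> 0 \<and> dist (sgn v) (sgn (u / w)) < m}"
  have "(ray_transform (ray_density w f) \<longlongrightarrow> (\<integral>t. ray_density w f t \<partial>lborel)) (at 0 within S)"
    by (rule ray_transform_at_0[OF ray_density_integrable[OF adm] ray_density_0 m(1)])
      (use m(2) in \<open>auto simp: S_def\<close>)
  moreover have "filterlim (\<lambda>z. z / w) (at 0 within S) (at_0_dir u)"
    unfolding filterlim_at
  proof
    have "((\<lambda>z. z / w) \<longlongrightarrow> 0 / w) (at 0)" using ray_w_nonzero by (intro tendsto_intros)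
    then show "((\<lambda>z. z / w) \<longlongrightarrow> 0) (at_0_dir u)"
      unfolding at_0_dir_def by (auto intro: filterlim_mono)
    have "filterlim sgn (nhds u) (at_0_dir u)"
      unfolding at_0_dir_def by (rule filterlim_mono[OF filterlim_filtercomap]) auto
    then have "((\<lambda>z. sgn z / sgn w) \<longlongrightarrow> u / sgn w) (at_0_dir u)"
      using ray_w_nonzero by (intro tendsto_divide tendsto_const) (auto simp: sgn_zero_iff)
    moreover have "u / sgn w = sgn (u / w)"
      using u ray_w_nonzero by (simp add: sgn_eq norm_divide)
    ultimately have "\<forall>\<^sub>F z in at_0_dir u. dist (sgn z / sgn w) (sgn (u / w)) < m"
      using m(1) tendstoD by metis
    moreover have "\<forall>\<^sub>F z in at_0_dir u. z \<noteq> 0"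
      unfolding at_0_dir_def by (rule filter_leD[OF inf_le1]) (auto simp: eventually_at_filter)
    ultimately show "\<forall>\<^sub>F z in at_0_dir u. z / w \<in> S \<and> z / w \<noteq> 0"
      by eventually_elim (use ray_w_nonzero in \<open>auto simp: S_def sgn_eq norm_divide mult.commute\<close>)
  qed
  ultimately show ?thesis
    unfolding ray_cauchy_eq[OF ray_w_nonzero, abs_def] ray_integral_eq[OF ray_w_nonzero]
    by (intro tendsto_mult_left) (rule filterlim_compose)
qed

end


section \<open>The tree functions\<close>

definition ray_factor :: "('n::finite lat \<Rightarrow> complex) \<Rightarrow> 'n lat \<Rightarrow> complex \<Rightarrow> complex" where
  "ray_factor Z \<gamma> z = exp (Z \<gamma> / z + z * cnj (Z \<gamma>))"

text \<open>The scalar part of G_T. Applying the recursion inside the multiset of functions, as in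
  \<open>treeG\<close>, is what primitive recursion through a multiset requires;
  \<open>tree_G_eq\<close> is the readable form.\<close>

primrec tree_G :: "('n::finite lat \<Rightarrow> complex) \<Rightarrow> 'n lat rtree \<Rightarrow> complex \<Rightarrow> complex" where
  "tree_G Z (Node \<gamma> M) = ray_cauchy (- Z \<gamma>)
     (\<lambda>z'. ray_factor Z \<gamma> z' * (\<Prod>F\<in>#image_mset (tree_G Z) M. F z'))"

text \<open>The density whose Cauchy integral over the root ray is G_T; up to sign it is also the
  jump of G_T there.\<close>

fun tree_f :: "('n::finite lat \<Rightarrow> complex) \<Rightarrow> 'n lat rtree \<Rightarrow> complex \<Rightarrow> complex" where
  "tree_f Z (Node \<gamma> M) z = ray_factor Z \<gamma> z * (\<Prod>T\<in>#M. tree_G Z T z)"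

definition tree_G0 :: "('n::finite lat \<Rightarrow> complex) \<Rightarrow> 'n lat rtree \<Rightarrow> complex" where
  "tree_G0 Z T = 1 / (4 * of_real pi * \<i>) * ray_integral (- Z (rroot T)) (\<lambda>z'. 1 / z' * tree_f Z T z')"

lemma tree_G_eq: "tree_G Z T = ray_cauchy (- Z (rroot T)) (tree_f Z T)"
proof (cases T)
  case (Node \<gamma> M)
  have "(\<lambda>z'. ray_factor Z \<gamma> z' * (\<Prod>F\<in>#image_mset (tree_G Z) M. F z')) = tree_f Z (Node \<gamma> M)"
    by (rule ext) (simp add: multiset.map_comp comp_def)
  then show ?thesis by (simp add: Node)
qed

text \<open>The exponent of the basis vector that carries G_T.\<close>

definition tree_deg :: "'n::finite lat rtree \<Rightarrow> 'n lat" where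
  "tree_deg T = \<Sum>\<^sub># (entries T)"

lemma tree_deg_Node: "tree_deg (Node \<gamma> M) = \<gamma> + (\<Sum>T\<in>#M. tree_deg T)"
proof -
  have "\<Sum>\<^sub># (\<Sum>T\<in>#M. entries T) = (\<Sum>T\<in>#M. \<Sum>\<^sub># (entries T))" by (induction M) auto
  then show ?thesis by (simp add: tree_deg_def)
qed

text \<open>With b equal to 0 or 1 the identity holds whether or not the integral converges, so it
  covers trees with singular inner integrals as well.\<close>

lemma ray_integral_mult_indicator:
  assumes "b = 0 \<or> b = 1" shows "ray_integral w (\<lambda>z. f z * b) = ray_integral w f * b"
  using assms by (auto simp: ray_integral_def)

context cone_algebra
begin

lemma hprod_scaled_be:
  assumes "\<And>T. T \<in># M \<Longrightarrow> deg T \<in> C"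
  shows "hprod_mset C (image_mset (\<lambda>T \<eta>. F T * be C (deg T) \<eta>) M) =
    (\<lambda>\<eta>. (\<Prod>T\<in>#M. F T) * be C (\<Sum>T\<in>#M. deg T) \<eta>)"
  using assms
proof (induction M)
  case (add T M)
  have "(\<Sum>T\<in>#M. deg T) \<in> C" by (intro sum_mset_in_cone) (use add in auto)
  with add show ?case
    by (simp add: hmult_scale_left hmult_scale_right be_mult_be mult.assoc)
qed simp

lemma tree_deg_in_cone: "set_rtree T \<subseteq> C \<Longrightarrow> tree_deg T \<in> C"
  unfolding tree_deg_def using sum_mset_in_cone[of "entries T" "\<lambda>x. x"] by auto

lemma hmult_X0_hprod:
  assumes "set_rtree (Node \<gamma> M) \<subseteq> C"
    and "\<And>T. T \<in># M \<Longrightarrow> F T = (\<lambda>\<eta>. f T * be C (tree_deg T) \<eta>)"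
  shows "hmult C (X0 C Z z \<gamma>) (hprod_mset C (image_mset F M)) =
    (\<lambda>\<eta>. ray_factor Z \<gamma> z * (\<Prod>T\<in>#M. f T) * be C (tree_deg (Node \<gamma> M)) \<eta>)"
proof -
  have deg: "tree_deg T \<in> C" if "T \<in># M" for T
    by (rule tree_deg_in_cone) (use assms(1) that in auto)
  have "image_mset F M = image_mset (\<lambda>T \<eta>. f T * be C (tree_deg T) \<eta>) M"
    by (rule image_mset_cong) (use assms(2) in auto)
  moreover have "(\<Sum>T\<in>#M. tree_deg T) \<in> C" by (rule sum_mset_in_cone) (rule deg)
  ultimately show ?thesis
    using assms(1) by (simp add: hprod_scaled_be deg X0_def ray_factor_def hmult_scale_left
        hmult_scale_right be_mult_be tree_deg_Node mult.assoc)
qed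

lemma be_values: "be C \<alpha> \<eta> = 0 \<or> be C \<alpha> \<eta> = 1"
  by (simp add: be_def)

lemma hmult_X0_treeG:
  assumes "set_rtree (Node \<gamma> M) \<subseteq> C"
    and "\<And>T. T \<in># M \<Longrightarrow> treeG C Z T z = (\<lambda>\<eta>. tree_G Z T z * be C (tree_deg T) \<eta>)"
  shows "hmult C (X0 C Z z \<gamma>) (hprod_mset C (image_mset (\<lambda>T. treeG C Z T z) M)) \<eta> =
    tree_f Z (Node \<gamma> M) z * be C (tree_deg (Node \<gamma> M)) \<eta>"
  using hmult_X0_hprod[OF assms(1), of "\<lambda>T. treeG C Z T z" "\<lambda>T. tree_G Z T z"] assms(2) by simp

lemma treeG_eq:
  "set_rtree T \<subseteq> C \<Longrightarrow> treeG C Z T z = (\<lambda>\<eta>. tree_G Z T z * be C (tree_deg T) \<eta>)"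
proof (induction T arbitrary: z)
  case (Node \<gamma> M)
  have "treeG C Z T z' = (\<lambda>\<eta>. tree_G Z T z' * be C (tree_deg T) \<eta>)" if "T \<in># M" for T z'
    using Node that by auto
  note hmult_X0_treeG[OF Node.prems this]
  then show ?case
    unfolding tree_G_eq ray_cauchy_def
    by (intro ext) (simp add: multiset.map_comp comp_def
        ray_integral_mult_indicator[OF be_values, symmetric] mult.assoc del: tree_f.simps)
qed

lemma treeG0_eq:
  "set_rtree T \<subseteq> C \<Longrightarrow> treeG0 C Z T = (\<lambda>\<eta>. tree_G0 Z T * be C (tree_deg T) \<eta>)"
proof (cases T)
  case (Node \<gamma> M)
  assume C: "set_rtree T \<subseteq> C"
  have "treeG C Z T z' = (\<lambda>\<eta>. tree_G Z T z' * be C (tree_deg T) \<eta>)" if "T \<in># M" for T z'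
    by (rule treeG_eq) (use C Node that in auto)
  note hmult_X0_treeG[OF C[unfolded Node] this]
  then show ?thesis
    unfolding tree_G0_def Node
    by (intro ext) (simp add: ray_integral_mult_indicator[OF be_values, symmetric] mult.assoc del: tree_f.simps)
qed

end

lemma ray_ray: "x \<in> ray w \<Longrightarrow> ray x = ray w"
proof -
  assume "x \<in> ray w"
  then obtain s where s: "s > 0" "x = of_real s * w" by (auto simp: ray_def)
  have "\<exists>t'>0. of_real t * x = of_real t' * w" if "t > 0" for t
    using s that by (intro exI[of _ "t * s"]) auto
  moreover have "\<exists>t'>0. of_real t * w = of_real t' * x" if "t > 0" for t
    using s that by (intro exI[of _ "t / s"]) auto
  ultimately show ?thesis unfolding ray_def by blast
qed

lemma self_in_ray: "w \<in> ray w"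
  unfolding ray_def by (auto intro!: exI[of _ 1])

lemma closed_ray_0: "closed (insert 0 (ray w))"
proof (cases "w = 0")
  case True
  then have "ray w = {0}" by (auto simp: ray_def intro!: exI[of _ 1])
  then show ?thesis by simp
next
  case False
  then have "insert 0 (ray w) = (\<lambda>z. z / w) -` \<real>\<^sub>\<ge>\<^sub>0" by (auto simp: ray_nonneg_Reals)
  moreover have "closed ((\<lambda>z. z / w) -` (\<real>\<^sub>\<ge>\<^sub>0 :: complex set))"
    using False by (intro continuous_closed_vimage continuous_intros) auto
  ultimately show ?thesis by simp
qed

section \<open>Trees of nonzero weight\<close>

locale stability_algebra = cone_algebra C
  for C :: "'n::finite lat set" +
  fixes pr :: "'n lat \<Rightarrow> 'n lat \<Rightarrow> int" and Om :: "'n lat \<Rightarrow> rat" and Z :: "'n lat \<Rightarrow> complex"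
  assumes form: "skew_form pr" and data: "stability_data Om Z"
    and pos: "positive_data C Om" and gen: "generic_data pr Om Z"
begin

abbreviation wt where "wt \<equiv> tree_weight pr Om"

text \<open>Integrals of trees outside this set may be singular, but such trees have coefficient
  zero in every sum.\<close>

definition trees :: "'n lat rtree set" where "trees = {T. wt T \<noteq> 0}"

lemma pr_add_right: "pr a (b + c) = pr a b + pr a c"
  and pr_add_left: "pr (a + b) c = pr a c + pr b c"
  and pr_skew: "pr a b = - pr b a"
  using form unfolding skew_form_def by blast+

lemma pr_0 [simp]: "pr a 0 = 0" "pr 0 a = 0"
  using pr_add_right[of a 0 0] pr_add_left[of 0 0 a] by simp_all

lemma Z_add: "Z (a + b) = Z a + Z b"
  using data unfolding stability_data_def by blast

lemma Z_0 [simp]: "Z 0 = 0"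
  using Z_add[of 0 0] by simp

text \<open>The support condition excludes Z \<gamma> = 0, so an active vector spans a genuine
  ray.\<close>

lemma active:
  assumes "DT Om \<gamma> \<noteq> 0" shows "\<gamma> \<in> C" "\<gamma> \<noteq> 0" "Z \<gamma> \<noteq> 0"
proof -
  show "\<gamma> \<in> C" using assms pos by (simp add: positive_data_def)
  show nz: "\<gamma> \<noteq> 0" using assms by (auto simp: DT_def)
  obtain K where "norm (\<chi> i. real_of_int (\<gamma> $ i)) \<le> K * cmod (Z \<gamma>)"
    using data assms unfolding stability_data_def by blast
  moreover have "(\<chi> i. real_of_int (\<gamma> $ i)) \<noteq> 0" using nz by (auto simp: vec_eq_iff)
  ultimately show "Z \<gamma> \<noteq> 0" by auto
qed

lemma trees_Node:
  "Node \<gamma> M \<in> trees \<longleftrightarrow> DT Om \<gamma> \<noteq> 0 \<and> (\<forall>T\<in>#M. T \<in> trees \<and> pr (rroot T) \<gamma> \<noteq> 0)"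
  using mfact_pos[of M] by (auto simp: trees_def tree_weight_Node prod_mset_zero_iff image_iff)

lemma trees_entries: "T \<in> trees \<Longrightarrow> \<gamma> \<in> set_rtree T \<Longrightarrow> DT Om \<gamma> \<noteq> 0"
  by (induction T) (auto simp: trees_Node)

lemma trees_subset_cone: "T \<in> trees \<Longrightarrow> set_rtree T \<subseteq> C"
  using trees_entries active by blast

lemma trees_root: "T \<in> trees \<Longrightarrow> DT Om (rroot T) \<noteq> 0"
  using trees_entries rroot_in_set by blast

lemma root_decomp:
  assumes "T \<in> trees"
  obtains \<delta> where "\<delta> \<in> C" "tree_deg T = rroot T + \<delta>"
proof (cases T)
  case (Node \<gamma> M)
  have "(\<Sum>T\<in>#M. tree_deg T) \<in> C"
    by (rule sum_mset_in_cone, rule tree_deg_in_cone)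
      (use trees_subset_cone[OF assms] Node in auto)
  then show thesis using that Node by (simp add: tree_deg_Node)
qed

lemma trees_deg: "T \<in> trees \<Longrightarrow> tree_deg T \<in> C - {0}"
  using root_decomp[of T] active[OF trees_root, of T] cone_add_eq_0 add_in_cone by (metis Diff_iff singletonD)

lemma root_basis_le: "T \<in> trees \<Longrightarrow> tree_deg T \<in> basis_le C k \<Longrightarrow> rroot T \<in> basis_le C k"
  using root_decomp[of T] active(1)[OF trees_root, of T] basis_le_summand(1) by metis

lemma distinct_rays:
  assumes "DT Om \<gamma> \<noteq> 0" "DT Om \<eta> \<noteq> 0" "pr \<gamma> \<eta> \<noteq> 0" "z \<in> ell Z \<gamma>"
  shows "z \<notin> ell Z \<eta>"
proof
  assume "z \<in> ell Z \<eta>"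
  then have "ell Z \<gamma> = ell Z \<eta>" using assms(4) ray_ray unfolding ell_def by metis
  then show False using gen assms unfolding generic_data_def by blast
qed

text \<open>The branches are holomorphic near the root ray and bounded on it, since their own root
  rays are different; the exponential decay comes from the factor X^0 of the root alone.\<close>

lemma tree_f_admissible: "T \<in> trees \<Longrightarrow> ray_admissible (- Z (rroot T)) (tree_f Z T)"
proof (induction T)
  case (Node \<gamma> M)
  let ?w = "- Z \<gamma>"
  have w: "?w \<noteq> 0" using Node.prems active trees_Node by auto
  have ch: "T \<in> trees" "pr (rroot T) \<gamma> \<noteq> 0" "ray_admissible (- Z (rroot T)) (tree_f Z T)" if "T \<in># M" for T
    using Node that trees_Node by auto
  have off: "z \<notin> ray (- Z (rroot T))" if "T \<in># M" "z \<in> ray ?w" for T z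
    using distinct_rays[of "rroot T" \<gamma> z] ch[OF that(1)] trees_root that Node.prems trees_Node
    unfolding ell_def by blast
  \<comment> \<open>The punctured plane without the root rays of the branches: all branch functions
    are holomorphic there.\<close>
  define U where "U = - (\<Union>T\<in>set_mset M. insert 0 (ray (- Z (rroot T)))) - {0}"
  have "open U" unfolding U_def
    by (intro open_Diff open_Compl closed_UN) (auto simp: closed_ray_0)
  moreover have "ray ?w \<subseteq> U"
    using off w by (auto simp: U_def ray_def)
  moreover have "tree_f Z (Node \<gamma> M) holomorphic_on U"
  proof -
    have G: "tree_G Z T holomorphic_on U" if "T \<in># M" for T
      unfolding holomorphic_on_def tree_G_eq
    proof
      fix z assume "z \<in> U"
      then have "z \<noteq> 0" "z \<notin> ray (- Z (rroot T))" using that unfolding U_def by blast+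
      then show "ray_cauchy (- Z (rroot T)) (tree_f Z T) field_differentiable at z within U"
        using ray_cauchy_differentiable[OF ch(3)[OF that]] field_differentiable_at_within by blast
    qed
    then have "(\<lambda>z. \<Prod>T\<in>#M. tree_G Z T z) holomorphic_on U"
      by (induction M) (auto intro!: holomorphic_intros)
    moreover have "ray_factor Z \<gamma> holomorphic_on U"
      unfolding ray_factor_def U_def by (intro holomorphic_intros) auto
    moreover have "tree_f Z (Node \<gamma> M) = (\<lambda>z. ray_factor Z \<gamma> z * (\<Prod>T\<in>#M. tree_G Z T z))"
      by (rule ext) simp
    ultimately show ?thesis by (simp only: holomorphic_on_mult)
  qed
  moreover have "\<exists>K. \<forall>t>0. norm (tree_f Z (Node \<gamma> M) (of_real t * ?w)) \<le> K * exp (- 1 / t - (norm ?w)\<^sup>2 * t)"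
  proof -
    have "\<exists>K. \<forall>t>0. norm (tree_G Z T (of_real t * ?w)) \<le> K" if "T \<in># M" for T
      using ray_cauchy_bounded_on_ray[OF ch(3)[OF that] w off[OF that self_in_ray]]
      unfolding tree_G_eq by metis
    then have "\<exists>K. \<forall>t>0. norm (\<Prod>T\<in>#M. tree_G Z T (of_real t * ?w)) \<le> K"
    proof (induction M)
      case (add T M)
      then obtain K L where K: "\<And>t. t > 0 \<Longrightarrow> norm (tree_G Z T (of_real t * ?w)) \<le> K"
        and L: "\<And>t. t > 0 \<Longrightarrow> norm (\<Prod>T\<in>#M. tree_G Z T (of_real t * ?w)) \<le> L"
        by (metis union_single_eq_member insert_iff set_mset_add_mset_insert)
      have "norm (\<Prod>T\<in>#add_mset T M. tree_G Z T (of_real t * ?w)) \<le> K * L" if "t > 0" for t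
        using mult_mono[OF K[OF that] L[OF that]] norm_ge_zero order_trans[OF norm_ge_zero K[OF that]]
        by (simp add: norm_mult)
      then show ?case by blast
    qed (auto intro: exI[of _ 1])
    then obtain K where K: "\<And>t. t > 0 \<Longrightarrow> norm (\<Prod>T\<in>#M. tree_G Z T (of_real t * ?w)) \<le> K" by blast
    have "norm (ray_factor Z \<gamma> (of_real t * ?w)) = exp (- 1 / t - (norm ?w)\<^sup>2 * t)" if "t > 0" for t
    proof -
      \<comment> \<open>At z' = - t Z(\<gamma>) the exponent of X^0 is real and negative; it
        produces the two decay terms of \<open>ray_admissible\<close>.\<close>
      have "Z \<gamma> / (of_real t * ?w) + of_real t * ?w * cnj (Z \<gamma>) = of_real (- 1 / t - (norm ?w)\<^sup>2 * t)"
        using w that by (simp add: complex_norm_square[symmetric] mult.assoc field_simps)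
      then show ?thesis unfolding ray_factor_def by (simp only: norm_exp_eq_Re Re_complex_of_real)
    qed
    then have "norm (tree_f Z (Node \<gamma> M) (of_real t * ?w)) \<le> K * exp (- 1 / t - (norm ?w)\<^sup>2 * t)" if "t > 0" for t
      using mult_right_mono[OF K[OF that], of "exp (- 1 / t - (norm ?w)\<^sup>2 * t)"] that
      by (simp add: norm_mult mult.commute)
    then show ?thesis by blast
  qed
  moreover have "(norm ?w)\<^sup>2 > 0" using w by simp
  ultimately show ?case unfolding ray_admissible_def rtree.sel using w by blast
qed

lemma tree_G_differentiable:
  "T \<in> trees \<Longrightarrow> z \<noteq> 0 \<Longrightarrow> z \<notin> ell Z (rroot T) \<Longrightarrow> tree_G Z T field_differentiable at z"
  unfolding tree_G_eq ell_def by (rule ray_cauchy_differentiable[OF tree_f_admissible])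

lemma finite_msets_bounded: "finite S \<Longrightarrow> finite {M. set_mset M \<subseteq> S \<and> size M \<le> n}"
proof -
  assume "finite S"
  then have "finite (mset ` {xs. set xs \<subseteq> S \<and> length xs \<le> n})"
    by (intro finite_imageI finite_lists_length_le)
  moreover have "{M. set_mset M \<subseteq> S \<and> size M \<le> n} \<subseteq> mset ` {xs. set xs \<subseteq> S \<and> length xs \<le> n}"
  proof
    fix M assume M: "M \<in> {M. set_mset M \<subseteq> S \<and> size M \<le> n}"
    obtain xs where "mset xs = M" using ex_mset by blast
    with M show "M \<in> mset ` {xs. set xs \<subseteq> S \<and> length xs \<le> n}" by (intro image_eqI[of _ _ xs]) auto
  qed
  ultimately show ?thesis by (rule rev_finite_subset)
qed

text \<open>The nonzero root vector uses up one level, so the branches have level k and are finitely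
  many by induction. Each of them has nonzero degree, so no more than k + 1 fit below one
  root.\<close>

lemma finite_trees_le: "finite {T \<in> trees. tree_deg T \<in> basis_le C k}"
proof (induction k)
  case 0
  have "{T \<in> trees. tree_deg T \<in> basis_le C 0} = {}" using trees_deg by (auto simp: basis_le_0)
  then show ?case by (simp only: finite.emptyI)
next
  case (Suc k)
  let ?S = "{T \<in> trees. tree_deg T \<in> basis_le C k}"
  let ?M = "{M. set_mset M \<subseteq> ?S \<and> size M \<le> Suc k}"
  have "finite ((\<lambda>(\<gamma>, M). Node \<gamma> M) ` (basis_le C (Suc k) \<times> ?M))"
    by (intro finite_imageI finite_cartesian_product finite_basis_le finite_msets_bounded Suc)
  moreover have "{T \<in> trees. tree_deg T \<in> basis_le C (Suc k)} \<subseteq> (\<lambda>(\<gamma>, M). Node \<gamma> M) ` (basis_le C (Suc k) \<times> ?M)"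
  proof
    fix T assume T: "T \<in> {T \<in> trees. tree_deg T \<in> basis_le C (Suc k)}"
    obtain \<gamma> M where N: "T = Node \<gamma> M" by (cases T)
    have ch: "T' \<in> trees" "tree_deg T' \<in> C - {0}" if "T' \<in># M" for T'
      using T N that trees_Node trees_deg by auto
    have \<gamma>: "\<gamma> \<in> C" "\<gamma> \<noteq> 0" using T N trees_Node active by auto
    have sum: "(\<Sum>T\<in>#N'. tree_deg T) \<in> C" if "N' \<subseteq># M" for N'
    proof (rule sum_mset_in_cone)
      fix T' assume "T' \<in># N'"
      then have "T' \<in># M" by (rule mset_subset_eqD[OF that])
      then show "tree_deg T' \<in> C" using ch(2) by simp
    qed
    have deg: "\<gamma> + (\<Sum>T\<in>#M. tree_deg T) \<in> basis_le C (Suc k)" using T N by (simp add: tree_deg_Node)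
    have "tree_deg T' \<in> basis_le C k" if T': "T' \<in># M" for T'
    proof -
      have "M = add_mset T' (M - {#T'#})" using T' by simp
      then have "(\<Sum>T\<in>#M. tree_deg T) = tree_deg T' + (\<Sum>T\<in>#M - {#T'#}. tree_deg T)"
        by (metis image_mset_add_mset sum_mset.add_mset)
      moreover have "(\<Sum>T\<in>#M - {#T'#}. tree_deg T) \<in> C" by (rule sum) simp
      ultimately have "tree_deg T' + \<gamma> \<in> basis_le C (Suc k)"
        using basis_le_summand(1)[of "tree_deg T' + \<gamma>" "(\<Sum>T\<in>#M - {#T'#}. tree_deg T)" "Suc k"]
          deg \<gamma> ch[OF T'] add_in_cone by (simp add: ac_simps)
      then show ?thesis using basis_le_proper_summand \<gamma> ch[OF T'] by blast
    qed
    moreover have "size M \<le> Suc k"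
    proof (rule ccontr)
      assume "\<not> size M \<le> Suc k"
      moreover obtain xs where xs: "mset xs = M" using ex_mset by blast
      ultimately have "sum_list (map tree_deg xs) \<in> cone_gt C (Suc k)"
        unfolding cone_gt_def using ch by (intro CollectI exI[of _ "map tree_deg xs"]) auto
      moreover have "sum_list (map tree_deg xs) = (\<Sum>T\<in>#M. tree_deg T)"
        using xs by (metis mset_map sum_mset_sum_list)
      ultimately show False
        using basis_le_summand(2)[OF \<gamma>(1) sum[OF subset_mset.order_refl] deg] by (simp add: basis_le_def)
    qed
    moreover have "\<gamma> \<in> basis_le C (Suc k)" by (rule basis_le_summand(1)[OF \<gamma>(1) sum[OF subset_mset.order_refl] deg])
    ultimately show "T \<in> (\<lambda>(\<gamma>, M). Node \<gamma> M) ` (basis_le C (Suc k) \<times> ?M)"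
      using N ch by (intro image_eqI[of _ _ "(\<gamma>, M)"]) auto
  qed
  ultimately show ?case by (rule rev_finite_subset)
qed

lemma finite_trees: "\<eta> \<in> B \<Longrightarrow> finite {T \<in> trees. tree_deg T = \<eta>}"
proof -
  assume "\<eta> \<in> B"
  then obtain k where "\<eta> \<in> basis_le C k" using hat_obtain by blast
  then show ?thesis by (intro finite_subset[OF _ finite_trees_le[of k]]) auto
qed

text \<open>The logarithm in X(e_\<alpha>), with F left open: it will be the values of the tree
  functions at z, their one-sided limits at a point of a ray, or the constants
  \<open>tree_G0\<close>.\<close>

definition log_coeff :: "('n lat rtree \<Rightarrow> complex) \<Rightarrow> 'n lat \<Rightarrow> 'n ser" where
  "log_coeff F \<alpha> \<eta> = (if \<eta> \<in> B then - (\<Sum>T | T \<in> trees \<and> tree_deg T = \<eta>.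
     of_int (pr \<alpha> (rroot T)) * of_rat (wt T) * F T) else 0)"

lemma log_coeff_add: "log_coeff F (a + b) = (\<lambda>\<eta>. log_coeff F a \<eta> + log_coeff F b \<eta>)"
  by (rule ext) (simp add: log_coeff_def pr_add_left sum.distrib algebra_simps)

lemma log_coeff_0 [simp]: "log_coeff F \<alpha> 0 = 0"
  using trees_deg unfolding log_coeff_def by (auto intro!: sum.neutral)

lemma pr_scale: "pr \<alpha> (int n *s v) = int n * pr \<alpha> v"
proof (induction n)
  case (Suc n)
  have "int (Suc n) *s v = v + int n *s v" by (simp add: vector_sadd_rdistrib)
  then show ?case using Suc by (simp only: pr_add_right) (simp add: algebra_simps)
qed simp

lemma pr_expand: "pr \<alpha> \<gamma> = (\<Sum>i\<in>UNIV. pr \<alpha> (axis i 1) * \<gamma> $ i)"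
proof -
  have add: "Modules.additive (pr \<alpha>)" by (simp add: Modules.additive_def pr_add_right)
  have scale: "pr \<alpha> (k *s v) = k * pr \<alpha> v" for k v
  proof (cases k)
    case (neg n)
    have e: "k *s v = - (of_nat (Suc n) *s v)" by (simp add: neg vec_eq_iff)
    have "pr \<alpha> (k *s v) = - (int (Suc n) * pr \<alpha> v)"
      unfolding e Modules.additive.minus[OF add] pr_scale ..
    then show ?thesis by (simp add: neg algebra_simps)
  qed (use pr_scale in auto)
  have "\<gamma> = (\<Sum>i\<in>UNIV. \<gamma> $ i *s axis i 1)" by (simp add: basis_expansion)
  then have "pr \<alpha> \<gamma> = (\<Sum>i\<in>UNIV. pr \<alpha> (\<gamma> $ i *s axis i 1))" by (metis Modules.additive.sum[OF add])
  then show ?thesis by (simp add: scale mult.commute)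
qed

text \<open>At each exponent only finitely many trees of nonzero weight have that degree, which
  replaces the infinite sum by a finite one. Outside \<open>trees\<close> nothing is known about F',
  and the vanishing weight makes up for it.\<close>

lemma pair_tensor_neg_tree_sum:
  assumes F: "\<And>T. T \<in> trees \<Longrightarrow> F' T = (\<lambda>\<eta>. F T * be C (tree_deg T) \<eta>)"
  shows "pair_tensor pr \<alpha> (neg_tree_sum pr Om F') = log_coeff F \<alpha>"
proof (rule ext)
  fix \<eta>
  have *: "(neg_tree_sum pr Om F' $ i) \<eta> =
      (if \<eta> \<in> B then - (\<Sum>T | T \<in> trees \<and> tree_deg T = \<eta>. of_int (rroot T $ i) * of_rat (wt T) * F T) else 0)" for i
  proof (cases "\<eta> \<in> B")
    case True
    have "(\<Sum>\<^sub>\<infinity>T. of_rat (treeW pr Om T $ i) * F' T \<eta>) =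
        (\<Sum>\<^sub>\<infinity>T\<in>{T \<in> trees. tree_deg T = \<eta>}. of_int (rroot T $ i) * of_rat (wt T) * F T)"
    proof (rule infsum_cong_neutral)
      fix T assume "T \<in> UNIV - {T \<in> trees. tree_deg T = \<eta>}"
      then show "of_rat (treeW pr Om T $ i) * F' T \<eta> = 0"
        by (cases "T \<in> trees") (auto simp: F be_def treeW_eq trees_def)
    qed (use True in \<open>auto simp: F be_def treeW_eq of_rat_mult\<close>)
    then show ?thesis using True finite_trees by (simp add: neg_tree_sum_def)
  next
    case False
    have "of_rat (treeW pr Om T $ i) * F' T \<eta> = 0" for T
      using False by (cases "T \<in> trees") (auto simp: F be_def treeW_eq trees_def)
    then have "(\<Sum>\<^sub>\<infinity>T. of_rat (treeW pr Om T $ i) * F' T \<eta>) = 0" by (intro infsum_0) auto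
    then show ?thesis using False by (simp add: neg_tree_sum_def)
  qed
  have pr: "(of_int (pr \<alpha> \<gamma>) :: complex) = (\<Sum>i\<in>UNIV. of_int (pr \<alpha> (axis i 1)) * of_int (\<gamma> $ i))" for \<gamma>
    by (subst pr_expand) simp
  have "(\<Sum>T | T \<in> trees \<and> tree_deg T = \<eta>. of_int (pr \<alpha> (rroot T)) * of_rat (wt T) * F T) =
      (\<Sum>T | T \<in> trees \<and> tree_deg T = \<eta>. \<Sum>i\<in>UNIV.
        of_int (pr \<alpha> (axis i 1)) * (of_int (rroot T $ i) * of_rat (wt T) * F T))"
    by (intro sum.cong refl, subst pr) (simp add: sum_distrib_right mult.assoc)
  also have "\<dots> = (\<Sum>i\<in>UNIV. of_int (pr \<alpha> (axis i 1)) *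
      (\<Sum>T | T \<in> trees \<and> tree_deg T = \<eta>. of_int (rroot T $ i) * of_rat (wt T) * F T))"
    unfolding sum_distrib_left by (rule sum.swap)
  finally show "pair_tensor pr \<alpha> (neg_tree_sum pr Om F') \<eta> = log_coeff F \<alpha> \<eta>"
    unfolding pair_tensor_def * log_coeff_def by (simp add: sum_negf)
qed

lemma ray_factor_add: "ray_factor Z (a + b) z = ray_factor Z a z * ray_factor Z b z"
  by (simp add: ray_factor_def Z_add exp_add[symmetric] add_divide_distrib algebra_simps)

lemma ray_factor_nz: "ray_factor Z a z \<noteq> 0"
  by (simp add: ray_factor_def)

definition sol :: "('n lat \<Rightarrow> complex) \<Rightarrow> ('n lat rtree \<Rightarrow> complex) \<Rightarrow> 'n ser \<Rightarrow> 'n ser" where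
  "sol c F = twist c (log_coeff F)"

lemma X_sol_eq: "X_sol pr C Om Z z = sol (\<lambda>\<alpha>. ray_factor Z \<alpha> z) (\<lambda>T. tree_G Z T z)"
proof -
  have "X_basis pr C Om Z z = tw_basis (\<lambda>\<alpha>. ray_factor Z \<alpha> z) (log_coeff (\<lambda>T. tree_G Z T z))"
    unfolding X_basis_def tw_basis_def X0_def ray_factor_def
    by (subst pair_tensor_neg_tree_sum[OF treeG_eq[OF trees_subset_cone]]) auto
  then show ?thesis by (simp add: X_sol_def sol_def twist_def)
qed


subsection \<open>Holomorphy and asymptotics\<close>

lemma sol_Aut:
  assumes "\<And>a b. c (a + b) = c a * c b" "\<And>a. c a \<noteq> 0"
  shows "sol c F \<in> Aut_hat C"
  unfolding sol_def by (rule twist_Aut) (simp_all add: assms log_coeff_add)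

lemma log_coeff_tendsto:
  assumes "\<And>T. T \<in> trees \<Longrightarrow> tree_deg T \<in> basis_le C k \<Longrightarrow> ((\<lambda>z. F z T) \<longlongrightarrow> F' T) A"
    and "\<eta> \<in> basis_le C k"
  shows "((\<lambda>z. log_coeff (F z) \<alpha> \<eta>) \<longlongrightarrow> log_coeff F' \<alpha> \<eta>) A"
  unfolding log_coeff_def using assms by (cases "\<eta> \<in> B") (auto intro!: tendsto_intros)

text \<open>Holomorphy is asked only of trees whose root pairs nontrivially with \<alpha>; this is
  what permits crossing the ray of \<alpha>.\<close>

lemma log_coeff_holomorphic:
  assumes "\<And>T. T \<in> trees \<Longrightarrow> tree_deg T \<in> basis_le C k \<Longrightarrow> pr \<alpha> (rroot T) \<noteq> 0 \<Longrightarrow>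
      (\<lambda>z. F z T) holomorphic_on S"
    and "\<eta> \<in> basis_le C k"
  shows "(\<lambda>z. log_coeff (F z) \<alpha> \<eta>) holomorphic_on S"
proof -
  have "(\<lambda>z. of_int (pr \<alpha> (rroot T)) * of_rat (wt T) * F z T) holomorphic_on S"
    if "T \<in> trees" "tree_deg T = \<eta>" for T
  proof (cases "pr \<alpha> (rroot T) = 0")
    case False
    then show ?thesis using assms that by (intro holomorphic_intros) auto
  qed simp
  then show ?thesis
    unfolding log_coeff_def by (cases "\<eta> \<in> B") (auto intro!: holomorphic_on_minus holomorphic_on_sum)
qed

lemma tw_basis_tendsto:
  assumes "\<And>T. T \<in> trees \<Longrightarrow> tree_deg T \<in> basis_le C k \<Longrightarrow> ((\<lambda>z. F z T) \<longlongrightarrow> F' T) A"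
    and "((\<lambda>z. c z \<alpha>) \<longlongrightarrow> c' \<alpha>) A" and \<gamma>: "\<gamma> \<in> basis_le C k"
  shows "((\<lambda>z. tw_basis (c z) (log_coeff (F z)) \<alpha> \<gamma>) \<longlongrightarrow> tw_basis c' (log_coeff F') \<alpha> \<gamma>) A"
proof (cases "\<alpha> \<in> B \<and> \<gamma> \<in> B \<and> \<gamma> - \<alpha> \<in> B")
  case True
  then have "\<gamma> - \<alpha> \<in> basis_le C k"
    using basis_le_summand(2)[of \<alpha> "\<gamma> - \<alpha>" k] \<gamma> hat_subset_cone by simp
  then show ?thesis unfolding tw_basis_eq if_P[OF True]
    by (intro tendsto_mult assms(2) tendsto_hexp[of k] log_coeff_tendsto[OF assms(1)]) auto
next
  case False
  then show ?thesis unfolding tw_basis_eq if_not_P[OF False] by simp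
qed

lemma tw_basis_holomorphic:
  assumes "\<And>T. T \<in> trees \<Longrightarrow> tree_deg T \<in> basis_le C k \<Longrightarrow> pr \<alpha> (rroot T) \<noteq> 0 \<Longrightarrow>
      (\<lambda>z. F z T) holomorphic_on S"
    and "(\<lambda>z. c z \<alpha>) holomorphic_on S" and \<gamma>: "\<gamma> \<in> basis_le C k"
  shows "(\<lambda>z. tw_basis (c z) (log_coeff (F z)) \<alpha> \<gamma>) holomorphic_on S"
proof (cases "\<alpha> \<in> B \<and> \<gamma> \<in> B \<and> \<gamma> - \<alpha> \<in> B")
  case True
  then have "\<gamma> - \<alpha> \<in> basis_le C k"
    using basis_le_summand(2)[of \<alpha> "\<gamma> - \<alpha>" k] \<gamma> hat_subset_cone by simp
  then show ?thesis unfolding tw_basis_eq if_P[OF True]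
    by (intro holomorphic_on_mult assms(2) holomorphic_on_hexp[of k] log_coeff_holomorphic[OF assms(1)]) auto
next
  case False
  then show ?thesis unfolding tw_basis_eq if_not_P[OF False] by simp
qed

lemma sol_eq_sum:
  "\<eta> \<in> basis_le C k \<Longrightarrow> sol c F x \<eta> = (\<Sum>\<alpha>\<in>basis_le C k. x \<alpha> * tw_basis c (log_coeff F) \<alpha> \<eta>)"
  unfolding sol_def by (rule twist_eq_sum)

lemma sol_tendsto:
  assumes "\<And>T. T \<in> trees \<Longrightarrow> tree_deg T \<in> basis_le C k \<Longrightarrow> ((\<lambda>z. F z T) \<longlongrightarrow> F' T) A"
    and "\<And>\<alpha>. ((\<lambda>z. c z \<alpha>) \<longlongrightarrow> c' \<alpha>) A" and "\<gamma> \<in> basis_le C k"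
  shows "((\<lambda>z. sol (c z) (F z) x \<gamma>) \<longlongrightarrow> sol c' F' x \<gamma>) A"
  unfolding sol_eq_sum[OF assms(3)]
  by (intro tendsto_sum tendsto_mult tendsto_const tw_basis_tendsto[OF assms(1,2) assms(3)])

lemma X_sol_Aut: "X_sol pr C Om Z z \<in> Aut_hat C"
  unfolding X_sol_eq by (rule sol_Aut) (auto simp: ray_factor_add ray_factor_nz)

lemma ray_factor_holomorphic: "0 \<notin> S \<Longrightarrow> ray_factor Z \<alpha> holomorphic_on S"
  unfolding ray_factor_def by (intro holomorphic_intros) auto

lemma tree_G_holomorphic:
  assumes "T \<in> trees" "0 \<notin> S" "S \<inter> ell Z (rroot T) = {}"
  shows "tree_G Z T holomorphic_on S"
  unfolding holomorphic_on_def
  using assms tree_G_differentiable field_differentiable_at_within by (metis IntI empty_iff)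

lemma X_sol_holomorphic:
  assumes "\<gamma> \<in> basis_le C k"
  shows "(\<lambda>z. X_sol pr C Om Z z x \<gamma>) holomorphic_on off_rays Om Z (basis_le C k)"
proof -
  have "tree_G Z T holomorphic_on off_rays Om Z (basis_le C k)"
    if "T \<in> trees" "tree_deg T \<in> basis_le C k" for T
    using that root_basis_le trees_root by (intro tree_G_holomorphic) (auto simp: off_rays_def)
  then show ?thesis unfolding X_sol_eq sol_eq_sum[OF assms]
    by (intro holomorphic_on_sum holomorphic_on_mult holomorphic_on_const
        tw_basis_holomorphic[OF _ _ assms] ray_factor_holomorphic) (auto simp: off_rays_def)
qed

text \<open>For fixed k only finitely many rays have to be avoided, which leaves an open set around
  the ray of \<alpha>; this set depends on k. Trees rooted on that ray have coefficient zero in the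
  logarithm.\<close>

lemma X_sol_extends:
  assumes \<alpha>: "Z \<alpha> \<noteq> 0" "\<forall>\<gamma>. DT Om \<gamma> \<noteq> 0 \<and> ell Z \<gamma> = ell Z \<alpha> \<longrightarrow> pr \<gamma> \<alpha> = 0"
  shows "\<exists>U. open U \<and> ell Z \<alpha> \<subseteq> U \<and>
    (\<forall>\<gamma>\<in>basis_le C k. (\<lambda>z. X_sol pr C Om Z z (be C \<alpha>) \<gamma>) holomorphic_on U)"
proof -
  define R where "R = {\<gamma> \<in> basis_le C k. DT Om \<gamma> \<noteq> 0 \<and> ell Z \<gamma> \<noteq> ell Z \<alpha>}"
  define U where "U = - (\<Union>\<gamma>\<in>R. insert 0 (ell Z \<gamma>)) - {0}"
  have "finite R" unfolding R_def using finite_basis_le by simp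
  then have "open U" unfolding U_def ell_def
    by (intro open_Diff open_Compl closed_UN) (auto simp: closed_ray_0)
  moreover have "ell Z \<alpha> \<subseteq> U"
  proof
    fix z assume z: "z \<in> ell Z \<alpha>"
    then have "z \<noteq> 0" using \<alpha>(1) by (auto simp: ell_def ray_def)
    moreover have "z \<notin> ell Z \<gamma>" if "\<gamma> \<in> R" for \<gamma>
    proof
      assume "z \<in> ell Z \<gamma>"
      then have "ell Z \<gamma> = ell Z \<alpha>" using z ray_ray unfolding ell_def by metis
      then show False using that by (simp add: R_def)
    qed
    ultimately show "z \<in> U" by (auto simp: U_def)
  qed
  moreover have "(\<lambda>z. X_sol pr C Om Z z (be C \<alpha>) \<gamma>) holomorphic_on U" if \<gamma>: "\<gamma> \<in> basis_le C k" for \<gamma>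
  proof -
    have "tree_G Z T holomorphic_on U"
      if T: "T \<in> trees" "tree_deg T \<in> basis_le C k" "pr \<alpha> (rroot T) \<noteq> 0" for T
    proof (rule tree_G_holomorphic)
      have "rroot T \<in> R"
        unfolding R_def using T trees_root root_basis_le \<alpha>(2) pr_skew[of \<alpha> "rroot T"] by auto
      then show "U \<inter> ell Z (rroot T) = {}" unfolding U_def by blast
    qed (use T in \<open>auto simp: U_def\<close>)
    then show ?thesis unfolding X_sol_eq sol_def twist_be
      by (intro tw_basis_holomorphic[OF _ _ \<gamma>] ray_factor_holomorphic) (auto simp: U_def)
  qed
  ultimately show ?thesis by blast
qed

definition asymptotic :: "'n ser \<Rightarrow> 'n ser" where
  "asymptotic = sol (\<lambda>_. 1) (tree_G0 Z)"

lemma asymptotic_be: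
  "asymptotic (be C \<alpha>) = hmult C (be C \<alpha>) (hexp C (pair_tensor pr \<alpha> (neg_tree_sum pr Om (treeG0 C Z))))"
  unfolding asymptotic_def sol_def twist_be tw_basis_def
  by (subst pair_tensor_neg_tree_sum[OF treeG0_eq[OF trees_subset_cone]]) auto

lemma X_sol_asymptotic:
  assumes u: "u \<in> off_rays Om Z (basis_le C k)" "norm u = 1" and \<gamma>: "\<gamma> \<in> basis_le C k"
  shows "((\<lambda>z. X_sol pr C Om Z z (exp_Z Z (- 1 / z) x) \<gamma>) \<longlongrightarrow> asymptotic x \<gamma>) (at_0_dir u)"
proof -
  \<comment> \<open>The twist by e^(-Z/z) cancels the essential singularity of X^0 and leaves a
    factor that tends to 1.\<close>
  have "exp (- 1 / z * Z \<alpha>) * ray_factor Z \<alpha> z = exp (z * cnj (Z \<alpha>))" for z \<alpha>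
    unfolding ray_factor_def exp_add[symmetric] by (simp add: algebra_simps)
  then have eq: "X_sol pr C Om Z z (exp_Z Z (- 1 / z) x) \<gamma> =
      sol (\<lambda>\<alpha>. exp (z * cnj (Z \<alpha>))) (\<lambda>T. tree_G Z T z) x \<gamma>" for z
    unfolding X_sol_eq sol_eq_sum[OF \<gamma>] exp_Z_def
    by (intro sum.cong refl) (simp add: tw_basis_eq mult_ac)
  have "((\<lambda>z. exp (z * cnj (Z \<alpha>))) \<longlongrightarrow> exp (0 * cnj (Z \<alpha>))) (at 0)" for \<alpha>
    by (intro tendsto_intros)
  then have "((\<lambda>z. exp (z * cnj (Z \<alpha>))) \<longlongrightarrow> 1) (at_0_dir u)" for \<alpha>
    unfolding at_0_dir_def by (intro tendsto_mono[OF inf_le1]) simp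
  moreover have "((\<lambda>z. tree_G Z T z) \<longlongrightarrow> tree_G0 Z T) (at_0_dir u)"
    if "T \<in> trees" "tree_deg T \<in> basis_le C k" for T
  proof -
    have "u \<notin> ray (- Z (rroot T))"
      using u(1) root_basis_le[OF that] trees_root[OF that(1)] by (auto simp: off_rays_def ell_def)
    then show ?thesis unfolding tree_G_eq tree_G0_def
      by (rule ray_cauchy_at_0_dir[OF tree_f_admissible[OF that(1)] u(2)])
  qed
  ultimately show ?thesis unfolding eq asymptotic_def by (intro sol_tendsto[OF _ _ \<gamma>])
qed

text \<open>Removing the root \<gamma> turns the trees into multisets of branches, weighted as in
  \<open>hexp_sum_msets\<close>. F is prescribed only off the ray through z0: trees rooted on this
  ray pair trivially with \<gamma> by genericity. Hence F may be either one-sided limit.\<close>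

lemma trees_by_root:
  assumes \<gamma>: "DT Om \<gamma> \<noteq> 0" "z0 \<in> ell Z \<gamma>" and \<eta>: "\<eta> \<in> B"
    and F: "\<And>T. T \<in> trees \<Longrightarrow> z0 \<notin> ell Z (rroot T) \<Longrightarrow> F T = tree_G Z T z0"
  shows "(\<Sum>T | T \<in> trees \<and> tree_deg T = \<eta> \<and> rroot T = \<gamma>. of_rat (wt T) * tree_f Z T z0) =
    of_rat (DT Om \<gamma>) * tw_basis (\<lambda>\<alpha>. ray_factor Z \<alpha> z0) (log_coeff F) \<gamma> \<eta>"
proof -
  let ?M = "{M. Node \<gamma> M \<in> trees \<and> (\<Sum>T\<in>#M. tree_deg T) = \<eta> - \<gamma>}"
  let ?d = "\<lambda>T. - (of_int (pr \<gamma> (rroot T)) * of_rat (wt T) * F T)"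
  have "{T. T \<in> trees \<and> tree_deg T = \<eta> \<and> rroot T = \<gamma>} = Node \<gamma> ` ?M"
  proof (intro equalityI subsetI)
    fix T assume "T \<in> {T. T \<in> trees \<and> tree_deg T = \<eta> \<and> rroot T = \<gamma>}"
    then show "T \<in> Node \<gamma> ` ?M" by (cases T) (auto simp: tree_deg_Node)
  qed (auto simp: tree_deg_Node)
  then have "(\<Sum>T | T \<in> trees \<and> tree_deg T = \<eta> \<and> rroot T = \<gamma>. of_rat (wt T) * tree_f Z T z0) =
      (\<Sum>M\<in>?M. of_rat (wt (Node \<gamma> M)) * tree_f Z (Node \<gamma> M) z0)"
    by (simp add: sum.reindex inj_on_def)
  also have "\<dots> = (\<Sum>M\<in>?M. of_rat (DT Om \<gamma>) * ray_factor Z \<gamma> z0 * ((\<Prod>T\<in>#M. ?d T) / of_nat (mfact M)))"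
  proof (rule sum.cong)
    fix M assume "M \<in> ?M"
    then have ch: "T \<in> trees" "pr (rroot T) \<gamma> \<noteq> 0" if "T \<in># M" for T using that trees_Node by auto
    have "?d T = of_rat (wt T) * of_int (pr (rroot T) \<gamma>) * tree_G Z T z0" if "T \<in># M" for T
    proof -
      \<comment> \<open>A branch pairs nontrivially with \<gamma>, whose ray passes through z0, so
        its own ray does not.\<close>
      have "z0 \<notin> ell Z (rroot T)"
        using distinct_rays[of \<gamma> "rroot T" z0] \<gamma> ch[OF that] trees_root pr_skew[of \<gamma> "rroot T"] by auto
      then show ?thesis using F ch(1)[OF that] pr_skew[of \<gamma> "rroot T"] by simp
    qed
    then have "(\<Prod>T\<in>#M. ?d T) = (\<Prod>T\<in>#M. of_rat (wt T) * of_int (pr (rroot T) \<gamma>) * tree_G Z T z0)"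
      by (intro arg_cong[where f = prod_mset] image_mset_cong)
    also have "\<dots> = of_rat (\<Prod>T\<in>#M. wt T * of_int (pr (rroot T) \<gamma>)) * (\<Prod>T\<in>#M. tree_G Z T z0)"
      by (induction M) (simp_all add: of_rat_mult mult_ac)
    finally show "of_rat (wt (Node \<gamma> M)) * tree_f Z (Node \<gamma> M) z0 =
        of_rat (DT Om \<gamma>) * ray_factor Z \<gamma> z0 * ((\<Prod>T\<in>#M. ?d T) / of_nat (mfact M))"
      by (simp add: tree_weight_Node of_rat_mult of_rat_divide)
  qed simp
  also have "\<dots> = of_rat (DT Om \<gamma>) * tw_basis (\<lambda>\<alpha>. ray_factor Z \<alpha> z0) (log_coeff F) \<gamma> \<eta>"
  proof (cases "\<eta> - \<gamma> \<in> B \<and> \<gamma> \<in> B")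
    case True
    let ?A = "msets trees tree_deg (\<eta> - \<gamma>)"
    have A: "?A = {M. set_mset M \<subseteq> trees \<and> (\<Sum>T\<in>#M. tree_deg T) = \<eta> - \<gamma>}"
      by (rule msets_def[OF trees_deg finite_trees])
    \<comment> \<open>The exponential runs over all multisets of trees; those with a member pairing
      trivially with \<gamma> are not branches of a tree in \<open>trees\<close>, but contribute
      zero.\<close>
    have "(\<Sum>M\<in>?M. (\<Prod>T\<in>#M. ?d T) / of_nat (mfact M)) = (\<Sum>M\<in>?A. (\<Prod>T\<in>#M. ?d T) / of_nat (mfact M))"
    proof (rule sum.mono_neutral_left)
      show "finite ?A" by (rule finite_msets[OF trees_deg finite_trees]) (use True in auto)
      show "?M \<subseteq> ?A" unfolding A using trees_Node by auto
      show "\<forall>M\<in>?A - ?M. (\<Prod>T\<in>#M. ?d T) / of_nat (mfact M) = 0"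
      proof
        fix M assume "M \<in> ?A - ?M"
        then have "\<exists>T\<in>#M. pr (rroot T) \<gamma> = 0" unfolding A using trees_Node \<gamma>(1) by auto
        then have "\<exists>T\<in>#M. ?d T = 0" using pr_skew[of \<gamma>] by force
        then show "(\<Prod>T\<in>#M. ?d T) / of_nat (mfact M) = 0" by (simp add: prod_mset_zero_iff image_iff)
      qed
    qed
    also have "\<dots> = hexp C (\<lambda>\<eta>. if \<eta> \<in> B then \<Sum>T\<in>{T \<in> trees. tree_deg T = \<eta>}. ?d T else 0) (\<eta> - \<gamma>)"
      by (rule hexp_sum_msets[OF trees_deg finite_trees, symmetric]) (use True in auto)
    also have "(\<lambda>\<eta>. if \<eta> \<in> B then \<Sum>T\<in>{T \<in> trees. tree_deg T = \<eta>}. ?d T else 0) = log_coeff F \<gamma>"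
      by (rule ext) (simp add: log_coeff_def sum_negf)
    finally have *: "(\<Sum>M\<in>?M. (\<Prod>T\<in>#M. ?d T) / of_nat (mfact M)) = hexp C (log_coeff F \<gamma>) (\<eta> - \<gamma>)" .
    show ?thesis unfolding sum_distrib_left[symmetric] * using True \<eta> by (simp add: tw_basis_eq mult.assoc)
  next
    case False
    have "?M = {}"
    proof (rule ccontr)
      assume "?M \<noteq> {}"
      then obtain M where M: "Node \<gamma> M \<in> trees" "(\<Sum>T\<in>#M. tree_deg T) = \<eta> - \<gamma>" by blast
      have "(\<Sum>T\<in>#M. tree_deg T) \<in> C"
      proof (rule sum_mset_in_cone)
        fix T assume "T \<in># M"
        then have "T \<in> trees" using M trees_Node by blast
        then show "tree_deg T \<in> C" using trees_deg by blast
      qed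
      then show False using False hat_summand[of \<gamma> "\<eta> - \<gamma>"] \<eta> active(1)[OF \<gamma>(1)] M(2) by simp
    qed
    then show ?thesis using False by (simp only: sum.empty) (auto simp: tw_basis_eq)
  qed
  finally show ?thesis .
qed


subsection \<open>The jump across a ray\<close>

lemma Z_scale: "Z (int n *s v) = of_nat n * Z v"
proof (induction n)
  case (Suc n)
  have "int (Suc n) *s v = v + int n *s v" by (simp add: vector_sadd_rdistrib)
  then show ?case using Suc by (simp only: Z_add) (simp add: algebra_simps)
qed simp

section \<open>From the numbers Omega to DT: the logarithm of the Stokes factor\<close>

definition divisors :: "'n lat \<Rightarrow> nat set" where
  "divisors \<gamma> = {n. n \<ge> 1 \<and> (\<forall>i. int n dvd \<gamma> $ i)}"

definition quot :: "'n lat \<Rightarrow> nat \<Rightarrow> 'n lat" where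
  "quot \<gamma> n = (\<chi> i. \<gamma> $ i div int n)"

lemma quot_scale: "n \<in> divisors \<gamma> \<Longrightarrow> int n *s quot \<gamma> n = \<gamma>"
  by (auto simp: divisors_def quot_def vec_eq_iff)

lemma divisors_scale: "n \<ge> 1 \<Longrightarrow> n \<in> divisors (int n *s \<gamma>) \<and> quot (int n *s \<gamma>) n = \<gamma>"
  by (auto simp: divisors_def quot_def vec_eq_iff)

lemma finite_divisors:
  assumes "\<gamma> \<noteq> 0" shows "finite (divisors \<gamma>)"
proof -
  obtain i where i: "\<gamma> $ i \<noteq> 0" using assms by (auto simp: vec_eq_iff)
  have "divisors \<gamma> \<subseteq> {..nat \<bar>\<gamma> $ i\<bar>}"
  proof
    fix n assume "n \<in> divisors \<gamma>"
    then have "int n \<le> \<bar>\<gamma> $ i\<bar>" using zdvd_imp_le[of "int n" "\<bar>\<gamma> $ i\<bar>"] i by (auto simp: divisors_def)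
    then show "n \<in> {..nat \<bar>\<gamma> $ i\<bar>}" by auto
  qed
  then show ?thesis by (rule finite_subset) simp
qed

lemma DT_eq: "\<gamma> \<noteq> 0 \<Longrightarrow> DT Om \<gamma> = (\<Sum>n\<in>divisors \<gamma>. Om (quot \<gamma> n) / (of_nat n)\<^sup>2)"
  by (simp add: DT_def divisors_def quot_def)

lemma scale_in_cone: "\<gamma> \<in> C \<Longrightarrow> int n *s \<gamma> \<in> C"
  using hpow_be by blast

text \<open>Inversion of the divisor sum by induction on the sum of the absolute coordinates. For n
  \<ge> 2 the vector \<gamma> / n is shorter and again outside the cone, as the cone is closed under
  multiples; so DT(\<gamma>) = 0 reduces to the term n = 1.\<close>

lemma Om_outside_cone:
  assumes "\<gamma> \<notin> C" shows "Om \<gamma> = 0"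
  using assms
proof (induction "nat (\<Sum>i\<in>UNIV. \<bar>\<gamma> $ i\<bar>)" arbitrary: \<gamma> rule: less_induct)
  case less
  have nz: "\<gamma> \<noteq> 0" using less.prems by auto
  have 1: "1 \<in> divisors \<gamma>" "quot \<gamma> 1 = \<gamma>" by (auto simp: divisors_def quot_def vec_eq_iff)
  have "Om (quot \<gamma> n) = 0" if n: "n \<in> divisors \<gamma>" "n \<noteq> 1" for n
  proof (rule less.hyps)
    let ?q = "quot \<gamma> n"
    have \<gamma>: "\<gamma> = int n *s ?q" and n2: "n \<ge> 2" using quot_scale n by (auto simp: divisors_def)
    show "?q \<notin> C" using scale_in_cone[of ?q n] less.prems \<gamma> by auto
    have "(\<Sum>i\<in>UNIV. \<bar>\<gamma> $ i\<bar>) = int n * (\<Sum>i\<in>UNIV. \<bar>?q $ i\<bar>)"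
      by (subst \<gamma>) (simp add: abs_mult sum_distrib_left)
    moreover have "(\<Sum>i\<in>UNIV. \<bar>?q $ i\<bar>) > 0"
    proof -
      have "?q \<noteq> 0" using \<gamma> nz by auto
      then obtain i where "?q $ i \<noteq> 0" by (auto simp: vec_eq_iff)
      then show ?thesis by (intro sum_pos2[of _ i]) auto
    qed
    ultimately have "(\<Sum>i\<in>UNIV. \<bar>?q $ i\<bar>) < (\<Sum>i\<in>UNIV. \<bar>\<gamma> $ i\<bar>)"
      using n2 mult_strict_right_mono[of 1 "int n" "\<Sum>i\<in>UNIV. \<bar>?q $ i\<bar>"] by simp
    then show "nat (\<Sum>i\<in>UNIV. \<bar>?q $ i\<bar>) < nat (\<Sum>i\<in>UNIV. \<bar>\<gamma> $ i\<bar>)"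
      using \<open>(\<Sum>i\<in>UNIV. \<bar>?q $ i\<bar>) > 0\<close> by simp
  qed
  then have "DT Om \<gamma> = Om \<gamma>"
    unfolding DT_eq[OF nz] sum.remove[OF finite_divisors[OF nz] 1(1)] 1(2) by simp
  moreover have "DT Om \<gamma> = 0" using pos less.prems by (auto simp: positive_data_def)
  ultimately show ?case by simp
qed

text \<open>The logarithm of the Stokes factor of l: the series of all factors on the ray, collected
  by exponent.\<close>

definition log_AdS :: "complex set \<Rightarrow> 'n lat \<Rightarrow> 'n ser" where
  "log_AdS l \<alpha> \<eta> = (if \<eta> \<in> B \<and> - Z \<eta> \<in> l then of_rat (DT Om \<eta>) * of_int (pr \<alpha> \<eta>) else 0)"

definition log_factor :: "'n lat \<Rightarrow> 'n lat \<Rightarrow> 'n ser" where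
  "log_factor \<alpha> \<gamma> \<eta> = (if \<eta> \<in> B then
     \<Sum>n | n \<ge> 1 \<and> \<eta> = int n *s \<gamma>. - of_rat (Om \<gamma> * of_int (pr \<gamma> \<alpha>)) / of_nat n else 0)"

lemma log_factor_0: "\<gamma> \<noteq> 0 \<Longrightarrow> log_factor \<alpha> \<gamma> 0 = 0"
  using scale_inj[of \<gamma> 0] by (auto simp: log_factor_def intro!: sum.neutral)

lemma hprod_log_factors:
  assumes "finite S" "S \<subseteq> C - {0}"
  shows "hprod_mset C (image_mset (\<lambda>\<gamma>. hone_minus_pow C (be C \<gamma>) (of_rat (Om \<gamma> * of_int (pr \<gamma> \<alpha>)))) (mset_set S)) =
    hexp C (\<lambda>\<eta>. \<Sum>\<gamma>\<in>S. log_factor \<alpha> \<gamma> \<eta>)"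
  using assms
proof (induction S)
  case (insert \<gamma> S)
  have "hone_minus_pow C (be C \<gamma>) (of_rat (Om \<gamma> * of_int (pr \<gamma> \<alpha>))) = hexp C (log_factor \<alpha> \<gamma>)"
    using insert.prems hone_minus_pow_be[of \<gamma>] unfolding log_factor_def[abs_def] by simp
  moreover have "(\<Sum>\<gamma>\<in>S. log_factor \<alpha> \<gamma> 0) = 0"
    using insert.prems by (intro sum.neutral ballI log_factor_0) auto
  ultimately show ?case
    using insert log_factor_0[of \<gamma> \<alpha>] by (simp add: hexp_add)
qed (simp add: hexp_zero)

text \<open>The origin of the n^2 in DT: for \<eta> = n \<gamma> one factor 1 / n comes from the
  series of the logarithm, the other from \<langle>\<alpha>, \<gamma>\<rangle> = \<langle>\<alpha>,
  \<eta>\<rangle> / n. Skew-symmetry absorbs the sign.\<close>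

lemma sum_log_factors:
  assumes l: "l = ray w" "w \<noteq> 0" and \<eta>: "\<eta> \<in> basis_le C k"
  shows "(\<Sum>\<gamma> | \<gamma> \<in> basis_le C k \<and> - Z \<gamma> \<in> l. log_factor \<alpha> \<gamma> \<eta>) = log_AdS l \<alpha> \<eta>"
proof (cases "\<eta> = 0")
  case True
  have "0 \<notin> l" using l by (auto simp: ray_def)
  then have "\<gamma> \<noteq> 0" if "- Z \<gamma> \<in> l" for \<gamma> using that by auto
  then show ?thesis using True \<open>0 \<notin> l\<close> by (auto simp: log_AdS_def log_factor_0 intro!: sum.neutral)
next
  case False
  let ?S = "{\<gamma>. \<gamma> \<in> basis_le C k \<and> - Z \<gamma> \<in> l}"
  let ?t = "\<lambda>\<gamma> n. - of_rat (Om \<gamma> * of_int (pr \<gamma> \<alpha>)) / of_nat n :: complex"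
  have \<eta>B: "\<eta> \<in> B" "\<eta> \<in> C" using \<eta> basis_le_subset_hat hat_subset_cone by auto
  have Zl: "- Z \<eta> \<in> l \<longleftrightarrow> - Z \<gamma> \<in> l" if "n \<ge> 1" "\<eta> = int n *s \<gamma>" for n \<gamma>
  proof -
    have "- Z \<eta> = of_real (real n) * (- Z \<gamma>)" by (simp add: that(2) Z_scale)
    then have "- Z \<eta> \<in> ray (- Z \<gamma>)" using in_ray[of "real n" "- Z \<gamma>"] that(1) by simp
    then have "ray (- Z \<eta>) = ray (- Z \<gamma>)" by (rule ray_ray)
    then show ?thesis unfolding l using ray_ray self_in_ray by metis
  qed
  have fin: "finite {n. n \<ge> 1 \<and> \<eta> = int n *s \<gamma>}" for \<gamma>
    by (rule finite_subset[OF _ finite_divisors[OF False]]) (auto simp: divisors_def)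
  have "(\<Sum>\<gamma>\<in>?S. log_factor \<alpha> \<gamma> \<eta>) = (\<Sum>(\<gamma>, n)\<in>Sigma ?S (\<lambda>\<gamma>. {n. n \<ge> 1 \<and> \<eta> = int n *s \<gamma>}). ?t \<gamma> n)"
    unfolding log_factor_def if_P[OF \<eta>B(1)] by (rule sum.Sigma) (use finite_basis_le fin in auto)
  \<comment> \<open>A factor \<gamma> contributes to \<eta> only as \<gamma> = \<eta> / n, so n
    alone determines the term.\<close>
  also have "\<dots> = (\<Sum>n | n \<in> divisors \<eta> \<and> quot \<eta> n \<in> ?S. ?t (quot \<eta> n) n)"
    by (rule sum.reindex_bij_witness[of _ "\<lambda>n. (quot \<eta> n, n)" snd])
      (auto simp: quot_scale divisors_scale dest: divisors_scale, auto simp: divisors_def)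
  also have "\<dots> = (if - Z \<eta> \<in> l then \<Sum>n\<in>divisors \<eta>. ?t (quot \<eta> n) n else 0)"
  proof (cases "- Z \<eta> \<in> l")
    case True
    have "(\<Sum>n | n \<in> divisors \<eta> \<and> quot \<eta> n \<in> ?S. ?t (quot \<eta> n) n) = (\<Sum>n\<in>divisors \<eta>. ?t (quot \<eta> n) n)"
    proof (rule sum.mono_neutral_left)
      show "\<forall>n\<in>divisors \<eta> - {n. n \<in> divisors \<eta> \<and> quot \<eta> n \<in> ?S}. ?t (quot \<eta> n) n = 0"
      proof
        fix n assume n: "n \<in> divisors \<eta> - {n. n \<in> divisors \<eta> \<and> quot \<eta> n \<in> ?S}"
        then have n1: "n \<ge> 1" "\<eta> = int n *s quot \<eta> n" using quot_scale[of n \<eta>] by (auto simp: divisors_def)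
        \<comment> \<open>A quotient inside the cone would be a summand of \<eta>, hence of level k
          and on the same ray. The missing divisors thus have Omega equal to 0.\<close>
        have "quot \<eta> n \<notin> C"
        proof
          assume q: "quot \<eta> n \<in> C"
          have "\<eta> = quot \<eta> n + int (n - 1) *s quot \<eta> n"
            using n1 by (simp add: of_nat_diff vec_eq_iff algebra_simps)
          then have "quot \<eta> n \<in> basis_le C k"
            using basis_le_summand(1)[OF q scale_in_cone[OF q, of "n - 1"]] \<eta> by metis
          then show False using n Zl[OF n1] True by auto
        qed
        then show "?t (quot \<eta> n) n = 0" by (simp add: Om_outside_cone)
      qed
    qed (use finite_divisors[OF False] in auto)
    then show ?thesis using True by simp
  next
    case F: False
    have "- Z (quot \<eta> n) \<notin> l" if "n \<in> divisors \<eta>" for n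
      using F Zl[of n "quot \<eta> n"] quot_scale[OF that] that by (simp add: divisors_def)
    then have "{n. n \<in> divisors \<eta> \<and> quot \<eta> n \<in> ?S} = {}" by blast
    then show ?thesis using F by (simp only: sum.empty if_False)
  qed
  also have "\<dots> = log_AdS l \<alpha> \<eta>"
  proof -
    have "?t (quot \<eta> n) n = of_rat (Om (quot \<eta> n) / (of_nat n)\<^sup>2) * of_int (pr \<alpha> \<eta>)" if "n \<in> divisors \<eta>" for n
    proof -
      have "pr \<alpha> \<eta> = int n * pr \<alpha> (quot \<eta> n)" using pr_scale[of \<alpha> n "quot \<eta> n"] quot_scale[OF that] by simp
      moreover have "n \<noteq> 0" using that by (auto simp: divisors_def)
      ultimately show ?thesis using pr_skew[of "quot \<eta> n" \<alpha>]
        by (simp add: of_rat_mult of_rat_minus of_rat_divide of_rat_power power2_eq_square field_simps)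
    qed
    then have "(\<Sum>n\<in>divisors \<eta>. ?t (quot \<eta> n) n) = of_rat (DT Om \<eta>) * of_int (pr \<alpha> \<eta>)"
      by (simp add: DT_eq[OF False] of_rat_sum sum_distrib_right)
    then show ?thesis using \<eta>B by (simp add: log_AdS_def)
  qed
  finally show ?thesis by simp
qed

lemma log_AdS_0: "w \<noteq> 0 \<Longrightarrow> log_AdS (ray w) \<alpha> 0 = 0"
  by (auto simp: log_AdS_def DT_def)

lemma AdS_eq:
  assumes "w \<noteq> 0"
  shows "AdS pr C Om Z (ray w) = twist (\<lambda>_. 1) (log_AdS (ray w))"
proof -
  let ?l = "ray w"
  let ?P = "\<lambda>\<alpha> k. hprod_mset C (image_mset (\<lambda>\<gamma>. hone_minus_pow C (be C \<gamma>) (of_rat (Om \<gamma> * of_int (pr \<gamma> \<alpha>))))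
    (mset_set {\<gamma> \<in> basis_le C k. - Z \<gamma> \<in> ?l}))"
  have P: "?P \<alpha> k = hexp C (\<lambda>\<eta>. \<Sum>\<gamma> | \<gamma> \<in> basis_le C k \<and> - Z \<gamma> \<in> ?l. log_factor \<alpha> \<gamma> \<eta>)" for \<alpha> k
  proof (rule hprod_log_factors)
    have "0 \<notin> ?l" using assms by (auto simp: ray_def)
    then show "{\<gamma> \<in> basis_le C k. - Z \<gamma> \<in> ?l} \<subseteq> C - {0}"
      using basis_le_subset_hat hat_subset_cone by auto
  qed (use finite_basis_le in simp)
  have "lim (\<lambda>k. ?P \<alpha> k \<eta>) = hexp C (log_AdS ?l \<alpha>) \<eta>" for \<alpha> \<eta>
  proof (cases "\<eta> \<in> B")
    case True
    then obtain k0 where k0: "\<eta> \<in> basis_le C k0" using hat_obtain by blast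
    \<comment> \<open>From the level of \<eta> on the finite product no longer changes at \<eta>, so
      the limit in \<open>AdS_basis\<close> is its stable value.\<close>
    have "?P \<alpha> k \<eta> = hexp C (log_AdS ?l \<alpha>) \<eta>" if "k \<ge> k0" for k
      unfolding P using k0 basis_le_mono[OF that]
      by (intro hexp_cong[of k] sum_log_factors[OF refl assms]) auto
    then have "(\<lambda>k. ?P \<alpha> k \<eta>) \<longlonglongrightarrow> hexp C (log_AdS ?l \<alpha>) \<eta>"
      by (intro tendsto_eventually eventually_sequentiallyI[of k0]) auto
    then show ?thesis by (rule limI)
  next
    case False
    then show ?thesis unfolding P by (simp add: ghat_D limI)
  qed
  then have "AdS_basis pr C Om Z ?l = tw_basis (\<lambda>_. 1) (log_AdS ?l)"
    by (intro ext) (simp add: AdS_basis_def tw_basis_def)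
  then show ?thesis by (simp add: AdS_def twist_def)
qed

lemma X_sol_jump:
  assumes w: "w \<noteq> 0" and z0: "z0 \<in> ray w"
  shows "\<exists>Xp\<in>Aut_hat C. \<exists>Xm\<in>Aut_hat C.
    tendsto_hat C (X_sol pr C Om Z) Xp (at_ccw z0) \<and>
    tendsto_hat C (X_sol pr C Om Z) Xm (at_cw z0) \<and>
    (\<forall>x\<in>ghat C. Xp x = Xm (AdS pr C Om Z (ray w) x))"
proof -
  have nz: "z0 \<noteq> 0" using w z0 by (auto simp: ray_def)
  have on_ray: "z0 \<in> ell Z \<gamma> \<longleftrightarrow> - Z \<gamma> \<in> ray w" for \<gamma>
    unfolding ell_def using z0 ray_ray self_in_ray by metis
  \<comment> \<open>One-sided limits are fixed tree by tree: they agree with the value off the root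
    ray and differ by minus the density on it.\<close>
  have "\<exists>PM. ((tree_G Z T \<longlongrightarrow> fst PM) (at_ccw z0)) \<and> ((tree_G Z T \<longlongrightarrow> snd PM) (at_cw z0)) \<and>
      (z0 \<notin> ell Z (rroot T) \<longrightarrow> fst PM = tree_G Z T z0 \<and> snd PM = tree_G Z T z0) \<and>
      (z0 \<in> ell Z (rroot T) \<longrightarrow> fst PM - snd PM = - tree_f Z T z0)" if T: "T \<in> trees" for T
  proof (cases "z0 \<in> ell Z (rroot T)")
    case True
    then show ?thesis
      using ray_cauchy_jump[OF tree_f_admissible[OF T], of z0] unfolding tree_G_eq ell_def
      by (metis fst_conv snd_conv)
  next
    case False
    then have "isCont (tree_G Z T) z0"
      using tree_G_differentiable[OF T nz] field_differentiable_imp_continuous_at by blast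
    then have "(tree_G Z T \<longlongrightarrow> tree_G Z T z0) (at z0)" by (simp add: isCont_def)
    then have "(tree_G Z T \<longlongrightarrow> tree_G Z T z0) (at z0 within S)" for S
      using tendsto_mono[OF at_le[of S UNIV]] by auto
    then show ?thesis using False unfolding at_ccw_def at_cw_def
      by (intro exI[of _ "(tree_G Z T z0, tree_G Z T z0)"]) auto
  qed
  then obtain PM where PM: "\<And>T. T \<in> trees \<Longrightarrow> (tree_G Z T \<longlongrightarrow> fst (PM T)) (at_ccw z0)"
    "\<And>T. T \<in> trees \<Longrightarrow> (tree_G Z T \<longlongrightarrow> snd (PM T)) (at_cw z0)"
    "\<And>T. T \<in> trees \<Longrightarrow> z0 \<notin> ell Z (rroot T) \<Longrightarrow> fst (PM T) = tree_G Z T z0 \<and> snd (PM T) = tree_G Z T z0"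
    "\<And>T. T \<in> trees \<Longrightarrow> z0 \<in> ell Z (rroot T) \<Longrightarrow> fst (PM T) - snd (PM T) = - tree_f Z T z0"
    by metis
  define Fp where "Fp T = fst (PM T)" for T
  define Fm where "Fm T = snd (PM T)" for T
  define c where "c \<alpha> = ray_factor Z \<alpha> z0" for \<alpha>
  have c: "c (a + b) = c a * c b" "c a \<noteq> 0" for a b
    by (simp_all add: c_def ray_factor_add ray_factor_nz)
  have c_lim: "((\<lambda>z. ray_factor Z \<alpha> z) \<longlongrightarrow> c \<alpha>) (at z0 within S)" for \<alpha> S
    unfolding c_def ray_factor_def using nz by (intro tendsto_intros)
  have lims: "tendsto_hat C (X_sol pr C Om Z) (sol c Fp) (at_ccw z0)"
    "tendsto_hat C (X_sol pr C Om Z) (sol c Fm) (at_cw z0)"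
    unfolding tendsto_hat_def X_sol_eq Fp_def Fm_def
    using PM(1,2) c_lim by (auto intro!: sol_tendsto simp: at_ccw_def at_cw_def)
  \<comment> \<open>The jump at the level of logarithms: log X^+ = log X^- + X^-(log of the Stokes
    factor). The minus sign of the tree jumps cancels the one in \<open>log_coeff\<close>.\<close>
  have jump: "log_coeff Fp \<alpha> \<eta> = log_coeff Fm \<alpha> \<eta> + sol c Fm (log_AdS (ray w) \<alpha>) \<eta>" for \<alpha> \<eta>
  proof (cases "\<eta> \<in> B")
    case True
    then obtain k where k: "\<eta> \<in> basis_le C k" using hat_obtain by blast
    let ?K = "{\<gamma> \<in> basis_le C k. DT Om \<gamma> \<noteq> 0 \<and> z0 \<in> ell Z \<gamma>}"
    let ?A = "{T. T \<in> trees \<and> tree_deg T = \<eta>}"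
    let ?h = "\<lambda>T. of_int (pr \<alpha> (rroot T)) * (of_rat (wt T) * tree_f Z T z0)"
    have "log_coeff Fp \<alpha> \<eta> - log_coeff Fm \<alpha> \<eta> =
        (\<Sum>T\<in>?A. - (of_int (pr \<alpha> (rroot T)) * of_rat (wt T) * (Fp T - Fm T)))"
      using True by (simp add: log_coeff_def sum_subtractf sum_negf algebra_simps)
    also have "\<dots> = (\<Sum>T\<in>?A. if z0 \<in> ell Z (rroot T) then ?h T else 0)"
      by (rule sum.cong) (use PM(3,4) in \<open>auto simp: Fp_def Fm_def\<close>)
    also have "\<dots> = (\<Sum>T | T \<in> ?A \<and> z0 \<in> ell Z (rroot T). ?h T)"
      using finite_trees[OF True] by (intro sum.inter_filter[symmetric]) simp
    also have "\<dots> = (\<Sum>\<gamma>\<in>?K. \<Sum>T | T \<in> {T \<in> ?A. z0 \<in> ell Z (rroot T)} \<and> rroot T = \<gamma>. ?h T)"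
    proof (rule sum.group[symmetric])
      show "rroot ` {T \<in> ?A. z0 \<in> ell Z (rroot T)} \<subseteq> ?K"
        using root_basis_le trees_root k by auto
      show "finite {T \<in> ?A. z0 \<in> ell Z (rroot T)}"
        by (rule finite_subset[OF _ finite_trees[OF True]]) auto
    qed (use finite_basis_le in auto)
    also have "\<dots> = (\<Sum>\<gamma>\<in>?K. of_int (pr \<alpha> \<gamma>) * (of_rat (DT Om \<gamma>) * tw_basis c (log_coeff Fm) \<gamma> \<eta>))"
    proof (rule sum.cong)
      fix \<gamma> assume \<gamma>: "\<gamma> \<in> ?K"
      have "(\<Sum>T | T \<in> {T \<in> ?A. z0 \<in> ell Z (rroot T)} \<and> rroot T = \<gamma>. ?h T) =
          (\<Sum>T | T \<in> trees \<and> tree_deg T = \<eta> \<and> rroot T = \<gamma>. of_int (pr \<alpha> \<gamma>) * (of_rat (wt T) * tree_f Z T z0))"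
        by (rule sum.cong) (use \<gamma> in auto)
      \<comment> \<open>All trees with root \<gamma> are summed at once. The clockwise limits are
        inserted for F because the Stokes factor is to be mapped by X^-.\<close>
      also have "\<dots> = of_int (pr \<alpha> \<gamma>) * (of_rat (DT Om \<gamma>) * tw_basis c (log_coeff Fm) \<gamma> \<eta>)"
        unfolding sum_distrib_left[symmetric] c_def[abs_def]
        using \<gamma> PM(3) by (subst trees_by_root[where F = Fm, OF _ _ True]) (auto simp: Fm_def)
      finally show "(\<Sum>T | T \<in> {T \<in> ?A. z0 \<in> ell Z (rroot T)} \<and> rroot T = \<gamma>. ?h T) =
          of_int (pr \<alpha> \<gamma>) * (of_rat (DT Om \<gamma>) * tw_basis c (log_coeff Fm) \<gamma> \<eta>)" .
    qed simp
    also have "\<dots> = (\<Sum>\<gamma>\<in>basis_le C k. log_AdS (ray w) \<alpha> \<gamma> * tw_basis c (log_coeff Fm) \<gamma> \<eta>)"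
      using finite_basis_le basis_le_subset_hat
      by (intro sum.mono_neutral_cong_left) (auto simp: log_AdS_def on_ray)
    also have "\<dots> = sol c Fm (log_AdS (ray w) \<alpha>) \<eta>" by (rule sol_eq_sum[OF k, symmetric])
    finally show ?thesis by (simp add: algebra_simps)
  next
    case False
    then show ?thesis by (simp add: log_coeff_def sol_def ghat_D)
  qed
  have "sol c Fp x = sol c Fm (AdS pr C Om Z (ray w) x)" for x
  proof -
    have props: "\<And>a b. log_coeff Fm (a + b) = (\<lambda>\<eta>. log_coeff Fm a \<eta> + log_coeff Fm b \<eta>)" "\<And>a. log_coeff Fm a 0 = 0"
      by (simp_all add: log_coeff_add)
    note hom = twist_hmult[of c "log_coeff Fm", OF c props] twist_hexp[of c "log_coeff Fm", OF c props]
      twist_at_0[of c "log_coeff Fm", OF c props]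
    \<comment> \<open>X^- is an algebra homomorphism compatible with exponentials, so the additive
      jump turns into composition on basis vectors; \<open>twist_comp_hext\<close> then extends it
      to all elements.\<close>
    have "sol c Fm (tw_basis (\<lambda>_. 1) (log_AdS (ray w)) \<alpha>) = tw_basis c (log_coeff Fp) \<alpha>" for \<alpha>
    proof -
      have "sol c Fm (tw_basis (\<lambda>_. 1) (log_AdS (ray w)) \<alpha>) =
          hmult C (tw_basis c (log_coeff Fm) \<alpha>) (hexp C (sol c Fm (log_AdS (ray w) \<alpha>)))"
        unfolding sol_def using hom(1) hom(2)[of "log_AdS (ray w) \<alpha>"] log_AdS_0[OF w]
        by (subst tw_basis_def) (simp add: twist_be)
      also have "\<dots> = hmult C (\<lambda>\<eta>. c \<alpha> * be C \<alpha> \<eta>)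
          (hmult C (hexp C (log_coeff Fm \<alpha>)) (hexp C (sol c Fm (log_AdS (ray w) \<alpha>))))"
        by (simp add: tw_basis_def hmult_assoc)
      also have "hmult C (hexp C (log_coeff Fm \<alpha>)) (hexp C (sol c Fm (log_AdS (ray w) \<alpha>))) =
          hexp C (log_coeff Fp \<alpha>)"
        unfolding jump[abs_def] using hom(3) log_AdS_0[OF w] by (subst hexp_add) (simp_all add: sol_def)
      finally show ?thesis by (simp add: tw_basis_def)
    qed
    then show ?thesis
      unfolding AdS_eq[OF w] sol_def twist_def[of "\<lambda>_. 1"] twist_comp_hext[OF lower_tw_basis]
      by (simp add: twist_def)
  qed
  then show ?thesis using lims sol_Aut[OF c, where F = Fp] sol_Aut[OF c, where F = Fm] by blast
qed

end

theorem lemma3p10: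
  fixes pr :: "'n::finite lat \<Rightarrow> 'n lat \<Rightarrow> int"
    and C :: "'n lat set"
    and Om :: "'n lat \<Rightarrow> rat"
    and Z :: "'n lat \<Rightarrow> complex"
    and H :: "complex set"
  assumes form: "skew_form pr"
    and cone: "strictly_convex_cone C"
    and fin_dim: "\<And>k. k \<ge> 1 \<Longrightarrow> finite (basis_le C k)"
    and data: "stability_data Om Z"
    and pos: "positive_data C Om"
    and gen: "generic_data pr Om Z"
    and half: "half_plane H"
    and rays: "\<And>\<gamma>. DT Om \<gamma> \<noteq> 0 \<Longrightarrow> ell Z \<gamma> \<subseteq> H"
  shows
    "(\<forall>z\<in>off_rays Om Z UNIV. X_sol pr C Om Z z \<in> Aut_hat C) \<and>
     (\<forall>k\<ge>1. \<forall>x\<in>ghat C. \<forall>\<gamma>\<in>basis_le C k.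
        (\<lambda>z. X_sol pr C Om Z z x \<gamma>) holomorphic_on off_rays Om Z (basis_le C k)) \<and>
     (\<forall>\<alpha>\<in>C. Z \<alpha> \<noteq> 0 \<and> (\<forall>\<gamma>. DT Om \<gamma> \<noteq> 0 \<and> ell Z \<gamma> = ell Z \<alpha> \<longrightarrow> pr \<gamma> \<alpha> = 0) \<longrightarrow>
        (\<exists>h. (\<forall>z. h z \<in> ghat C) \<and>
             (\<forall>z\<in>off_rays Om Z UNIV. h z = X_sol pr C Om Z z (be C \<alpha>)) \<and>
             (\<forall>k\<ge>1. \<exists>U. open U \<and> ell Z \<alpha> \<subseteq> U \<and>
                (\<forall>\<gamma>\<in>basis_le C k. (\<lambda>z. h z \<gamma>) holomorphic_on U)))) \<and>
     (\<forall>w. w \<noteq> 0 \<and> ray w \<subseteq> H \<longrightarrow> (\<forall>z0\<in>ray w.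
        \<exists>Xp\<in>Aut_hat C. \<exists>Xm\<in>Aut_hat C.
          tendsto_hat C (X_sol pr C Om Z) Xp (at_ccw z0) \<and>
          tendsto_hat C (X_sol pr C Om Z) Xm (at_cw z0) \<and>
          (\<forall>x\<in>ghat C. Xp x = Xm (AdS pr C Om Z (ray w) x)))) \<and>
     (\<exists>g\<in>Aut_hat C.
        (\<forall>k\<ge>1. \<forall>u\<in>off_rays Om Z (basis_le C k). cmod u = 1 \<longrightarrow>
           (\<forall>x\<in>ghat C. \<forall>\<gamma>\<in>basis_le C k.
              ((\<lambda>z. X_sol pr C Om Z z (exp_Z Z (- 1 / z) x) \<gamma>) \<longlongrightarrow> g x \<gamma>) (at_0_dir u))) \<and>
        (\<forall>\<alpha>\<in>C. g (be C \<alpha>) = hmult C (be C \<alpha>)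
           (hexp C (pair_tensor pr \<alpha> (neg_tree_sum pr Om (treeG0 C Z))))))"
proof -
  interpret stability_algebra C pr Om Z
    by unfold_locales (fact cone fin_dim form data pos gen)+
  have asym: "asymptotic \<in> Aut_hat C" unfolding asymptotic_def by (rule sol_Aut) auto
  show ?thesis
  proof (intro conjI, goal_cases)
    case 1
    show ?case using X_sol_Aut by blast
  next
    case 2
    show ?case using X_sol_holomorphic by blast
  next
    case 3
    show ?case
    proof (intro ballI impI, goal_cases)
      case (1 \<alpha>)
      have "X_sol pr C Om Z z (be C \<alpha>) \<in> ghat C" for z unfolding X_sol_eq sol_def by simp
      \<comment> \<open>The extension is X itself: on the ray of \<alpha> the tree functions rooted
        there enter with coefficient zero, so their values on the ray do not matter.\<close>
      then show ?case
        using 1 X_sol_extends[of \<alpha>] by (intro exI[of _ "\<lambda>z. X_sol pr C Om Z z (be C \<alpha>)"]) blast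
    qed
  next
    case 4
    show ?case by (intro allI impI ballI X_sol_jump) auto
  next
    case 5
    show ?case using X_sol_asymptotic asymptotic_be by (intro bexI[OF _ asym]) blast
  qed
qed

end
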